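(* Let $\lambda\in\mathbb C\setminus[-1,1]$ and let $\alpha=\frac{1}{2\pi i}\log\frac{\lambda-1}{\lambda+1}$, where $\log z=\log|z|+i\arg z$ with $\arg z\in\,]-\pi,\pi]$ (so that $|\Re(\alpha)|<1/2$). Then $S_{\mathbb R^+}-\lambda I_{\mathbb R^+}$ is invertible in $L_2(\mathbb R^+)$ and, assuming $-1/2<\Re(\alpha)<0$, for $f\in L_2(\mathbb R^+)$ and $t>0$, $$(S_{\mathbb R^+}-\lambda I_{\mathbb R^+})^{-1}f(t)=\frac{1}{\lambda^2-1}\left[\lambda f(t)-\frac{t^\alpha}{i\pi}\int_{\mathbb R^+}\frac{f(s)}{(t-s)\,s^\alpha}\,ds\right],$$ where the integral is understood as a Cauchy principal value.
   Context: $S_{\mathbb R^+}:L_2(\mathbb R^+)\to L_2(\mathbb R^+)$ is the bounded singular integral operator $S_{\mathbb R^+}\phi(x)=\frac{1}{\pi i}\int_{\mathbb R^+}\frac{\phi(t)}{t-x}\,dt$, $x\in\mathbb R^+=(0,\infty)$, the integral being a Cauchy principal value, and $I_{\mathbb R^+}$ is the identity on $L_2(\mathbb R^+)$. For $t>0$, $t^\alpha=e^{\alpha\log t}$ with real $\log t$.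
   Formalization: The prefactor 1/(λ²−1) in the inverse formula is replaced by 1/(1−λ²): as printed the right-hand side is minus the inverse (e.g. λ=−iR, R large, where the inverse is ≈ −1/λ but the printed formula is ≈ +1/λ). *)

theory Defs
  imports "HOL-Analysis.Analysis"
begin

abbreviation Rplus :: "real measure" where
  "Rplus \<equiv> lebesgue_on {0<..}"

definition L2_fun :: "(real \<Rightarrow> complex) set" where
  "L2_fun = {f \<in> borel_measurable Rplus. integrable Rplus (\<lambda>t. (cmod (f t))\<^sup>2)}"

lemma L2_fun_add:
  assumes "f \<in> L2_fun" "g \<in> L2_fun"
  shows "(\<lambda>t. f t + g t) \<in> L2_fun"
proof -
  have m[measurable]: "f \<in> borel_measurable Rplus" "g \<in> borel_measurable Rplus"
    and i: "integrable Rplus (\<lambda>t. (cmod (f t))\<^sup>2)" "integrable Rplus (\<lambda>t. (cmod (g t))\<^sup>2)"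
    using assms by (auto simp: L2_fun_def)
  have "integrable Rplus (\<lambda>t. (cmod (f t + g t))\<^sup>2)"
  proof (rule Bochner_Integration.integrable_bound)
    show "integrable Rplus (\<lambda>t. 2 * (cmod (f t))\<^sup>2 + 2 * (cmod (g t))\<^sup>2)"
      using i by (intro Bochner_Integration.integrable_add integrable_mult_right) auto
    have "(cmod (f t + g t))\<^sup>2 \<le> 2 * (cmod (f t))\<^sup>2 + 2 * (cmod (g t))\<^sup>2" for t
    proof -
      have "(cmod (f t + g t))\<^sup>2 \<le> (cmod (f t) + cmod (g t))\<^sup>2"
        by (intro power_mono norm_triangle_ineq) auto
      also have "\<dots> \<le> 2 * (cmod (f t))\<^sup>2 + 2 * (cmod (g t))\<^sup>2"
        using sum_squares_bound[of "cmod (f t)" "cmod (g t)"] by (simp add: power2_sum)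
      finally show ?thesis .
    qed
    then show "AE t in Rplus. norm ((cmod (f t + g t))\<^sup>2)
        \<le> norm (2 * (cmod (f t))\<^sup>2 + 2 * (cmod (g t))\<^sup>2)"
      by (intro AE_I2) (simp add: order_trans[OF _ abs_ge_self])
  qed measurable
  then show ?thesis by (simp add: L2_fun_def)
qed

lemma L2_fun_cmult:
  assumes "f \<in> L2_fun"
  shows "(\<lambda>t. c * f t) \<in> L2_fun"
  using assms by (auto simp: L2_fun_def norm_mult power_mult_distrib)

lemma L2_fun_zero: "(\<lambda>t. 0) \<in> L2_fun"
  by (simp add: L2_fun_def)

quotient_type L2 = "real \<Rightarrow> complex" /
  partial: "\<lambda>f g. f \<in> L2_fun \<and> g \<in> L2_fun \<and> (AE t in Rplus. f t = g t)"
proof (rule part_equivpI)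
  show "\<exists>f. f \<in> L2_fun \<and> f \<in> L2_fun \<and> (AE t in Rplus. f t = f t)"
    using L2_fun_zero by auto
  show "symp (\<lambda>f g. f \<in> L2_fun \<and> g \<in> L2_fun \<and> (AE t in Rplus. f t = g t))"
    by (rule sympI) (auto simp: eq_commute)
  show "transp (\<lambda>f g. f \<in> L2_fun \<and> g \<in> L2_fun \<and> (AE t in Rplus. f t = g t))"
  proof (rule transpI)
    fix f g h :: "real \<Rightarrow> complex"
    assume 1: "f \<in> L2_fun \<and> g \<in> L2_fun \<and> (AE t in Rplus. f t = g t)"
      and 2: "g \<in> L2_fun \<and> h \<in> L2_fun \<and> (AE t in Rplus. g t = h t)"
    from 1 2 have "AE t in Rplus. f t = g t" "AE t in Rplus. g t = h t" by blast+
    then have "AE t in Rplus. f t = h t" by eventually_elim simp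
    with 1 2 show "f \<in> L2_fun \<and> h \<in> L2_fun \<and> (AE t in Rplus. f t = h t)" by blast
  qed
qed

lift_definition scaleC_L2 :: "complex \<Rightarrow> L2 \<Rightarrow> L2" is "\<lambda>c f t. c * f t"
  by (auto simp: L2_fun_cmult)

definition L2_norm_fun :: "(real \<Rightarrow> complex) \<Rightarrow> real" where
  "L2_norm_fun f = sqrt (LINT t|Rplus. (cmod (f t))\<^sup>2)"

lemma Cauchy_Schwarz_Rplus:
  assumes "f \<in> L2_fun" "g \<in> L2_fun"
  shows "integrable Rplus (\<lambda>t. cmod (f t) * cmod (g t))"
    and "(LINT t|Rplus. cmod (f t) * cmod (g t)) \<le> L2_norm_fun f * L2_norm_fun g"
proof -
  have m[measurable]: "f \<in> borel_measurable Rplus" "g \<in> borel_measurable Rplus"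
    and i: "integrable Rplus (\<lambda>t. (cmod (f t))\<^sup>2)" "integrable Rplus (\<lambda>t. (cmod (g t))\<^sup>2)"
    using assms by (auto simp: L2_fun_def)
  show ifg: "integrable Rplus (\<lambda>t. cmod (f t) * cmod (g t))"
  proof (rule Bochner_Integration.integrable_bound)
    show "integrable Rplus (\<lambda>t. (cmod (f t))\<^sup>2 + (cmod (g t))\<^sup>2)"
      using i by (intro Bochner_Integration.integrable_add) auto
    have "cmod (f t) * cmod (g t) \<le> (cmod (f t))\<^sup>2 + (cmod (g t))\<^sup>2" for t
    proof -
      have "0 \<le> cmod (f t) * cmod (g t)" by simp
      then show ?thesis
        using sum_squares_bound[of "cmod (f t)" "cmod (g t)"] by linarith
    qed
    then show "AE t in Rplus. norm (cmod (f t) * cmod (g t))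
        \<le> norm ((cmod (f t))\<^sup>2 + (cmod (g t))\<^sup>2)"
      by (intro AE_I2) simp
  qed measurable
  define A where "A = (LINT t|Rplus. (cmod (f t))\<^sup>2)"
  define B where "B = (LINT t|Rplus. (cmod (g t))\<^sup>2)"
  define C where "C = (LINT t|Rplus. cmod (f t) * cmod (g t))"
  have nn: "A \<ge> 0" "B \<ge> 0" "C \<ge> 0"
    unfolding A_def B_def C_def by (auto intro!: Bochner_Integration.integral_nonneg)
  have q: "0 \<le> r\<^sup>2 * A - 2 * r * s * C + s\<^sup>2 * B" for r s :: real
  proof -
    have "0 \<le> (LINT t|Rplus. (r * cmod (f t) - s * cmod (g t))\<^sup>2)"
      by (intro Bochner_Integration.integral_nonneg) auto
    also have "\<dots> = (LINT t|Rplus. r\<^sup>2 * (cmod (f t))\<^sup>2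
        - 2 * r * s * (cmod (f t) * cmod (g t)) + s\<^sup>2 * (cmod (g t))\<^sup>2)"
      by (intro Bochner_Integration.integral_cong) (auto simp: power2_eq_square algebra_simps)
    also have "\<dots> = r\<^sup>2 * A - 2 * r * s * C + s\<^sup>2 * B"
      unfolding A_def B_def C_def using i ifg
      by (subst Bochner_Integration.integral_add Bochner_Integration.integral_diff,
          simp, simp)+ simp
    finally show ?thesis .
  qed
  have "C\<^sup>2 \<le> A * B"
  proof (cases "B = 0")
    case True
    show ?thesis
    proof (cases "C = 0")
      case False
      then have C: "C > 0" using nn by simp
      have "0 \<le> A - 2 * ((A + 1) / C) * C" using q[of 1 "(A + 1) / C"] True by simp
      then have "0 \<le> A - 2 * (A + 1)" using C by simp
      then show ?thesis using nn by simp
    qed (use True in simp)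
  next
    case False
    then have B: "B > 0" using nn by simp
    have "0 \<le> B * (A * B - C\<^sup>2)"
      using q[of B C] by (simp add: power2_eq_square algebra_simps)
    then show ?thesis using B by (simp add: zero_le_mult_iff)
  qed
  then have "C \<le> sqrt (A * B)" by (simp add: real_le_rsqrt)
  then show "(LINT t|Rplus. cmod (f t) * cmod (g t)) \<le> L2_norm_fun f * L2_norm_fun g"
    by (simp add: L2_norm_fun_def A_def B_def C_def real_sqrt_mult)
qed

lemma L2_norm_fun_triangle:
  assumes "f \<in> L2_fun" "g \<in> L2_fun"
  shows "L2_norm_fun (\<lambda>t. f t + g t) \<le> L2_norm_fun f + L2_norm_fun g"
proof -
  have i: "integrable Rplus (\<lambda>t. (cmod (f t))\<^sup>2)" "integrable Rplus (\<lambda>t. (cmod (g t))\<^sup>2)"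
    "integrable Rplus (\<lambda>t. (cmod (f t + g t))\<^sup>2)"
    using assms L2_fun_add[OF assms] by (auto simp: L2_fun_def)
  note CS = Cauchy_Schwarz_Rplus[OF assms]
  have nn: "0 \<le> (LINT t|Rplus. (cmod (f t))\<^sup>2)" "0 \<le> (LINT t|Rplus. (cmod (g t))\<^sup>2)"
    by (auto intro!: Bochner_Integration.integral_nonneg)
  have "(LINT t|Rplus. (cmod (f t + g t))\<^sup>2)
      \<le> (LINT t|Rplus. (cmod (f t))\<^sup>2 + 2 * (cmod (f t) * cmod (g t)) + (cmod (g t))\<^sup>2)"
  proof (rule Bochner_Integration.integral_mono)
    fix t
    have "(cmod (f t + g t))\<^sup>2 \<le> (cmod (f t) + cmod (g t))\<^sup>2"
      by (intro power_mono norm_triangle_ineq) auto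
    then show "(cmod (f t + g t))\<^sup>2
        \<le> (cmod (f t))\<^sup>2 + 2 * (cmod (f t) * cmod (g t)) + (cmod (g t))\<^sup>2"
      by (simp add: power2_sum algebra_simps)
  qed (use i CS in auto)
  also have "\<dots> = (LINT t|Rplus. (cmod (f t))\<^sup>2)
      + 2 * (LINT t|Rplus. cmod (f t) * cmod (g t)) + (LINT t|Rplus. (cmod (g t))\<^sup>2)"
    using i CS by simp
  also have "\<dots> \<le> (L2_norm_fun f)\<^sup>2 + 2 * (L2_norm_fun f * L2_norm_fun g) + (L2_norm_fun g)\<^sup>2"
    using CS(2) nn by (simp add: L2_norm_fun_def)
  also have "\<dots> = (L2_norm_fun f + L2_norm_fun g)\<^sup>2"
    by (simp add: power2_sum)
  finally show ?thesis
    unfolding L2_norm_fun_def[of "\<lambda>t. f t + g t"]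
    by (intro real_le_lsqrt) (auto simp: L2_norm_fun_def nn)
qed

instantiation L2 :: real_normed_vector
begin

lift_definition zero_L2 :: L2 is "\<lambda>t. 0"
  by (auto simp: L2_fun_zero)

lift_definition plus_L2 :: "L2 \<Rightarrow> L2 \<Rightarrow> L2" is "\<lambda>f g t. f t + g t"
  by (auto simp: L2_fun_add)

lift_definition norm_L2 :: "L2 \<Rightarrow> real" is L2_norm_fun
proof -
  fix f g :: "real \<Rightarrow> complex"
  assume *: "f \<in> L2_fun \<and> g \<in> L2_fun \<and> (AE t in Rplus. f t = g t)"
  then have "AE t in Rplus. (cmod (f t))\<^sup>2 = (cmod (g t))\<^sup>2"
    by auto
  then show "L2_norm_fun f = L2_norm_fun g"
    using * unfolding L2_norm_fun_def L2_fun_def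
    by (intro arg_cong[where f = sqrt] integral_cong_AE) auto
qed

definition uminus_L2 :: "L2 \<Rightarrow> L2" where
  "uminus_L2 f = scaleC_L2 (-1) f"

definition minus_L2 :: "L2 \<Rightarrow> L2 \<Rightarrow> L2" where
  "minus_L2 f g = f + - g"

definition scaleR_L2 :: "real \<Rightarrow> L2 \<Rightarrow> L2" where
  "scaleR_L2 r f = scaleC_L2 (of_real r) f"

definition sgn_L2 :: "L2 \<Rightarrow> L2" where
  "sgn_L2 f = inverse (norm f) *\<^sub>R f"

definition dist_L2 :: "L2 \<Rightarrow> L2 \<Rightarrow> real" where
  "dist_L2 f g = norm (f - g)"

definition uniformity_L2 :: "(L2 \<times> L2) filter" where
  "uniformity_L2 = (INF e\<in>{0<..}. principal {(x, y). dist x y < e})"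

definition open_L2 :: "L2 set \<Rightarrow> bool" where
  "open_L2 U = (\<forall>x\<in>U. \<forall>\<^sub>F (x', y) in uniformity. x' = x \<longrightarrow> y \<in> U)"

instance
proof
  fix f g h :: L2 and a b :: real and U :: "L2 set"
  show "f + g + h = f + (g + h)"
    by transfer (auto simp: L2_fun_add add.assoc)
  show "f + g = g + f"
    by transfer (auto simp: L2_fun_add add.commute)
  show "0 + f = f"
    by transfer auto
  show "- f + f = 0"
    unfolding uminus_L2_def by transfer (use L2_fun_cmult[of _ "-1"] in \<open>auto simp: L2_fun_zero\<close>)
  show "f - g = f + - g"
    by (simp add: minus_L2_def)
  show "a *\<^sub>R (f + g) = a *\<^sub>R f + a *\<^sub>R g"
    unfolding scaleR_L2_def
    by transfer (auto simp: L2_fun_add L2_fun_cmult distrib_left)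
  show "(a + b) *\<^sub>R f = a *\<^sub>R f + b *\<^sub>R f"
    unfolding scaleR_L2_def
    by transfer (use L2_fun_cmult in \<open>auto simp: L2_fun_add distrib_right\<close>)
  show "a *\<^sub>R b *\<^sub>R f = (a * b) *\<^sub>R f"
    unfolding scaleR_L2_def
    by transfer (use L2_fun_cmult in \<open>auto simp: mult.assoc\<close>)
  show "1 *\<^sub>R f = f"
    unfolding scaleR_L2_def by transfer auto
  show "dist f g = norm (f - g)"
    by (simp add: dist_L2_def)
  show "sgn f = inverse (norm f) *\<^sub>R f"
    by (simp add: sgn_L2_def)
  show "uniformity = (INF e\<in>{0<..}. principal {(x :: L2, y). dist x y < e})"
    by (simp add: uniformity_L2_def)
  show "open U = (\<forall>x\<in>U. \<forall>\<^sub>F (x', y) in uniformity. x' = x \<longrightarrow> y \<in> U)"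
    by (simp add: open_L2_def)
  show "(norm f = 0) = (f = 0)"
  proof transfer
    fix f :: "real \<Rightarrow> complex"
    assume *: "f \<in> L2_fun \<and> f \<in> L2_fun \<and> (AE t in Rplus. f t = f t)"
    then have "integrable Rplus (\<lambda>t. (cmod (f t))\<^sup>2)" by (simp add: L2_fun_def)
    then have "(LINT t|Rplus. (cmod (f t))\<^sup>2) = 0 \<longleftrightarrow> (AE t in Rplus. (cmod (f t))\<^sup>2 = 0)"
      by (intro integral_nonneg_eq_0_iff_AE) auto
    then show "(L2_norm_fun f = 0) = (f \<in> L2_fun \<and> (\<lambda>t. 0) \<in> L2_fun \<and> (AE t in Rplus. f t = 0))"
      using * by (simp add: L2_norm_fun_def L2_fun_zero)
  qed
  show "norm (f + g) \<le> norm f + norm g"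
    by transfer (auto intro: L2_norm_fun_triangle)
  show "norm (a *\<^sub>R f) = \<bar>a\<bar> * norm f"
    unfolding scaleR_L2_def
    by transfer (auto simp: L2_norm_fun_def norm_mult power_mult_distrib real_sqrt_mult)
qed

end

text \<open>The excluded neighbourhoods of the singularity \<open>x\<close> are symmetric; away from \<open>x\<close>, and in
  particular at \<open>0\<close> and at infinity, the integral has to converge absolutely.\<close>

definition has_principal_value :: "(real \<Rightarrow> complex) \<Rightarrow> real \<Rightarrow> complex \<Rightarrow> bool" where
  "has_principal_value g x l \<longleftrightarrow>
     (\<forall>\<epsilon>>0. set_integrable lebesgue {t. 0 < t \<and> \<epsilon> < \<bar>t - x\<bar>} g) \<and>
     ((\<lambda>\<epsilon>. LINT t:{t. 0 < t \<and> \<epsilon> < \<bar>t - x\<bar>}|lebesgue. g t) \<longlongrightarrow> l) (at_right 0)"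

definition principal_value :: "(real \<Rightarrow> complex) \<Rightarrow> real \<Rightarrow> complex" where
  "principal_value g x = (THE l. has_principal_value g x l)"

text \<open>For square-integrable \<open>\<phi>\<close> the principal value exists for almost every \<open>x\<close>; neither the
  null set of exceptional \<open>x\<close> nor the choice of the representative affects the class.\<close>

definition S_Rplus :: "L2 \<Rightarrow> L2" where
  "S_Rplus \<phi> = abs_L2 (\<lambda>x. 1 / (of_real pi * \<i>) *
     principal_value (\<lambda>t. rep_L2 \<phi> t / of_real (t - x)) x)"

text \<open>\<open>bounded_linear\<close> is only real linearity, hence the second conjunct.\<close>

definition bounded_operator :: "(L2 \<Rightarrow> L2) \<Rightarrow> bool" where
  "bounded_operator T \<longleftrightarrow>
     bounded_linear T \<and> (\<forall>c \<phi>. T (scaleC_L2 c \<phi>) = scaleC_L2 c (T \<phi>))"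

definition invertible_operator :: "(L2 \<Rightarrow> L2) \<Rightarrow> bool" where
  "invertible_operator T \<longleftrightarrow>
     bounded_operator T \<and> (\<exists>R. bounded_operator R \<and> R \<circ> T = id \<and> T \<circ> R = id)"

end

theory Submission
  imports Defs "HOL-Complex_Analysis.Complex_Analysis" "HOL-Probability.Sinc_Integral"
begin

text \<open>
  Extend \<open>f\<close> by \<open>0\<close> to the line and let \<open>D\<^sub>\<epsilon> f(x) = 1/(2\<pi>\<i>) \<integral> f(t)/(t - x - \<i>\<epsilon>) dt\<close>. These operators are
  self-adjoint, \<open>D\<^sub>\<epsilon> D\<^sub>\<delta> = D\<^bsub>\<epsilon>+\<delta>\<^esub>\<close>, and the Poisson integrals satisfy \<open>P\<^sub>\<delta> D\<^sub>\<epsilon> = D\<^bsub>\<epsilon>+\<delta>\<^esub>\<close>, so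
  \<open>\<parallel>D\<^sub>\<epsilon> f\<parallel>\<^sup>2 = \<langle>f, D\<^bsub>2\<epsilon>\<^esub> f\<rangle>\<close> is bounded and monotone in \<open>\<epsilon>\<close>; hence \<open>D\<^sub>\<epsilon> f\<close> converges in \<open>L\<^sub>2\<close> to some \<open>Df\<close> with
  \<open>D\<^sub>\<epsilon> f = P\<^sub>\<epsilon> Df\<close>. Lebesgue points of \<open>f\<close> and \<open>Df\<close>, obtained from the Hardy-Littlewood maximal inequality,
  turn this into convergence almost everywhere, including that of the truncated integrals:
  the principal value of \<open>f\<close> is \<open>\<pi>\<i> (2 Df - f)\<close>.

  On the half-line the kernel weighted by \<open>(x/t)\<^sup>\<alpha>\<close>, \<open>\<bar>Re \<alpha>\<bar> < 1/2\<close>, differs from the unweighted one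
  by an absolutely convergent kernel, bounded by Schur's test. This gives bounded operators
  \<open>W\<^sub>\<alpha>\<close> with \<open>S = W\<^sub>0 - 1\<close>. The integral of \<open>s\<^sup>\<gamma>/((s - z)(s - w))\<close> over the half-line, computed by residues in
  the strip \<open>0 \<le> Im u \<le> 2\<pi>\<close> with \<open>s = exp u\<close>, yields \<open>W\<^sub>\<beta> W\<^sub>\<alpha> = \<kappa> W\<^sub>\<alpha> + (2 - \<kappa>) W\<^sub>\<beta>\<close> with
  \<open>\<kappa> = 2/(1 - exp(2\<pi>\<i>(\<alpha> - \<beta>)))\<close>; with \<open>\<beta> = 0\<close> and with the roles exchanged this is the inversion formula.
\<close>


section \<open>Square-integrable functions on the line\<close>

text \<open>The kernel 1/(t - x) is not absolutely integrable near t = x, and compositions of its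
  truncations are unwieldy. All identities are therefore proved for 1/(t - x - i eps), where a
  composition is an integral against two simple poles and returns a kernel of the same family;
  truncations are compared with these only through an error dominated by the Poisson kernel. The
  energy identity takes the place of Plancherel's theorem. With weights the family is still closed:
  as a function of the middle variable s the product of two weighted kernels is s^(\<alpha>-\<beta>)
  over two simple factors. Its residues carry z^(\<alpha>-\<beta>) and w^(\<alpha>-\<beta>), and
  such a power turns one weight into the other. So a product of two weighted operators is a
  combination of these two operators, and inverting S - \<lambda> is linear algebra. The order of
  limits matters: the inner regularisation is removed first, weakly against a fixed
  square-integrable pole kernel, and the outer one afterwards, almost everywhere. Functions are
  Borel on the whole line and vanish on t \<le> 0; classes appear only in the last section.\<close>

definition sq_integrable :: "(real \<Rightarrow> complex) \<Rightarrow> bool" where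
  "sq_integrable f \<longleftrightarrow> f \<in> borel_measurable borel \<and> integrable lborel (\<lambda>t. (cmod (f t))\<^sup>2)"

definition L2nrm :: "(real \<Rightarrow> complex) \<Rightarrow> real" where
  "L2nrm f = sqrt (LBINT t. (cmod (f t))\<^sup>2)"

lemma L2nrm_nonneg [simp]: "0 \<le> L2nrm f"
  by (simp add: L2nrm_def)

lemma sq_integrable_measurable: "sq_integrable f \<Longrightarrow> f \<in> borel_measurable borel"
  by (simp add: sq_integrable_def)

lemma L2nrm_sq: "(L2nrm f)\<^sup>2 = (LBINT t. (cmod (f t))\<^sup>2)"
  by (simp add: L2nrm_def)

lemma nn_integral_sq:
  "sq_integrable f \<Longrightarrow> (\<integral>\<^sup>+t. ennreal ((cmod (f t))\<^sup>2) \<partial>lborel) = ennreal ((L2nrm f)\<^sup>2)"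
  unfolding sq_integrable_def L2nrm_sq by (intro nn_integral_eq_integral) auto

lemma sq_integrableI:
  assumes [measurable]: "f \<in> borel_measurable borel"
    and le: "(\<integral>\<^sup>+t. ennreal ((cmod (f t))\<^sup>2) \<partial>lborel) \<le> ennreal (C\<^sup>2)"
  shows "sq_integrable f" and "0 \<le> C \<Longrightarrow> L2nrm f \<le> C"
proof -
  show s: "sq_integrable f"
    unfolding sq_integrable_def
    using le_less_trans[OF le ennreal_less_top] by (auto intro!: integrableI_bounded)
  show "L2nrm f \<le> C" if "0 \<le> C"
    using le nn_integral_sq[OF s] that by (auto simp: power2_le_iff_abs_le)
qed

lemma sq_integrableI_finite:
  assumes [measurable]: "f \<in> borel_measurable borel"
    and "(\<integral>\<^sup>+t. ennreal ((cmod (f t))\<^sup>2) \<partial>lborel) < \<infinity>"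
  shows "sq_integrable f"
  unfolding sq_integrable_def using assms by (auto intro!: integrableI_bounded)

lemma sq_integrable_mono:
  assumes "sq_integrable g" and [measurable]: "f \<in> borel_measurable borel"
    and "AE t in lborel. cmod (f t) \<le> cmod (g t)"
  shows "sq_integrable f" "L2nrm f \<le> L2nrm g"
proof -
  have "(\<integral>\<^sup>+t. ennreal ((cmod (f t))\<^sup>2) \<partial>lborel) \<le> (\<integral>\<^sup>+t. ennreal ((cmod (g t))\<^sup>2) \<partial>lborel)"
    using assms(3) by (intro nn_integral_mono_AE) (auto simp: power_mono)
  also have "\<dots> = ennreal ((L2nrm g)\<^sup>2)" by (rule nn_integral_sq[OF assms(1)])
  finally show "sq_integrable f" "L2nrm f \<le> L2nrm g" by (auto intro: sq_integrableI)
qed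

lemma sq_integrable_cmult:
  "sq_integrable f \<Longrightarrow> sq_integrable (\<lambda>t. c * f t)"
  by (auto simp: sq_integrable_def norm_mult power_mult_distrib)

lemma L2nrm_cmult: "L2nrm (\<lambda>t. c * f t) = cmod c * L2nrm f"
  by (simp add: L2nrm_def norm_mult power_mult_distrib real_sqrt_mult)

lemma sq_integrable_cnj: "sq_integrable f \<Longrightarrow> sq_integrable (\<lambda>t. cnj (f t))"
  by (auto simp: sq_integrable_def intro: borel_measurable_continuous_onI[THEN measurable_compose[rotated]]
      intro!: continuous_intros)

lemma L2nrm_cnj [simp]: "L2nrm (\<lambda>t. cnj (f t)) = L2nrm f"
  by (simp add: L2nrm_def)

lemma sq_integrable_add:
  assumes "sq_integrable f" "sq_integrable g"
  shows "sq_integrable (\<lambda>t. f t + g t)"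
proof -
  have m[measurable]: "f \<in> borel_measurable borel" "g \<in> borel_measurable borel"
    and i: "integrable lborel (\<lambda>t. (cmod (f t))\<^sup>2)" "integrable lborel (\<lambda>t. (cmod (g t))\<^sup>2)"
    using assms by (auto simp: sq_integrable_def)
  have "integrable lborel (\<lambda>t. (cmod (f t + g t))\<^sup>2)"
  proof (rule Bochner_Integration.integrable_bound)
    show "integrable lborel (\<lambda>t. 2 * (cmod (f t))\<^sup>2 + 2 * (cmod (g t))\<^sup>2)"
      using i by (intro Bochner_Integration.integrable_add integrable_mult_right) auto
    have "(cmod (f t + g t))\<^sup>2 \<le> 2 * (cmod (f t))\<^sup>2 + 2 * (cmod (g t))\<^sup>2" for t
    proof -
      have "(cmod (f t + g t))\<^sup>2 \<le> (cmod (f t) + cmod (g t))\<^sup>2"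
        by (intro power_mono norm_triangle_ineq) auto
      also have "\<dots> \<le> 2 * (cmod (f t))\<^sup>2 + 2 * (cmod (g t))\<^sup>2"
        using sum_squares_bound[of "cmod (f t)" "cmod (g t)"] by (simp add: power2_sum)
      finally show ?thesis .
    qed
    then show "AE t in lborel. norm ((cmod (f t + g t))\<^sup>2)
        \<le> norm (2 * (cmod (f t))\<^sup>2 + 2 * (cmod (g t))\<^sup>2)"
      by (intro AE_I2) (simp add: order_trans[OF _ abs_ge_self])
  qed measurable
  then show ?thesis by (simp add: sq_integrable_def)
qed

lemma sq_integrable_diff:
  assumes "sq_integrable f" "sq_integrable g"
  shows "sq_integrable (\<lambda>t. f t - g t)"
  using sq_integrable_add[OF assms(1) sq_integrable_cmult[OF assms(2), of "-1"]] by simp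

lemma L2_Cauchy_Schwarz:
  assumes "sq_integrable f" "sq_integrable g"
  shows "integrable lborel (\<lambda>t. f t * g t)"
    and "(LBINT t. cmod (f t * g t)) \<le> L2nrm f * L2nrm g"
    and "cmod (LBINT t. f t * g t) \<le> L2nrm f * L2nrm g"
proof -
  have m[measurable]: "f \<in> borel_measurable borel" "g \<in> borel_measurable borel"
    using assms by (auto simp: sq_integrable_def)
  define A where "A = (\<integral>\<^sup>+t. ennreal (cmod (f t * g t)) \<partial>lborel)"
  have "A\<^sup>2 \<le> ennreal ((L2nrm f)\<^sup>2) * ennreal ((L2nrm g)\<^sup>2)"
    using Cauchy_Schwarz_nn_integral[of "\<lambda>t. ennreal (cmod (f t))" lborel "\<lambda>t. ennreal (cmod (g t))"]
      nn_integral_sq[OF assms(1)] nn_integral_sq[OF assms(2)]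
    by (simp add: A_def norm_mult ennreal_mult' ennreal_power)
  also have "\<dots> = (ennreal (L2nrm f * L2nrm g))\<^sup>2"
    by (simp add: ennreal_mult[symmetric] ennreal_power power_mult_distrib)
  finally have le: "A \<le> ennreal (L2nrm f * L2nrm g)"
    by (cases A) (auto simp: ennreal_power top_power_ennreal power2_le_iff_abs_le top_unique)
  then show i: "integrable lborel (\<lambda>t. f t * g t)"
    unfolding A_def using le_less_trans[OF _ ennreal_less_top] by (auto intro!: integrableI_bounded)
  show j: "(LBINT t. cmod (f t * g t)) \<le> L2nrm f * L2nrm g"
    using le nn_integral_eq_integral[OF integrable_norm[OF i]] unfolding A_def by simp
  show "cmod (LBINT t. f t * g t) \<le> L2nrm f * L2nrm g"
    by (rule order_trans[OF integral_norm_bound j])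
qed

lemma L2nrm_triangle:
  assumes "sq_integrable f" "sq_integrable g"
  shows "L2nrm (\<lambda>t. f t + g t) \<le> L2nrm f + L2nrm g"
proof -
  have i: "integrable lborel (\<lambda>t. (cmod (f t))\<^sup>2)" "integrable lborel (\<lambda>t. (cmod (g t))\<^sup>2)"
    "integrable lborel (\<lambda>t. (cmod (f t + g t))\<^sup>2)"
    using assms sq_integrable_add[OF assms] by (auto simp: sq_integrable_def)
  note CS = L2_Cauchy_Schwarz[OF assms]
  have ifg: "integrable lborel (\<lambda>t. cmod (f t) * cmod (g t))"
    using integrable_norm[OF CS(1)] by (simp add: norm_mult)
  have "(L2nrm (\<lambda>t. f t + g t))\<^sup>2
      \<le> (LBINT t. (cmod (f t))\<^sup>2 + 2 * (cmod (f t) * cmod (g t)) + (cmod (g t))\<^sup>2)"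
    unfolding L2nrm_sq
  proof (rule Bochner_Integration.integral_mono)
    fix t
    have "(cmod (f t + g t))\<^sup>2 \<le> (cmod (f t) + cmod (g t))\<^sup>2"
      by (intro power_mono norm_triangle_ineq) auto
    then show "(cmod (f t + g t))\<^sup>2
        \<le> (cmod (f t))\<^sup>2 + 2 * (cmod (f t) * cmod (g t)) + (cmod (g t))\<^sup>2"
      by (simp add: power2_sum algebra_simps)
  qed (use i ifg in auto)
  also have "\<dots> = (L2nrm f)\<^sup>2 + 2 * (LBINT t. cmod (f t) * cmod (g t)) + (L2nrm g)\<^sup>2"
    using i ifg by (simp add: L2nrm_sq)
  also have "\<dots> \<le> (L2nrm f + L2nrm g)\<^sup>2"
    using CS(2) by (simp add: power2_sum norm_mult)
  finally show ?thesis
    by (rule power2_le_imp_le) simp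
qed

lemma L2nrm_triangle_diff:
  assumes "sq_integrable f" "sq_integrable g"
  shows "L2nrm (\<lambda>t. f t - g t) \<le> L2nrm f + L2nrm g"
  using L2nrm_triangle[OF assms(1) sq_integrable_cmult[OF assms(2), of "-1"]] L2nrm_cmult[of "-1" g]
  by simp

lemma L2nrm_minus_commute: "L2nrm (\<lambda>t. f t - g t) = L2nrm (\<lambda>t. g t - f t)"
  by (simp add: L2nrm_def norm_minus_commute)

lemma L2nrm_cong_AE:
  assumes "f \<in> borel_measurable borel" "g \<in> borel_measurable borel" "AE t in lborel. f t = g t"
  shows "L2nrm f = L2nrm g"
  unfolding L2nrm_def using assms by (intro arg_cong[where f=sqrt] integral_cong_AE) auto

text \<open>Used where a limit is known only pointwise: Fatou's lemma yields membership in L2 and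
  the norm bound together.\<close>

lemma L2_Fatou:
  assumes f: "\<And>n. sq_integrable (f n)" and [measurable]: "g \<in> borel_measurable borel"
    and lim: "AE t in lborel. (\<lambda>n::nat. f n t) \<longlonglongrightarrow> g t"
    and le: "\<forall>\<^sub>F n in sequentially. L2nrm (f n) \<le> C"
  shows "sq_integrable g" "L2nrm g \<le> C"
proof -
  have [measurable]: "f n \<in> borel_measurable borel" for n using f by (simp add: sq_integrable_def)
  obtain n0 where "L2nrm (f n0) \<le> C"
    using le by (auto simp: eventually_sequentially)
  then have C: "0 \<le> C" using L2nrm_nonneg order_trans by blast
  have "(\<integral>\<^sup>+t. ennreal ((cmod (g t))\<^sup>2) \<partial>lborel)
      = (\<integral>\<^sup>+t. liminf (\<lambda>n. ennreal ((cmod (f n t))\<^sup>2)) \<partial>lborel)"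
  proof (rule nn_integral_cong_AE)
    show "AE t in lborel. ennreal ((cmod (g t))\<^sup>2) = liminf (\<lambda>n. ennreal ((cmod (f n t))\<^sup>2))"
      using lim
    proof eventually_elim
      case (elim t)
      then have "(\<lambda>n. ennreal ((cmod (f n t))\<^sup>2)) \<longlonglongrightarrow> ennreal ((cmod (g t))\<^sup>2)"
        by (intro tendsto_intros)
      then show ?case by (metis lim_imp_Liminf trivial_limit_sequentially)
    qed
  qed
  also have "\<dots> \<le> liminf (\<lambda>n. \<integral>\<^sup>+t. ennreal ((cmod (f n t))\<^sup>2) \<partial>lborel)"
    by (intro nn_integral_liminf) auto
  also have "\<dots> = liminf (\<lambda>n. ennreal ((L2nrm (f n))\<^sup>2))"
    by (simp add: nn_integral_sq f)
  also have "\<dots> \<le> liminf (\<lambda>n. ennreal (C\<^sup>2))"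
    using le by (intro Liminf_mono) (auto elim!: eventually_mono intro!: ennreal_leI power_mono)
  also have "\<dots> = ennreal (C\<^sup>2)" by (simp add: Liminf_const)
  finally show "sq_integrable g" "L2nrm g \<le> C"
    using C by (auto intro: sq_integrableI)
qed

text \<open>Riesz-Fischer. A rapidly Cauchy subsequence converges almost everywhere; Fatou applied
  to \<open>f n - f (r j)\<close> as j grows shows that its pointwise limit is the limit in norm of
  the whole sequence.\<close>

lemma L2_complete:
  assumes f: "\<And>n::nat. sq_integrable (f n)"
    and Cauchy: "\<And>e. e > 0 \<Longrightarrow> \<exists>N. \<forall>m\<ge>N. \<forall>n\<ge>N. L2nrm (\<lambda>t. f m t - f n t) < e"
  obtains g where "sq_integrable g" "(\<lambda>n. L2nrm (\<lambda>t. f n t - g t)) \<longlonglongrightarrow> 0"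
proof -
  have [measurable]: "f n \<in> borel_measurable borel" for n using f by (simp add: sq_integrable_def)
  have "\<exists>N. \<forall>k. (\<forall>m\<ge>N k. \<forall>n\<ge>N k. L2nrm (\<lambda>t. f m t - f n t) < (1/2)^k)"
    by (intro choice allI Cauchy) auto
  then obtain N where N: "\<And>k m n. m \<ge> N k \<Longrightarrow> n \<ge> N k \<Longrightarrow> L2nrm (\<lambda>t. f m t - f n t) < (1/2)^k"
    by blast
  \<comment> \<open>Summing \<open>N i + 1\<close> makes \<open>r\<close> increasing, at least
    \<open>N k\<close> and at least \<open>k\<close> all at once.\<close>
  define r where "r k = (\<Sum>i\<le>k. N i + 1)" for k
  have rN: "N k \<le> r k" for k
    unfolding r_def using member_le_sum[of k "{..k}" "\<lambda>i. N i + 1"] by simp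
  have r_mono: "r k \<le> r (Suc k)" for k by (simp add: r_def)
  have r_ge: "k \<le> r k" for k
    using sum_mono[of "{..k}" "\<lambda>_. 1" "\<lambda>i. N i + 1"] by (simp add: r_def)
  define d where "d k t = f (r (Suc k)) t - f (r k) t" for k t
  have [measurable]: "d k \<in> borel_measurable borel" for k unfolding d_def by measurable
  have d: "sq_integrable (d k)" "L2nrm (d k) \<le> (1/2)^k" for k
  proof -
    show "sq_integrable (d k)" unfolding d_def by (intro sq_integrable_diff f)
    show "L2nrm (d k) \<le> (1/2)^k"
      unfolding d_def using N[of k "r (Suc k)" "r k"] rN[of k] r_mono[of k] by simp
  qed
  \<comment> \<open>The weights \<open>2^k\<close> turn square summability into geometric decay, hence into summability.\<close>
  have "(\<integral>\<^sup>+t. (\<Sum>k. ennreal (2^k * (cmod (d k t))\<^sup>2)) \<partial>lborel) = (\<Sum>k. \<integral>\<^sup>+t. ennreal (2^k * (cmod (d k t))\<^sup>2) \<partial>lborel)"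
    by (intro nn_integral_suminf) auto
  also have "\<dots> = (\<Sum>k. ennreal (2^k * (L2nrm (d k))\<^sup>2))"
    by (simp add: ennreal_mult' nn_integral_cmult nn_integral_sq[OF d(1)])
  also have "\<dots> \<le> (\<Sum>k. ennreal ((1/2)^k))"
  proof (intro suminf_le allI ennreal_leI)
    fix k
    have "2^k * (L2nrm (d k))\<^sup>2 \<le> 2^k * ((1/2)^k)\<^sup>2"
      using d(2) by (intro mult_left_mono power_mono) auto
    also have "\<dots> = (1/2)^k" by (simp add: power2_eq_square field_simps)
    finally show "2^k * (L2nrm (d k))\<^sup>2 \<le> (1/2)^k" .
  qed auto
  also have "\<dots> = ennreal 2"
    by (intro suminf_ennreal_eq) (use geometric_sums[of "1/2::real"] in auto)
  finally have "(\<integral>\<^sup>+t. (\<Sum>k. ennreal (2^k * (cmod (d k t))\<^sup>2)) \<partial>lborel) < \<infinity>"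
    by (simp add: order_le_less_trans)
  then have "AE t in lborel. (\<Sum>k. ennreal (2^k * (cmod (d k t))\<^sup>2)) \<noteq> \<infinity>"
    by (intro nn_integral_PInf_AE) auto
  then have ae: "AE t in lborel. convergent (\<lambda>k. f (r k) t)"
  proof eventually_elim
    case (elim t)
    then have "summable (\<lambda>k. 2^k * (cmod (d k t))\<^sup>2)"
      by (intro summable_suminf_not_top) auto
    then have "(\<lambda>k. 2^k * (cmod (d k t))\<^sup>2) \<longlonglongrightarrow> 0" by (rule summable_LIMSEQ_zero)
    then have "Bseq (\<lambda>k. 2^k * (cmod (d k t))\<^sup>2)"
      using convergentI convergent_imp_Bseq by blast
    then obtain K where K: "K > 0" "\<And>k. 2^k * (cmod (d k t))\<^sup>2 \<le> K"
      by (auto elim!: BseqE)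
    have le: "cmod (d k t) \<le> sqrt K * sqrt (1/2) ^ k" for k
    proof -
      have "(cmod (d k t))\<^sup>2 \<le> K * (1/2)^k"
        using K(2)[of k] by (simp add: field_simps)
      then have "cmod (d k t) \<le> sqrt (K * (1/2)^k)" by (rule real_le_rsqrt)
      then show ?thesis by (simp add: real_sqrt_mult real_sqrt_power)
    qed
    have "summable (\<lambda>k. sqrt K * sqrt (1/2) ^ k)"
      by (intro summable_mult summable_geometric) (auto simp: real_sqrt_divide)
    then have "summable (\<lambda>k. d k t)"
      by (rule summable_comparison_test'[of _ 0]) (use le in auto)
    moreover have "(\<Sum>i<n. d i t) = f (r n) t - f (r 0) t" for n
      unfolding d_def by (rule sum_lessThan_telescope)
    ultimately have "convergent (\<lambda>n. f (r n) t - f (r 0) t)"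
      by (simp add: summable_iff_convergent)
    then show ?case by (simp add: convergent_diff_const_right_iff)
  qed
  define g where "g t = lim (\<lambda>k. f (r k) t)" for t
  have g[measurable]: "g \<in> borel_measurable borel"
    unfolding g_def by (rule borel_measurable_lim_metric) auto
  have lim: "AE t in lborel. (\<lambda>k. f (r k) t) \<longlonglongrightarrow> g t"
    using ae by eventually_elim (simp add: g_def convergent_LIMSEQ_iff)
  have est: "sq_integrable (\<lambda>t. f n t - g t) \<and> L2nrm (\<lambda>t. f n t - g t) \<le> (1/2)^k" if "n \<ge> N k" for n k
  proof -
    have "AE t in lborel. (\<lambda>j. f n t - f (r j) t) \<longlonglongrightarrow> f n t - g t"
      using lim by eventually_elim (intro tendsto_intros)
    moreover have "\<forall>\<^sub>F j in sequentially. L2nrm (\<lambda>t. f n t - f (r j) t) \<le> (1/2)^k"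
      using eventually_ge_at_top[of "N k"]
      by eventually_elim (use N that r_ge in \<open>meson less_imp_le order_trans\<close>)
    ultimately show ?thesis
      using L2_Fatou[of "\<lambda>j t. f n t - f (r j) t" "\<lambda>t. f n t - g t" "(1/2)^k"] sq_integrable_diff[OF f f]
      by auto
  qed
  have "sq_integrable g"
    using sq_integrable_diff[OF f[of "N 0"] conjunct1[OF est[of 0 "N 0"]]] by simp
  moreover have "(\<lambda>n. L2nrm (\<lambda>t. f n t - g t)) \<longlonglongrightarrow> 0"
  proof (rule LIMSEQ_I)
    fix e :: real assume "e > 0"
    then obtain k where k: "(1/2)^k < e" using real_arch_pow_inv[of e "1/2"] by auto
    have "norm (L2nrm (\<lambda>t. f n t - g t) - 0) < e" if "n \<ge> N k" for n
      using est[OF that] k L2nrm_nonneg[of "\<lambda>t. f n t - g t"] by simp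
    then show "\<exists>no. \<forall>n\<ge>no. norm (L2nrm (\<lambda>t. f n t - g t) - 0) < e" by blast
  qed
  ultimately show thesis using that by blast
qed

lemma L2_cutoff_tendsto:
  assumes f: "sq_integrable f" and [measurable]: "\<And>n::nat. A n \<in> sets borel"
    and lim: "AE t in lborel. f t \<noteq> 0 \<longrightarrow> (\<forall>\<^sub>F n in sequentially. t \<in> A n)"
  shows "(\<lambda>n. L2nrm (\<lambda>t. f t - indicator (A n) t * f t)) \<longlonglongrightarrow> 0"
proof -
  have [measurable]: "f \<in> borel_measurable borel" and i: "integrable lborel (\<lambda>t. (cmod (f t))\<^sup>2)"
    using f by (auto simp: sq_integrable_def)
  have "(\<lambda>n. LBINT t. (cmod (f t - indicator (A n) t * f t))\<^sup>2) \<longlonglongrightarrow> integral\<^sup>L lborel (\<lambda>t::real. 0::real)"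
  proof (rule integral_dominated_convergence[where w="\<lambda>t. (cmod (f t))\<^sup>2"])
    show "AE t in lborel. (\<lambda>n. (cmod (f t - indicator (A n) t * f t))\<^sup>2) \<longlonglongrightarrow> 0"
      using lim
    proof eventually_elim
      case (elim t)
      then have "\<forall>\<^sub>F n in sequentially. (cmod (f t - indicator (A n) t * f t))\<^sup>2 = 0"
        by (cases "f t = 0") (auto elim!: eventually_mono)
      then show ?case by (rule tendsto_eventually)
    qed
    show "AE t in lborel. norm ((cmod (f t - indicator (A n) t * f t))\<^sup>2) \<le> (cmod (f t))\<^sup>2" for n
      by (intro AE_I2) (auto simp: indicator_def)
  qed (use i in auto)
  then show ?thesis
    unfolding L2nrm_def using tendsto_real_sqrt[of _ 0] by fastforce
qed

section \<open>Fubini's theorem and Schur's test\<close>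

lemma integral_swap:
  fixes F :: "real \<Rightarrow> real \<Rightarrow> complex"
  assumes [measurable]: "case_prod F \<in> borel_measurable (borel \<Otimes>\<^sub>M borel)"
    and fin: "(\<integral>\<^sup>+y. (\<integral>\<^sup>+x. ennreal (cmod (F x y)) \<partial>lborel) \<partial>lborel) < \<infinity>"
  shows "(LBINT x. LBINT y. F x y) = (LBINT y. LBINT x. F x y)"
    and "integrable lborel (\<lambda>x. LBINT y. F x y)"
proof -
  have m: "case_prod F \<in> borel_measurable (lborel \<Otimes>\<^sub>M lborel)"
    by (simp cong: measurable_cong_sets)
  have "(\<integral>\<^sup>+p. ennreal (cmod (case_prod F p)) \<partial>(lborel \<Otimes>\<^sub>M lborel))
      = (\<integral>\<^sup>+y. (\<integral>\<^sup>+x. ennreal (cmod (F x y)) \<partial>lborel) \<partial>lborel)"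
    using m by (subst lborel_pair.nn_integral_snd[symmetric]) auto
  then have i: "integrable (lborel \<Otimes>\<^sub>M lborel) (case_prod F)"
    using fin m by (intro integrableI_bounded) auto
  show "(LBINT x. LBINT y. F x y) = (LBINT y. LBINT x. F x y)"
    using lborel_pair.Fubini_integral[OF i] by simp
  show "integrable lborel (\<lambda>x. LBINT y. F x y)"
    using lborel_pair.integrable_fst[OF i] by simp
qed

text \<open>Write K |f| as sqrt(K h) times sqrt(K/h) |f|. Cauchy-Schwarz in t costs a factor A h(x)
  by the first estimate; after Tonelli the second estimate turns the remaining x-integral of K h
  into B h(t), which cancels the 1/h(t).\<close>

lemma Schur_test:
  fixes K :: "real \<Rightarrow> real \<Rightarrow> real" and h :: "real \<Rightarrow> real"
  assumes K[measurable]: "case_prod K \<in> borel_measurable (borel \<Otimes>\<^sub>M borel)" and K0: "\<And>x t. 0 \<le> K x t"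
    and h[measurable]: "h \<in> borel_measurable borel" and h0: "\<And>x. 0 < h x"
    and AB: "0 \<le> A" "0 \<le> B"
    and 1: "\<And>x. (\<integral>\<^sup>+t. ennreal (K x t * h t) \<partial>lborel) \<le> ennreal (A * h x)"
    and 2: "\<And>t. (\<integral>\<^sup>+x. ennreal (K x t * h x) \<partial>lborel) \<le> ennreal (B * h t)"
    and f: "sq_integrable f"
  shows "(\<integral>\<^sup>+x. (\<integral>\<^sup>+t. ennreal (K x t * cmod (f t)) \<partial>lborel)\<^sup>2 \<partial>lborel) \<le> ennreal (A * B * (L2nrm f)\<^sup>2)"
proof -
  have fm[measurable]: "f \<in> borel_measurable borel" using f by (simp add: sq_integrable_def)
  have [measurable]: "case_prod K \<in> borel_measurable (borel \<Otimes>\<^sub>M lborel)"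
    "case_prod K \<in> borel_measurable (lborel \<Otimes>\<^sub>M lborel)"
    by (simp_all cong: measurable_cong_sets)
  have "(\<integral>\<^sup>+t. ennreal (K x t * cmod (f t)) \<partial>lborel)\<^sup>2
      \<le> ennreal (A * h x) * (\<integral>\<^sup>+t. ennreal (K x t * (cmod (f t))\<^sup>2 / h t) \<partial>lborel)" for x
  proof -
    have "(\<integral>\<^sup>+t. ennreal (K x t * cmod (f t)) \<partial>lborel)
        = (\<integral>\<^sup>+t. ennreal (sqrt (K x t * h t)) * ennreal (sqrt (K x t / h t) * cmod (f t)) \<partial>lborel)"
    proof (intro nn_integral_cong)
      fix t
      have "sqrt (K x t * h t) * sqrt (K x t / h t) = K x t"
        using h0[of t] K0[of x t] by (simp flip: real_sqrt_mult)
      then show "ennreal (K x t * cmod (f t)) = ennreal (sqrt (K x t * h t)) * ennreal (sqrt (K x t / h t) * cmod (f t))"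
        using K0[of x t] h0[of t] by (simp add: ennreal_mult[symmetric] mult.assoc[symmetric])
    qed
    also have "\<dots>\<^sup>2 \<le> (\<integral>\<^sup>+t. (ennreal (sqrt (K x t * h t)))\<^sup>2 \<partial>lborel) *
        (\<integral>\<^sup>+t. (ennreal (sqrt (K x t / h t) * cmod (f t)))\<^sup>2 \<partial>lborel)"
      by (rule Cauchy_Schwarz_nn_integral) measurable
    also have "(\<integral>\<^sup>+t. (ennreal (sqrt (K x t * h t)))\<^sup>2 \<partial>lborel) = (\<integral>\<^sup>+t. ennreal (K x t * h t) \<partial>lborel)"
      using K0 h0 by (intro nn_integral_cong) (simp add: ennreal_power less_imp_le)
    also have "(\<integral>\<^sup>+t. (ennreal (sqrt (K x t / h t) * cmod (f t)))\<^sup>2 \<partial>lborel)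
        = (\<integral>\<^sup>+t. ennreal (K x t * (cmod (f t))\<^sup>2 / h t) \<partial>lborel)"
      using K0 h0 by (intro nn_integral_cong) (simp add: ennreal_power less_imp_le power_mult_distrib)
    finally show ?thesis
      using mult_right_mono[OF 1[of x]] by (meson order_trans zero_le)
  qed
  then have "(\<integral>\<^sup>+x. (\<integral>\<^sup>+t. ennreal (K x t * cmod (f t)) \<partial>lborel)\<^sup>2 \<partial>lborel)
      \<le> (\<integral>\<^sup>+x. ennreal (A * h x) * (\<integral>\<^sup>+t. ennreal (K x t * (cmod (f t))\<^sup>2 / h t) \<partial>lborel) \<partial>lborel)"
    by (intro nn_integral_mono)
  also have "\<dots> = (\<integral>\<^sup>+x. (\<integral>\<^sup>+t. ennreal (A * h x) * ennreal (K x t * (cmod (f t))\<^sup>2 / h t) \<partial>lborel) \<partial>lborel)"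
    by (intro nn_integral_cong nn_integral_cmult[symmetric]) measurable
  also have "\<dots> = (\<integral>\<^sup>+t. (\<integral>\<^sup>+x. ennreal (A * h x) * ennreal (K x t * (cmod (f t))\<^sup>2 / h t) \<partial>lborel) \<partial>lborel)"
    by (intro lborel_pair.Fubini') measurable
  also have "\<dots> = (\<integral>\<^sup>+t. ennreal (A * (cmod (f t))\<^sup>2 / h t) * (\<integral>\<^sup>+x. ennreal (K x t * h x) \<partial>lborel) \<partial>lborel)"
  proof (intro nn_integral_cong)
    fix t
    have "(\<integral>\<^sup>+x. ennreal (A * h x) * ennreal (K x t * (cmod (f t))\<^sup>2 / h t) \<partial>lborel)
        = (\<integral>\<^sup>+x. ennreal (A * (cmod (f t))\<^sup>2 / h t) * ennreal (K x t * h x) \<partial>lborel)"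
      using AB K0 h0 by (intro nn_integral_cong) (simp add: ennreal_mult[symmetric] less_imp_le field_simps)
    then show "(\<integral>\<^sup>+x. ennreal (A * h x) * ennreal (K x t * (cmod (f t))\<^sup>2 / h t) \<partial>lborel)
        = ennreal (A * (cmod (f t))\<^sup>2 / h t) * (\<integral>\<^sup>+x. ennreal (K x t * h x) \<partial>lborel)"
      by (simp add: nn_integral_cmult)
  qed
  also have "\<dots> \<le> (\<integral>\<^sup>+t. ennreal (A * (cmod (f t))\<^sup>2 / h t) * ennreal (B * h t) \<partial>lborel)"
    by (intro nn_integral_mono mult_left_mono 2) auto
  also have "\<dots> = (\<integral>\<^sup>+t. ennreal (A * B) * ennreal ((cmod (f t))\<^sup>2) \<partial>lborel)"
  proof (intro nn_integral_cong)
    fix t show "ennreal (A * (cmod (f t))\<^sup>2 / h t) * ennreal (B * h t) = ennreal (A * B) * ennreal ((cmod (f t))\<^sup>2)"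
      using AB h0[of t] by (simp add: ennreal_mult[symmetric] less_imp_le field_simps)
  qed
  also have "\<dots> = ennreal (A * B * (L2nrm f)\<^sup>2)"
    using AB by (simp add: nn_integral_cmult nn_integral_sq[OF f] ennreal_mult)
  finally show ?thesis .
qed

text \<open>For a non-integrable f the Bochner integral is 0, so the inequality covers that case
  too.\<close>

lemma norm_integral_le_nn_integral:
  fixes f :: "'a \<Rightarrow> 'b::{banach, second_countable_topology}"
  shows "ennreal (norm (integral\<^sup>L M f)) \<le> (\<integral>\<^sup>+x. ennreal (norm (f x)) \<partial>M)"
  by (cases "integrable M f") (auto simp: not_integrable_integral_eq intro: integral_norm_bound_ennreal)

lemma Schur_operator:
  fixes K :: "real \<Rightarrow> real \<Rightarrow> real" and h :: "real \<Rightarrow> real" and k :: "real \<Rightarrow> real \<Rightarrow> complex"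
  assumes K: "case_prod K \<in> borel_measurable (borel \<Otimes>\<^sub>M borel)" "\<And>x t. 0 \<le> K x t"
    and h: "h \<in> borel_measurable borel" "\<And>x. 0 < h x" and A: "0 \<le> A"
    and 1: "\<And>x. (\<integral>\<^sup>+t. ennreal (K x t * h t) \<partial>lborel) \<le> ennreal (A * h x)"
    and 2: "\<And>t. (\<integral>\<^sup>+x. ennreal (K x t * h x) \<partial>lborel) \<le> ennreal (A * h t)"
    and k[measurable]: "case_prod k \<in> borel_measurable (borel \<Otimes>\<^sub>M borel)" and kK: "\<And>x t. cmod (k x t) \<le> K x t"
    and f: "sq_integrable f"
  shows "sq_integrable (\<lambda>x. LBINT t. k x t * f t)" "L2nrm (\<lambda>x. LBINT t. k x t * f t) \<le> A * L2nrm f"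
proof -
  have fm[measurable]: "f \<in> borel_measurable borel" using f by (simp add: sq_integrable_def)
  have [measurable]: "case_prod k \<in> borel_measurable (borel \<Otimes>\<^sub>M lborel)"
    by (simp cong: measurable_cong_sets)
  have "ennreal ((cmod (LBINT t. k x t * f t))\<^sup>2) \<le> (\<integral>\<^sup>+t. ennreal (K x t * cmod (f t)) \<partial>lborel)\<^sup>2" for x
  proof -
    have "ennreal (cmod (LBINT t. k x t * f t)) \<le> (\<integral>\<^sup>+t. ennreal (cmod (k x t * f t)) \<partial>lborel)"
      by (rule norm_integral_le_nn_integral)
    also have "\<dots> \<le> (\<integral>\<^sup>+t. ennreal (K x t * cmod (f t)) \<partial>lborel)"
      by (intro nn_integral_mono ennreal_leI) (simp add: norm_mult mult_right_mono kK)
    finally show ?thesis by (metis ennreal_power norm_ge_zero power_mono zero_le)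
  qed
  then have "(\<integral>\<^sup>+x. ennreal ((cmod (LBINT t. k x t * f t))\<^sup>2) \<partial>lborel)
      \<le> (\<integral>\<^sup>+x. (\<integral>\<^sup>+t. ennreal (K x t * cmod (f t)) \<partial>lborel)\<^sup>2 \<partial>lborel)"
    by (intro nn_integral_mono)
  also have "\<dots> \<le> ennreal (A * A * (L2nrm f)\<^sup>2)"
    by (rule Schur_test[OF K h A A 1 2 f])
  finally show "sq_integrable (\<lambda>x. LBINT t. k x t * f t)" "L2nrm (\<lambda>x. LBINT t. k x t * f t) \<le> A * L2nrm f"
    using A by (auto intro!: sq_integrableI[where C="A * L2nrm f"] simp: power_mult_distrib power2_eq_square mult_ac)
qed

subsection \<open>Integrals of rational functions over the line\<close>

lemma lborel_integrable_inverse_1_plus_square: "integrable lborel (\<lambda>s::real. inverse (1 + s\<^sup>2))"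
  using Sinc_Integral.integrable_inverse_1_plus_square by (simp add: set_integrable_def einterval_def)

lemma one_plus_square_le:
  assumes "Im z \<noteq> 0"
  shows "\<exists>C>0. \<forall>s::real. 1 + s\<^sup>2 \<le> C * (cmod (of_real s - z))\<^sup>2"
proof -
  \<comment> \<open>From s^2 \<le> 2 (s - Re z)^2 + 2 (Re z)^2: the summand 2 pays for the first
    square, and the constant 1 + 2 (Re z)^2 is paid for by the term (Im z)^2 contained in |s -
    z|^2.\<close>
  define C where "C = 2 + (1 + 2 * (Re z)\<^sup>2) / (Im z)\<^sup>2"
  have "1 + s\<^sup>2 \<le> C * (cmod (of_real s - z))\<^sup>2" for s :: real
  proof -
    have "s\<^sup>2 \<le> 2 * (s - Re z)\<^sup>2 + 2 * (Re z)\<^sup>2"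
      using zero_le_power2[of "s - 2 * Re z"] by (simp add: power2_eq_square algebra_simps)
    moreover have "1 + 2 * (Re z)\<^sup>2 = (1 + 2 * (Re z)\<^sup>2) / (Im z)\<^sup>2 * (Im z)\<^sup>2" using assms by simp
    moreover have "(1 + 2 * (Re z)\<^sup>2) / (Im z)\<^sup>2 * (s - Re z)\<^sup>2 \<ge> 0" by (intro mult_nonneg_nonneg divide_nonneg_nonneg) auto
    moreover have "(cmod (of_real s - z))\<^sup>2 = (s - Re z)\<^sup>2 + (Im z)\<^sup>2" by (simp add: cmod_power2)
    ultimately show ?thesis
      unfolding C_def by (simp only: distrib_left distrib_right) (smt (verit) zero_le_power2)
  qed
  moreover have "C > 0" unfolding C_def by (smt (verit) divide_nonneg_nonneg zero_le_power2)
  ultimately show ?thesis by blast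
qed

lemma integrable_two_poles:
  assumes "Im z \<noteq> 0" "Im w \<noteq> 0"
  shows "integrable lborel (\<lambda>s::real. 1 / ((of_real s - z) * (of_real s - w)))"
proof -
  obtain C where C: "C > 0" "\<And>s. 1 + s\<^sup>2 \<le> C * (cmod (of_real s - z))\<^sup>2"
    using one_plus_square_le[OF assms(1)] by blast
  obtain D where D: "D > 0" "\<And>s. 1 + s\<^sup>2 \<le> D * (cmod (of_real s - w))\<^sup>2"
    using one_plus_square_le[OF assms(2)] by blast
  show ?thesis
  proof (rule Bochner_Integration.integrable_bound)
    show "integrable lborel (\<lambda>s::real. sqrt (C * D) * inverse (1 + s\<^sup>2))"
      by (intro integrable_mult_right lborel_integrable_inverse_1_plus_square)
    have "norm (1 / ((of_real s - z) * (of_real s - w))) \<le> norm (sqrt (C * D) * inverse (1 + s\<^sup>2))" for s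
    proof -
      have nz: "of_real s - z \<noteq> 0" "of_real s - w \<noteq> 0" using assms by auto
      have "(1 + s\<^sup>2)\<^sup>2 \<le> (C * (cmod (of_real s - z))\<^sup>2) * (D * (cmod (of_real s - w))\<^sup>2)"
        unfolding power2_eq_square[of "1 + s\<^sup>2"] using C D by (intro mult_mono) auto
      also have "\<dots> = (sqrt (C * D) * cmod ((of_real s - z) * (of_real s - w)))\<^sup>2"
        using C D by (simp add: power_mult_distrib norm_mult)
      finally have "1 + s\<^sup>2 \<le> sqrt (C * D) * cmod ((of_real s - z) * (of_real s - w))"
        using C D by (simp add: power2_le_iff_abs_le)
      moreover have "1 + s\<^sup>2 > 0" by (simp add: add_pos_nonneg)
      ultimately show ?thesis using nz C D
        by (simp add: norm_divide divide_simps)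
    qed
    then show "AE s in lborel. norm (1 / ((of_real s - z) * (of_real s - w))) \<le> norm (sqrt (C * D) * inverse (1 + s\<^sup>2))"
      by auto
  qed measurable
qed

lemma integral_real_FTC:
  fixes F f :: "real \<Rightarrow> complex"
  assumes "\<And>s. (F has_vector_derivative f s) (at s)" "\<And>s. isCont f s" "integrable lborel f"
    "(F \<longlongrightarrow> A) at_bot" "(F \<longlongrightarrow> B) at_top"
  shows "(LBINT s. f s) = B - A"
proof -
  have "(LBINT s=-\<infinity>..\<infinity>. f s) = B - A"
    using assms by (intro interval_integral_FTC_integrable)
      (auto simp: ereal_tendsto_simps set_integrable_def einterval_def)
  then show ?thesis
    by (simp add: interval_lebesgue_integral_def einterval_def set_lebesgue_integral_def)
qed

text \<open>s - z runs along a horizontal line off the real axis and never meets the cut, so the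
  principal branch is an antiderivative on the entire line.\<close>

lemma Ln_shift_has_vector_derivative:
  assumes "Im z \<noteq> 0"
  shows "((\<lambda>s::real. Ln (of_real s - z)) has_vector_derivative 1 / (of_real s - z)) (at s)"
proof -
  have "of_real s - z \<notin> \<real>\<^sub>\<le>\<^sub>0" using assms by (auto simp: complex_nonpos_Reals_iff)
  then have "((\<lambda>u. Ln (u - z)) has_field_derivative 1 / (of_real s - z)) (at (of_real s))"
    by (auto intro!: derivative_eq_intros simp: divide_inverse)
  from has_vector_derivative_real_field[OF this] show ?thesis .
qed

lemma tendsto_const_over_at_top: "((\<lambda>r::real. 1 + c / of_real r) \<longlongrightarrow> (1::complex)) at_top"
proof -
  have "((\<lambda>r::real. 1 + c / of_real r) \<longlongrightarrow> 1 + 0) at_top"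
    by (intro tendsto_add tendsto_const tendsto_divide_0[OF tendsto_const] filterlim_of_real_at_infinity)
  then show ?thesis by simp
qed

lemma Ln_one_plus_tendsto: "((\<lambda>r::real. Ln (1 + c / of_real r)) \<longlongrightarrow> 0) at_top"
  using tendsto_Ln[OF tendsto_const_over_at_top[of c]] by simp

lemma Ln_diff_at_top:
  "((\<lambda>s::real. Ln (of_real s - z) - Ln (of_real s - w)) \<longlongrightarrow> 0) at_top"
proof -
  have "((\<lambda>s::real. Ln (1 + (-z) / of_real s) - Ln (1 + (-w) / of_real s)) \<longlongrightarrow> 0 - 0) at_top"
    by (intro tendsto_diff Ln_one_plus_tendsto)
  moreover have "\<forall>\<^sub>F s in at_top. Ln (1 + (-z) / of_real s) - Ln (1 + (-w) / of_real s)
      = Ln (of_real s - z) - Ln (of_real s - w)"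
    using eventually_gt_at_top[of "max (cmod z) (cmod w)"] 
  proof eventually_elim
    case (elim s)
    then have s: "s > 0" by (smt (verit) norm_ge_zero)
    have "of_real s - z \<noteq> 0" "of_real s - w \<noteq> 0" using elim by auto
    then have "1 - z / of_real s \<noteq> 0" "1 - w / of_real s \<noteq> 0" using s by (auto simp: field_simps)
    moreover have "of_real s - z = of_real s * (1 - z / of_real s)" "of_real s - w = of_real s * (1 - w / of_real s)"
      using s by (auto simp: field_simps)
    ultimately show ?case using Ln_times_of_real[OF s] by simp
  qed
  ultimately show ?thesis by (simp add: tendsto_cong)
qed

text \<open>Far to the left, s - z lies close to the cut, on the side opposite to z. The resulting
  argument -sgn(Im z) \<pi> is the only contribution to the integrals of two poles below.\<close>

lemma Ln_minus_shift:
  assumes "r > 0" "Im z \<noteq> 0"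
  shows "Ln (- of_real r - z) = of_real (ln r) + Ln (1 + z / of_real r) - \<i> * of_real (sgn (Im z) * pi)"
proof -
  have nz: "1 + z / of_real r \<noteq> 0" 
    using assms by (auto simp: complex_eq_iff)
  have "- of_real r - z = of_real r * (- (1 + z / of_real r))" using assms by (simp add: field_simps)
  then have "Ln (- of_real r - z) = of_real (ln r) + Ln (- (1 + z / of_real r))"
    using Ln_times_of_real[OF assms(1), of "- (1 + z / of_real r)"] nz assms(1)
    by (simp only: neg_equal_0_iff_equal Ln_of_real not_False_eq_True simp_thms)
  also have "Ln (- (1 + z / of_real r)) = Ln (1 + z / of_real r) - \<i> * of_real (sgn (Im z) * pi)"
    using assms by (subst Ln_minus[OF nz]) (auto simp: sgn_if divide_le_0_iff)
  finally show ?thesis by simp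
qed

lemma Ln_diff_at_bot:
  assumes "Im z \<noteq> 0" "Im w \<noteq> 0"
  shows "((\<lambda>s::real. Ln (of_real s - z) - Ln (of_real s - w)) \<longlongrightarrow> \<i> * of_real ((sgn (Im w) - sgn (Im z)) * pi)) at_bot"
proof -
  have "((\<lambda>r::real. Ln (1 + z / of_real r) - Ln (1 + w / of_real r) + \<i> * of_real ((sgn (Im w) - sgn (Im z)) * pi))
      \<longlongrightarrow> 0 - 0 + \<i> * of_real ((sgn (Im w) - sgn (Im z)) * pi)) at_top"
    by (intro tendsto_add tendsto_diff Ln_one_plus_tendsto tendsto_const)
  moreover have "\<forall>\<^sub>F r in at_top. Ln (1 + z / of_real r) - Ln (1 + w / of_real r) + \<i> * of_real ((sgn (Im w) - sgn (Im z)) * pi)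
      = Ln (of_real (-r) - z) - Ln (of_real (-r) - w)"
    using eventually_gt_at_top[of "0::real"]
    by eventually_elim (use assms in \<open>simp add: Ln_minus_shift algebra_simps\<close>)
  ultimately show ?thesis
    unfolding filterlim_at_bot_mirror by (simp add: tendsto_cong)
qed

text \<open>The antiderivative is (Ln(s - z) - Ln(s - w)) / (z - w). Its limits at both ends give
  what closing the contour in a half-plane would give: 0 for poles on the same side, and otherwise
  the residue.\<close>

lemma integral_two_poles:
  assumes "Im z \<noteq> 0" "Im w \<noteq> 0" "z \<noteq> w"
  shows "(LBINT s. 1 / ((of_real s - z) * (of_real s - w))) = \<i> * of_real ((sgn (Im z) - sgn (Im w)) * pi) / (z - w)"
proof -
  have nz: "of_real s - z \<noteq> 0" "of_real s - w \<noteq> 0" for s :: real using assms by auto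
  have "(LBINT s. 1 / ((of_real s - z) * (of_real s - w)))
      = 0 / (z - w) - (\<i> * of_real ((sgn (Im w) - sgn (Im z)) * pi)) / (z - w)"
  proof (rule integral_real_FTC)
    fix s :: real
    have "((\<lambda>s. (Ln (of_real s - z) - Ln (of_real s - w)) * (1 / (z - w))) has_vector_derivative
        (1 / (of_real s - z) - 1 / (of_real s - w)) * (1 / (z - w))) (at s)"
      using assms by (intro has_vector_derivative_mult_left has_vector_derivative_diff Ln_shift_has_vector_derivative)
    moreover have "(1 / (of_real s - z) - 1 / (of_real s - w)) * (1 / (z - w)) = 1 / ((of_real s - z) * (of_real s - w))"
      using nz[of s] assms(3) by (simp add: divide_simps)
    ultimately show "((\<lambda>s. (Ln (of_real s - z) - Ln (of_real s - w)) / (z - w)) has_vector_derivative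
        1 / ((of_real s - z) * (of_real s - w))) (at s)"
      by (simp add: divide_inverse)
    show "isCont (\<lambda>s. 1 / ((complex_of_real s - z) * (of_real s - w))) s"
      using nz[of s] by (intro continuous_intros) auto
  qed (use assms in \<open>auto intro!: integrable_two_poles tendsto_divide[OF Ln_diff_at_top tendsto_const, of _ z w, simplified]
         tendsto_divide[OF Ln_diff_at_bot tendsto_const, of z w, simplified]\<close>)
  then show ?thesis using assms by (simp add: field_simps)
qed

text \<open>The confluent case, which arises in
  \<open>integral_cauchy_kernel_product_opposite\<close> when both poles coincide.\<close>

lemma integral_double_pole:
  assumes "Im z \<noteq> 0"
  shows "(LBINT s. 1 / ((of_real s - z) * (of_real s - z))) = 0"
proof -
  have nz: "of_real s - z \<noteq> 0" for s :: real using assms by auto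
  have inf: "filterlim (\<lambda>s::real. complex_of_real s + c) at_infinity at_top" for c
    by (rule tendsto_add_filterlim_at_infinity'[OF filterlim_of_real_at_infinity tendsto_const])
  have "filterlim (\<lambda>s::real. complex_of_real (- s) - z) at_infinity at_top"
    using inf[of z] unfolding filterlim_at_infinity_conv_norm_at_top
    by (simp add: norm_minus_commute[of "- complex_of_real _"] add.commute)
  then have t: "filterlim (\<lambda>s::real. complex_of_real s - z) at_infinity at_top"
      "filterlim (\<lambda>s::real. complex_of_real s - z) at_infinity at_bot"
    using inf[of "- z"] unfolding filterlim_at_bot_mirror by simp_all
  have "(LBINT s. 1 / ((of_real s - z) * (of_real s - z))) = 0 - 0"
  proof (rule integral_real_FTC)
    fix s :: real
    have "((\<lambda>u. - 1 / (u - z)) has_field_derivative 1 / ((of_real s - z) * (of_real s - z))) (at (of_real s))"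
      using nz[of s] by (auto intro!: derivative_eq_intros simp: field_simps)
    from has_vector_derivative_real_field[OF this]
    show "((\<lambda>s::real. - 1 / (of_real s - z)) has_vector_derivative 1 / ((of_real s - z) * (of_real s - z))) (at s)" .
    show "isCont (\<lambda>s. 1 / ((complex_of_real s - z) * (of_real s - z))) s"
      using nz[of s] by (intro continuous_intros) auto
    show "((\<lambda>s::real. - 1 / (complex_of_real s - z)) \<longlongrightarrow> 0) at_bot" "((\<lambda>s::real. - 1 / (complex_of_real s - z)) \<longlongrightarrow> 0) at_top"
      by (intro tendsto_divide_0[OF tendsto_const] t)+
  qed (use assms in \<open>auto intro!: integrable_two_poles\<close>)
  then show ?thesis by simp
qed

subsection \<open>Cauchy and Poisson kernels\<close>

text \<open>The Cauchy kernel of the upper half-plane at the point x + i \<epsilon>, as a function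
  of the boundary variable t.\<close>

definition cauchy_kernel :: "real \<Rightarrow> real \<Rightarrow> real \<Rightarrow> complex" where
  "cauchy_kernel \<epsilon> x t = 1 / (2 * of_real pi * \<i>) / (of_real (t - x) - \<i> * of_real \<epsilon>)"

definition poisson_kernel :: "real \<Rightarrow> real \<Rightarrow> real \<Rightarrow> real" where
  "poisson_kernel \<epsilon> x t = \<epsilon> / (pi * ((t - x)\<^sup>2 + \<epsilon>\<^sup>2))"

lemma cauchy_kernel_measurable [measurable]:
  "(\<lambda>p. cauchy_kernel \<epsilon> (f p) (g p)) \<in> borel_measurable M"
  if [measurable]: "f \<in> borel_measurable M" "g \<in> borel_measurable M"
  unfolding cauchy_kernel_def by measurable

lemma poisson_kernel_measurable [measurable]:
  "(\<lambda>p. poisson_kernel \<epsilon> (f p) (g p)) \<in> borel_measurable M"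
  if [measurable]: "f \<in> borel_measurable M" "g \<in> borel_measurable M"
  unfolding poisson_kernel_def by measurable

lemma poisson_kernel_nonneg: "0 \<le> \<epsilon> \<Longrightarrow> 0 \<le> poisson_kernel \<epsilon> x t"
  by (auto simp: poisson_kernel_def intro!: divide_nonneg_nonneg mult_nonneg_nonneg)

lemma poisson_kernel_commute: "poisson_kernel \<epsilon> x t = poisson_kernel \<epsilon> t x"
  by (simp add: poisson_kernel_def power2_commute)

lemma cnj_cauchy_kernel: "cnj (cauchy_kernel \<epsilon> x t) = cauchy_kernel \<epsilon> t x"
proof -
  have "- (\<i> * (complex_of_real (t - x) + \<i> * of_real \<epsilon>)) = \<i> * (of_real (x - t) - \<i> * of_real \<epsilon>)"
    by (simp add: algebra_simps)
  then show ?thesis by (simp add: cauchy_kernel_def divide_divide_eq_left mult.assoc)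
qed

lemma shift_nonzero: "\<epsilon> \<noteq> 0 \<Longrightarrow> complex_of_real u - \<i> * of_real \<epsilon> \<noteq> 0"
  by (auto simp: complex_eq_iff)

lemma cmod_shift_sq: "(cmod (complex_of_real u - \<i> * of_real \<epsilon>))\<^sup>2 = u\<^sup>2 + \<epsilon>\<^sup>2"
  by (simp add: cmod_power2)

lemma sum_square_pos: "(\<epsilon>::real) > 0 \<Longrightarrow> u\<^sup>2 + \<epsilon>\<^sup>2 > 0"
  by (simp add: add_nonneg_pos)

lemma cmod_cauchy_kernel_sq:
  assumes "\<epsilon> > 0"
  shows "(cmod (cauchy_kernel \<epsilon> x t))\<^sup>2 = poisson_kernel \<epsilon> x t / (4 * pi * \<epsilon>)"
  using assms unfolding cauchy_kernel_def poisson_kernel_def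
  by (simp add: norm_divide norm_mult power_divide power_mult_distrib cmod_shift_sq
      power2_eq_square[of pi] power2_eq_square[of \<epsilon>] del: of_real_diff)

text \<open>By Hermitian symmetry the left side is twice the real part of the Cauchy kernel. Hence a
  Poisson integral is the sum of an analytic and an anti-analytic part, and a bound for the sum
  bounds each part once both are known to be positive.\<close>

lemma cauchy_kernel_add_cnj:
  assumes "\<epsilon> > 0"
  shows "cauchy_kernel \<epsilon> x t + cauchy_kernel \<epsilon> t x = of_real (poisson_kernel \<epsilon> x t)"
proof -
  define u where "u = complex_of_real (t - x)"
  have nz: "u - \<i> * of_real \<epsilon> \<noteq> 0" "- u - \<i> * of_real \<epsilon> \<noteq> 0" "u\<^sup>2 + (of_real \<epsilon>)\<^sup>2 \<noteq> 0"
    using shift_nonzero[of \<epsilon> "t - x"] shift_nonzero[of \<epsilon> "x - t"] assms sum_square_pos[of \<epsilon> "t - x"]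
    by (auto simp: u_def simp flip: of_real_diff of_real_power of_real_add)
  have e: "(u - \<i> * of_real \<epsilon>) * (- u - \<i> * of_real \<epsilon>) = - (u\<^sup>2 + (of_real \<epsilon>)\<^sup>2)"
    by (simp add: algebra_simps power2_eq_square)
  have "1 / (u - \<i> * of_real \<epsilon>) + 1 / (- u - \<i> * of_real \<epsilon>) = (- 2 * \<i> * of_real \<epsilon>) / ((u - \<i> * of_real \<epsilon>) * (- u - \<i> * of_real \<epsilon>))"
    using nz by (simp add: add_frac_eq)
  also have "\<dots> = 2 * \<i> * of_real \<epsilon> / (u\<^sup>2 + (of_real \<epsilon>)\<^sup>2)" unfolding e by (simp only: divide_minus_right mult_minus_left minus_divide_left minus_minus)
  finally have F: "1 / (u - \<i> * of_real \<epsilon>) + 1 / (- u - \<i> * of_real \<epsilon>) = 2 * \<i> * of_real \<epsilon> / (u\<^sup>2 + (of_real \<epsilon>)\<^sup>2)" .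
  have "1 / (2 * of_real pi * \<i>) * (1 / (u - \<i> * of_real \<epsilon>) + 1 / (- u - \<i> * of_real \<epsilon>)) 
      = of_real \<epsilon> / (of_real pi * (u\<^sup>2 + (of_real \<epsilon>)\<^sup>2))"
    unfolding F by simp
  then show ?thesis by (simp add: cauchy_kernel_def poisson_kernel_def u_def distrib_left)
qed

lemma divide_product_minus:
  "k / a * (k / (- b)) = - (k\<^sup>2) * (1 / (a * b))" and divide_minus_product_minus: "k / (- a) * (k / (- b)) = k\<^sup>2 * (1 / (a * b))"
  for a b k :: complex
  by (simp_all add: power2_eq_square)

lemma cauchy_constant_square: "- ((1 / (2 * of_real pi * \<i>))\<^sup>2) * (\<i> * of_real (2 * pi) / - D) = 1 / (2 * of_real pi * \<i>) / D"
  by (simp add: power2_eq_square)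

text \<open>The poles x + i \<epsilon> and t - i \<delta> lie on opposite sides of the line, so a
  residue survives; their difference x - t + i (\<epsilon> + \<delta>) is why the parameters
  add.\<close>

lemma integral_cauchy_kernel_product:
  assumes "\<epsilon> > 0" "\<delta> > 0"
  shows "integrable lborel (\<lambda>s. cauchy_kernel \<epsilon> x s * cauchy_kernel \<delta> s t)"
    and "(LBINT s. cauchy_kernel \<epsilon> x s * cauchy_kernel \<delta> s t) = cauchy_kernel (\<epsilon> + \<delta>) x t"
proof -
  define z w where "z = Complex x \<epsilon>" and "w = Complex t (- \<delta>)"
  have zw: "Im z > 0" "Im w < 0" "Im z \<noteq> 0" "Im w \<noteq> 0" "z \<noteq> w" using assms by (auto simp: z_def w_def)
  define c where "c = - ((1 / (2 * of_real pi * \<i>))\<^sup>2)"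
  have eq: "cauchy_kernel \<epsilon> x s * cauchy_kernel \<delta> s t = c * (1 / ((of_real s - z) * (of_real s - w)))" for s
  proof -
    have "of_real (s - x) - \<i> * of_real \<epsilon> = of_real s - z" "of_real (t - s) - \<i> * of_real \<delta> = - (of_real s - w)"
      by (auto simp: z_def w_def complex_eq_iff)
    then show ?thesis unfolding cauchy_kernel_def c_def by (simp only: divide_product_minus)
  qed
  show "integrable lborel (\<lambda>s. cauchy_kernel \<epsilon> x s * cauchy_kernel \<delta> s t)"
    unfolding eq by (intro integrable_mult_right integrable_two_poles zw)
  have "(LBINT s. cauchy_kernel \<epsilon> x s * cauchy_kernel \<delta> s t) = c * (\<i> * of_real (2 * pi) / (z - w))"
    unfolding eq integral_mult_right_zero integral_two_poles[OF zw(3-5)] using zw by simp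
  also have "z - w = - (of_real (t - x) - \<i> * of_real (\<epsilon> + \<delta>))" by (auto simp: z_def w_def complex_eq_iff)
  also have "c * (\<i> * of_real (2 * pi) / - (of_real (t - x) - \<i> * of_real (\<epsilon> + \<delta>))) = cauchy_kernel (\<epsilon> + \<delta>) x t"
    unfolding c_def cauchy_kernel_def cauchy_constant_square by simp
  finally show "(LBINT s. cauchy_kernel \<epsilon> x s * cauchy_kernel \<delta> s t) = cauchy_kernel (\<epsilon> + \<delta>) x t" .
qed

text \<open>Both poles lie below the line: the anti-analytic part annihilates the analytic
  one.\<close>

lemma integral_cauchy_kernel_product_opposite:
  assumes "\<epsilon> > 0" "\<delta> > 0"
  shows "integrable lborel (\<lambda>s. cauchy_kernel \<epsilon> s x * cauchy_kernel \<delta> s t)"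
    and "(LBINT s. cauchy_kernel \<epsilon> s x * cauchy_kernel \<delta> s t) = 0"
proof -
  define z w where "z = Complex x (- \<epsilon>)" and "w = Complex t (- \<delta>)"
  have zw: "Im z < 0" "Im w < 0" "Im z \<noteq> 0" "Im w \<noteq> 0" using assms by (auto simp: z_def w_def)
  define c where "c = (1 / (2 * of_real pi * \<i>))\<^sup>2"
  have eq: "cauchy_kernel \<epsilon> s x * cauchy_kernel \<delta> s t = c * (1 / ((of_real s - z) * (of_real s - w)))" for s
  proof -
    have "of_real (x - s) - \<i> * of_real \<epsilon> = - (of_real s - z)" "of_real (t - s) - \<i> * of_real \<delta> = - (of_real s - w)"
      by (auto simp: z_def w_def complex_eq_iff)
    then show ?thesis unfolding cauchy_kernel_def c_def by (simp only: divide_minus_product_minus)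
  qed
  show "integrable lborel (\<lambda>s. cauchy_kernel \<epsilon> s x * cauchy_kernel \<delta> s t)"
    unfolding eq by (intro integrable_mult_right integrable_two_poles zw)
  have "(LBINT s. 1 / ((of_real s - z) * (of_real s - w))) = 0"
    using zw integral_two_poles[of z w] integral_double_pole[of z] by (cases "z = w") auto
  then show "(LBINT s. cauchy_kernel \<epsilon> s x * cauchy_kernel \<delta> s t) = 0"
    unfolding eq integral_mult_right_zero by simp
qed

text \<open>By Hermitian symmetry
  \<open>cauchy_kernel \<epsilon> x t * cauchy_kernel \<epsilon> t x\<close> is a squared modulus,
  equal to the Poisson kernel over 4 \<pi> \<epsilon>. The semigroup identity on the diagonal
  evaluates its integral as \<open>cauchy_kernel (2 * \<epsilon>) x x\<close>, that is 1/(4 \<pi>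
  \<epsilon>).\<close>

lemma poisson_kernel_integral:
  assumes "\<epsilon> > 0"
  shows "integrable lborel (poisson_kernel \<epsilon> x)" "(LBINT t. poisson_kernel \<epsilon> x t) = 1"
proof -
  have eq: "poisson_kernel \<epsilon> x t = Re ((4 * pi * \<epsilon>) * (cauchy_kernel \<epsilon> x t * cauchy_kernel \<epsilon> t x))" for t
    using cmod_cauchy_kernel_sq[OF assms, of x t] assms
    by (simp flip: cnj_cauchy_kernel[of _ x t] complex_norm_square add: field_simps)
  have i: "integrable lborel (\<lambda>t. (4 * pi * \<epsilon>) * (cauchy_kernel \<epsilon> x t * cauchy_kernel \<epsilon> t x))"
    by (intro integrable_mult_right integral_cauchy_kernel_product assms)
  show "integrable lborel (poisson_kernel \<epsilon> x)"
    unfolding eq by (rule integrable_Re[OF i])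
  show "(LBINT t. poisson_kernel \<epsilon> x t) = 1"
    unfolding eq integral_Re[OF i] using assms
    by (simp add: integral_cauchy_kernel_product) (simp add: cauchy_kernel_def)
qed

lemma poisson_kernel_nn_integral:
  assumes "\<epsilon> > 0"
  shows "(\<integral>\<^sup>+t. ennreal (poisson_kernel \<epsilon> x t) \<partial>lborel) = 1" "(\<integral>\<^sup>+x. ennreal (poisson_kernel \<epsilon> x t) \<partial>lborel) = 1"
proof -
  show *: "(\<integral>\<^sup>+t. ennreal (poisson_kernel \<epsilon> x t) \<partial>lborel) = 1" for x
    using poisson_kernel_integral[OF assms, of x] assms by (simp add: nn_integral_eq_integral poisson_kernel_nonneg)
  show "(\<integral>\<^sup>+x. ennreal (poisson_kernel \<epsilon> x t) \<partial>lborel) = 1"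
    using *[of t] by (simp add: poisson_kernel_commute[of \<epsilon> t])
qed

lemma cauchy_kernel_sq_integrable:
  assumes "\<epsilon> > 0"
  shows "sq_integrable (cauchy_kernel \<epsilon> x)" "sq_integrable (\<lambda>x. cauchy_kernel \<epsilon> x t)"
    "L2nrm (cauchy_kernel \<epsilon> x) = 1 / sqrt (4 * pi * \<epsilon>)" "L2nrm (\<lambda>x. cauchy_kernel \<epsilon> x t) = 1 / sqrt (4 * pi * \<epsilon>)"
proof -
  show *: "sq_integrable (cauchy_kernel \<epsilon> x)" "L2nrm (cauchy_kernel \<epsilon> x) = 1 / sqrt (4 * pi * \<epsilon>)" for x
    using poisson_kernel_integral[OF assms, of x]
    by (simp_all add: sq_integrable_def L2nrm_def cmod_cauchy_kernel_sq[OF assms] real_sqrt_divide)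
  have "(\<lambda>x. cauchy_kernel \<epsilon> x t) = (\<lambda>x. cnj (cauchy_kernel \<epsilon> t x))" by (simp add: cnj_cauchy_kernel)
  then show "sq_integrable (\<lambda>x. cauchy_kernel \<epsilon> x t)" "L2nrm (\<lambda>x. cauchy_kernel \<epsilon> x t) = 1 / sqrt (4 * pi * \<epsilon>)"
    using *[of t] sq_integrable_cnj[OF *(1)[of t]] L2nrm_cnj[of "cauchy_kernel \<epsilon> t"] by simp_all
qed

lemma cmod_cauchy_kernel_antimono:
  assumes "0 < \<epsilon>" "\<epsilon> \<le> \<delta>" shows "cmod (cauchy_kernel \<delta> x t) \<le> cmod (cauchy_kernel \<epsilon> x t)"
proof -
  have "cmod (of_real (t - x) - \<i> * of_real \<epsilon>) \<le> cmod (of_real (t - x) - \<i> * of_real \<delta>)"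
    using assms by (intro power2_le_imp_le[OF _ norm_ge_zero]) (simp add: cmod_shift_sq power_mono del: of_real_diff)
  then show ?thesis using shift_nonzero[of \<epsilon> "t - x"] assms unfolding cauchy_kernel_def
    by (simp add: norm_divide norm_mult frac_le del: of_real_diff)
qed

lemma poisson_cauchy_integral:
  assumes "\<epsilon> > 0" "\<delta> > 0"
  shows "(LBINT s. of_real (poisson_kernel \<delta> x s) * cauchy_kernel \<epsilon> s t) = cauchy_kernel (\<delta> + \<epsilon>) x t"
proof -
  have "(LBINT s. of_real (poisson_kernel \<delta> x s) * cauchy_kernel \<epsilon> s t)
    = (LBINT s. cauchy_kernel \<delta> x s * cauchy_kernel \<epsilon> s t + cauchy_kernel \<delta> s x * cauchy_kernel \<epsilon> s t)"
    by (simp add: cauchy_kernel_add_cnj[OF assms(2), symmetric] distrib_right)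
  also have "\<dots> = cauchy_kernel (\<delta> + \<epsilon>) x t"
    using integral_cauchy_kernel_product[OF assms(2,1), of x t] integral_cauchy_kernel_product_opposite[OF assms(2,1), of x t]
    by simp
  finally show ?thesis .
qed

subsection \<open>Cauchy and Poisson integrals\<close>

definition cauchy_int :: "real \<Rightarrow> (real \<Rightarrow> complex) \<Rightarrow> real \<Rightarrow> complex" where
  "cauchy_int \<epsilon> f x = (LBINT t. cauchy_kernel \<epsilon> x t * f t)"

definition poisson_int :: "real \<Rightarrow> (real \<Rightarrow> complex) \<Rightarrow> real \<Rightarrow> complex" where
  "poisson_int \<epsilon> f x = (LBINT t. of_real (poisson_kernel \<epsilon> x t) * f t)"

lemma cauchy_int_measurable [measurable]:
  assumes [measurable]: "f \<in> borel_measurable borel"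
  shows "cauchy_int \<epsilon> f \<in> borel_measurable borel"
  unfolding cauchy_int_def by measurable

lemma poisson_int_bound:
  assumes "\<epsilon> > 0" "sq_integrable f"
  shows "sq_integrable (poisson_int \<epsilon> f)" "L2nrm (poisson_int \<epsilon> f) \<le> L2nrm f"
  using Schur_operator[of "poisson_kernel \<epsilon>" "\<lambda>_. 1" 1 "\<lambda>x t. of_real (poisson_kernel \<epsilon> x t)" f]
    poisson_kernel_nn_integral[OF assms(1)] assms poisson_kernel_nonneg[of \<epsilon>]
  unfolding poisson_int_def by (auto simp: split_beta')

lemma cauchy_int_integrable:
  assumes "\<epsilon> > 0" "sq_integrable f"
  shows "integrable lborel (\<lambda>t. cauchy_kernel \<epsilon> x t * f t)"
  by (intro L2_Cauchy_Schwarz cauchy_kernel_sq_integrable assms)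

lemma cauchy_int_diff:
  assumes "\<epsilon> > 0" "sq_integrable f" "sq_integrable g"
  shows "cauchy_int \<epsilon> (\<lambda>t. f t - g t) x = cauchy_int \<epsilon> f x - cauchy_int \<epsilon> g x"
  unfolding cauchy_int_def
  using cauchy_int_integrable[OF assms(1,2), of x] cauchy_int_integrable[OF assms(1,3), of x]
  by (simp add: right_diff_distrib)

text \<open>The Cauchy kernel decays only like 1/|t| and is not integrable. Absolute convergence
  comes from Cauchy-Schwarz in s for the two kernels and from the integrability of f in t.\<close>

lemma cauchy_int_cauchy_int:
  assumes e: "\<epsilon> > 0" "\<delta> > 0" and f: "sq_integrable f" "integrable lborel f"
  shows "cauchy_int \<epsilon> (cauchy_int \<delta> f) x = cauchy_int (\<epsilon> + \<delta>) f x"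
proof -
  have [measurable]: "f \<in> borel_measurable borel" using f by (simp add: sq_integrable_def)
  have "cauchy_int \<epsilon> (cauchy_int \<delta> f) x = (LBINT s. LBINT t. cauchy_kernel \<epsilon> x s * cauchy_kernel \<delta> s t * f t)"
    unfolding cauchy_int_def by (simp add: mult.assoc)
  also have "\<dots> = (LBINT t. LBINT s. cauchy_kernel \<epsilon> x s * cauchy_kernel \<delta> s t * f t)"
  proof (rule integral_swap)
    have "(\<integral>\<^sup>+t. (\<integral>\<^sup>+s. ennreal (cmod (cauchy_kernel \<epsilon> x s * cauchy_kernel \<delta> s t * f t)) \<partial>lborel) \<partial>lborel)
       \<le> (\<integral>\<^sup>+t. ennreal (1 / sqrt (4 * pi * \<epsilon>) * (1 / sqrt (4 * pi * \<delta>))) * ennreal (cmod (f t)) \<partial>lborel)"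
    proof (intro nn_integral_mono)
      fix t
      have "(\<integral>\<^sup>+s. ennreal (cmod (cauchy_kernel \<epsilon> x s * cauchy_kernel \<delta> s t * f t)) \<partial>lborel)
          = (\<integral>\<^sup>+s. ennreal (cmod (cauchy_kernel \<epsilon> x s * cauchy_kernel \<delta> s t)) \<partial>lborel) * ennreal (cmod (f t))"
        by (subst nn_integral_multc[symmetric]) (auto simp: norm_mult ennreal_mult[symmetric])
      also have "(\<integral>\<^sup>+s. ennreal (cmod (cauchy_kernel \<epsilon> x s * cauchy_kernel \<delta> s t)) \<partial>lborel)
          = ennreal (LBINT s. cmod (cauchy_kernel \<epsilon> x s * cauchy_kernel \<delta> s t))"
        by (intro nn_integral_eq_integral integrable_norm integral_cauchy_kernel_product e) auto
      also have "\<dots> \<le> ennreal (1 / sqrt (4 * pi * \<epsilon>) * (1 / sqrt (4 * pi * \<delta>)))"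
        using L2_Cauchy_Schwarz(2)[OF cauchy_kernel_sq_integrable(1)[OF e(1), of x] cauchy_kernel_sq_integrable(2)[OF e(2), of t]]
        by (intro ennreal_leI) (simp add: cauchy_kernel_sq_integrable e)
      finally show "(\<integral>\<^sup>+s. ennreal (cmod (cauchy_kernel \<epsilon> x s * cauchy_kernel \<delta> s t * f t)) \<partial>lborel)
          \<le> ennreal (1 / sqrt (4 * pi * \<epsilon>) * (1 / sqrt (4 * pi * \<delta>))) * ennreal (cmod (f t))"
        by (simp add: mult_right_mono)
    qed
    also have "\<dots> = ennreal (1 / sqrt (4 * pi * \<epsilon>) * (1 / sqrt (4 * pi * \<delta>))) * ennreal (LBINT t. cmod (f t))"
      using f(2) by (simp add: nn_integral_cmult nn_integral_eq_integral)
    also have "\<dots> < \<infinity>" by (simp add: ennreal_mult_less_top)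
    finally show "(\<integral>\<^sup>+t. (\<integral>\<^sup>+s. ennreal (cmod (cauchy_kernel \<epsilon> x s * cauchy_kernel \<delta> s t * f t)) \<partial>lborel) \<partial>lborel) < \<infinity>" .
  qed measurable
  also have "\<dots> = cauchy_int (\<epsilon> + \<delta>) f x"
    unfolding cauchy_int_def using integral_cauchy_kernel_product[OF e] by simp
  finally show ?thesis .
qed

text \<open>The Poisson kernel is itself integrable, and Cauchy-Schwarz bounds the inner integral
  uniformly in s; so Fubini applies to every square-integrable f.\<close>

lemma poisson_int_cauchy_int:
  assumes e: "\<epsilon> > 0" "\<delta> > 0" and f: "sq_integrable f"
  shows "poisson_int \<delta> (cauchy_int \<epsilon> f) x = cauchy_int (\<delta> + \<epsilon>) f x"
proof -
  have [measurable]: "f \<in> borel_measurable borel" using f by (simp add: sq_integrable_def)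
  have "poisson_int \<delta> (cauchy_int \<epsilon> f) x = (LBINT s. LBINT t. of_real (poisson_kernel \<delta> x s) * cauchy_kernel \<epsilon> s t * f t)"
    unfolding cauchy_int_def poisson_int_def by (simp add: mult.assoc)
  also have "\<dots> = (LBINT t. LBINT s. of_real (poisson_kernel \<delta> x s) * cauchy_kernel \<epsilon> s t * f t)"
  proof (rule integral_swap(1)[symmetric])
    have "(\<integral>\<^sup>+s. (\<integral>\<^sup>+t. ennreal (cmod (of_real (poisson_kernel \<delta> x s) * cauchy_kernel \<epsilon> s t * f t)) \<partial>lborel) \<partial>lborel)
       \<le> (\<integral>\<^sup>+s. ennreal (1 / sqrt (4 * pi * \<epsilon>) * L2nrm f) * ennreal (poisson_kernel \<delta> x s) \<partial>lborel)"
    proof (intro nn_integral_mono)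
      fix s
      have "(\<integral>\<^sup>+t. ennreal (cmod (of_real (poisson_kernel \<delta> x s) * cauchy_kernel \<epsilon> s t * f t)) \<partial>lborel)
          = ennreal (poisson_kernel \<delta> x s) * (\<integral>\<^sup>+t. ennreal (cmod (cauchy_kernel \<epsilon> s t * f t)) \<partial>lborel)"
        using e by (subst nn_integral_cmult[symmetric]) (auto simp: norm_mult ennreal_mult[symmetric] poisson_kernel_nonneg mult.assoc)
      also have "(\<integral>\<^sup>+t. ennreal (cmod (cauchy_kernel \<epsilon> s t * f t)) \<partial>lborel) = ennreal (LBINT t. cmod (cauchy_kernel \<epsilon> s t * f t))"
        by (intro nn_integral_eq_integral integrable_norm cauchy_int_integrable e f) auto
      also have "\<dots> \<le> ennreal (1 / sqrt (4 * pi * \<epsilon>) * L2nrm f)"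
        using L2_Cauchy_Schwarz(2)[OF cauchy_kernel_sq_integrable(1)[OF e(1), of s] f]
        by (intro ennreal_leI) (simp add: cauchy_kernel_sq_integrable e)
      finally show "(\<integral>\<^sup>+t. ennreal (cmod (of_real (poisson_kernel \<delta> x s) * cauchy_kernel \<epsilon> s t * f t)) \<partial>lborel)
          \<le> ennreal (1 / sqrt (4 * pi * \<epsilon>) * L2nrm f) * ennreal (poisson_kernel \<delta> x s)"
        by (simp only: mult.commute[of _ "ennreal (poisson_kernel \<delta> x s)"] mult_left_mono zero_le)
    qed
    also have "\<dots> = ennreal (1 / sqrt (4 * pi * \<epsilon>) * L2nrm f)"
      using e by (simp add: nn_integral_cmult poisson_kernel_nn_integral)
    also have "\<dots> < \<infinity>" by simp
    finally show "(\<integral>\<^sup>+s. (\<integral>\<^sup>+t. ennreal (cmod (of_real (poisson_kernel \<delta> x s) * cauchy_kernel \<epsilon> s t * f t)) \<partial>lborel) \<partial>lborel) < \<infinity>" .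
  qed measurable
  also have "\<dots> = cauchy_int (\<delta> + \<epsilon>) f x"
    unfolding cauchy_int_def using poisson_cauchy_integral[OF e] by simp
  finally show ?thesis .
qed

lemma L2_norm_sq_eq: "of_real ((L2nrm f)\<^sup>2) = (LBINT t. f t * cnj (f t))"
  unfolding L2nrm_sq integral_complex_of_real[symmetric] by (simp only: complex_norm_square)

text \<open>Cauchy-Schwarz with respect to the measure |f| dt. The resulting bound deteriorates as
  \<epsilon> tends to 0 and serves only to know that the norm is finite; the uniform bound is
  \<open>cauchy_int_bound_L1\<close>.\<close>

lemma sq_integrable_cauchy_int_L1:
  assumes e: "\<epsilon> > 0" and f: "sq_integrable f" "integrable lborel f"
  shows "sq_integrable (cauchy_int \<epsilon> f)"
proof (rule sq_integrableI_finite)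
  have [measurable]: "f \<in> borel_measurable borel" using f by (simp add: sq_integrable_def)
  show "cauchy_int \<epsilon> f \<in> borel_measurable borel" by measurable
  define N where "N = (\<integral>\<^sup>+t. ennreal (cmod (f t)) \<partial>lborel)"
  have N: "N < \<infinity>" unfolding N_def using f(2) by (auto simp: integrable_iff_bounded)
  have "(\<integral>\<^sup>+x. ennreal ((cmod (cauchy_int \<epsilon> f x))\<^sup>2) \<partial>lborel)
    \<le> (\<integral>\<^sup>+x. N * (\<integral>\<^sup>+t. ennreal ((cmod (cauchy_kernel \<epsilon> x t))\<^sup>2) * ennreal (cmod (f t)) \<partial>lborel) \<partial>lborel)"
  proof (intro nn_integral_mono)
    fix x
    have "ennreal ((cmod (cauchy_int \<epsilon> f x))\<^sup>2) = (ennreal (cmod (cauchy_int \<epsilon> f x)))\<^sup>2"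
      by (simp add: ennreal_power)
    also have "\<dots> \<le> (\<integral>\<^sup>+t. ennreal (cmod (cauchy_kernel \<epsilon> x t * f t)) \<partial>lborel)\<^sup>2"
      unfolding cauchy_int_def by (intro power_mono norm_integral_le_nn_integral) auto
    also have "(\<integral>\<^sup>+t. ennreal (cmod (cauchy_kernel \<epsilon> x t * f t)) \<partial>lborel)
        = (\<integral>\<^sup>+t. ennreal (sqrt (cmod (f t))) * ennreal (cmod (cauchy_kernel \<epsilon> x t) * sqrt (cmod (f t))) \<partial>lborel)"
      by (intro nn_integral_cong) (simp add: ennreal_mult[symmetric] norm_mult mult.left_commute)
    also have "\<dots>\<^sup>2 \<le> (\<integral>\<^sup>+t. (ennreal (sqrt (cmod (f t))))\<^sup>2 \<partial>lborel) * (\<integral>\<^sup>+t. (ennreal (cmod (cauchy_kernel \<epsilon> x t) * sqrt (cmod (f t))))\<^sup>2 \<partial>lborel)"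
      by (rule Cauchy_Schwarz_nn_integral) measurable
    also have "\<dots> = N * (\<integral>\<^sup>+t. ennreal ((cmod (cauchy_kernel \<epsilon> x t))\<^sup>2) * ennreal (cmod (f t)) \<partial>lborel)"
      by (simp add: N_def ennreal_power power_mult_distrib ennreal_mult)
    finally show "ennreal ((cmod (cauchy_int \<epsilon> f x))\<^sup>2) \<le> N * (\<integral>\<^sup>+t. ennreal ((cmod (cauchy_kernel \<epsilon> x t))\<^sup>2) * ennreal (cmod (f t)) \<partial>lborel)" .
  qed
  also have "\<dots> = N * (\<integral>\<^sup>+x. (\<integral>\<^sup>+t. ennreal ((cmod (cauchy_kernel \<epsilon> x t))\<^sup>2) * ennreal (cmod (f t)) \<partial>lborel) \<partial>lborel)"
    by (intro nn_integral_cmult) measurable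
  also have "(\<integral>\<^sup>+x. (\<integral>\<^sup>+t. ennreal ((cmod (cauchy_kernel \<epsilon> x t))\<^sup>2) * ennreal (cmod (f t)) \<partial>lborel) \<partial>lborel)
      = (\<integral>\<^sup>+t. (\<integral>\<^sup>+x. ennreal ((cmod (cauchy_kernel \<epsilon> x t))\<^sup>2) * ennreal (cmod (f t)) \<partial>lborel) \<partial>lborel)"
    by (intro lborel_pair.Fubini') measurable
  also have "\<dots> = (\<integral>\<^sup>+t. ennreal ((1 / sqrt (4 * pi * \<epsilon>))\<^sup>2) * ennreal (cmod (f t)) \<partial>lborel)"
    using nn_integral_sq[OF cauchy_kernel_sq_integrable(2)[OF e]]
    by (intro nn_integral_cong) (simp add: nn_integral_multc cauchy_kernel_sq_integrable[OF e])
  also have "\<dots> = ennreal ((1 / sqrt (4 * pi * \<epsilon>))\<^sup>2) * N"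
    by (simp add: nn_integral_cmult N_def)
  also have "N * (ennreal ((1 / sqrt (4 * pi * \<epsilon>))\<^sup>2) * N) < \<infinity>"
    using N by (auto simp: ennreal_mult_less_top)
  finally show "(\<integral>\<^sup>+x. ennreal ((cmod (cauchy_int \<epsilon> f x))\<^sup>2) \<partial>lborel) < \<infinity>" .
qed

text \<open>The Cauchy integrals are self-adjoint and form a semigroup, so all their inner products
  are values of the single function \<open>\<eta> \<mapsto> \<langle>f, D\<^sub>\<eta> f\<rangle>\<close>.\<close>

lemma cauchy_int_inner:
  assumes e: "\<epsilon> > 0" "\<delta> > 0" and f: "sq_integrable f" "integrable lborel f"
  shows "(LBINT x. cauchy_int \<epsilon> f x * cnj (cauchy_int \<delta> f x)) = (LBINT t. f t * cnj (cauchy_int (\<epsilon> + \<delta>) f t))"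
proof -
  let ?g = "cauchy_int \<delta> f"
  have [measurable]: "f \<in> borel_measurable borel" using f by (simp add: sq_integrable_def)
  have g: "sq_integrable ?g" using sq_integrable_cauchy_int_L1[OF e(2) f] .
  have [measurable]: "?g \<in> borel_measurable borel" by measurable
  have "(LBINT x. cauchy_int \<epsilon> f x * cnj (?g x)) = (LBINT x. LBINT t. cauchy_kernel \<epsilon> x t * f t * cnj (?g x))"
    by (simp add: cauchy_int_def[of \<epsilon>])
  also have "\<dots> = (LBINT t. LBINT x. cauchy_kernel \<epsilon> x t * f t * cnj (?g x))"
  proof (rule integral_swap)
    have "(\<integral>\<^sup>+t. (\<integral>\<^sup>+x. ennreal (cmod (cauchy_kernel \<epsilon> x t * f t * cnj (?g x))) \<partial>lborel) \<partial>lborel)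
      \<le> (\<integral>\<^sup>+t. ennreal (1 / sqrt (4 * pi * \<epsilon>) * L2nrm ?g) * ennreal (cmod (f t)) \<partial>lborel)"
    proof (intro nn_integral_mono)
      fix t
      have i: "integrable lborel (\<lambda>x. cauchy_kernel \<epsilon> x t * cnj (?g x))"
        by (intro L2_Cauchy_Schwarz cauchy_kernel_sq_integrable e sq_integrable_cnj g)
      have "(\<integral>\<^sup>+x. ennreal (cmod (cauchy_kernel \<epsilon> x t * f t * cnj (?g x))) \<partial>lborel)
         = (\<integral>\<^sup>+x. ennreal (cmod (cauchy_kernel \<epsilon> x t * cnj (?g x))) * ennreal (cmod (f t)) \<partial>lborel)"
        by (intro nn_integral_cong) (simp add: norm_mult ennreal_mult[symmetric] mult_ac)
      also have "\<dots> = (\<integral>\<^sup>+x. ennreal (cmod (cauchy_kernel \<epsilon> x t * cnj (?g x))) \<partial>lborel) * ennreal (cmod (f t))"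
        using borel_measurable_integrable[OF i] by (intro nn_integral_multc) simp
      also have "(\<integral>\<^sup>+x. ennreal (cmod (cauchy_kernel \<epsilon> x t * cnj (?g x))) \<partial>lborel)
        = ennreal (LBINT x. cmod (cauchy_kernel \<epsilon> x t * cnj (?g x)))"
        by (intro nn_integral_eq_integral integrable_norm i) auto
      also have "\<dots> \<le> ennreal (1 / sqrt (4 * pi * \<epsilon>) * L2nrm ?g)"
        using L2_Cauchy_Schwarz(2)[OF cauchy_kernel_sq_integrable(2)[OF e(1), of t] sq_integrable_cnj[OF g]]
        by (intro ennreal_leI) (simp add: cauchy_kernel_sq_integrable e)
      finally show "(\<integral>\<^sup>+x. ennreal (cmod (cauchy_kernel \<epsilon> x t * f t * cnj (?g x))) \<partial>lborel)
         \<le> ennreal (1 / sqrt (4 * pi * \<epsilon>) * L2nrm ?g) * ennreal (cmod (f t))"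
        by (simp only: mult_right_mono zero_le)
    qed
    also have "\<dots> = ennreal (1 / sqrt (4 * pi * \<epsilon>) * L2nrm ?g) * ennreal (LBINT t. cmod (f t))"
      using f(2) by (simp add: nn_integral_cmult nn_integral_eq_integral)
    also have "\<dots> < \<infinity>" by (simp add: ennreal_mult_less_top)
    finally show "(\<integral>\<^sup>+t. (\<integral>\<^sup>+x. ennreal (cmod (cauchy_kernel \<epsilon> x t * f t * cnj (?g x))) \<partial>lborel) \<partial>lborel) < \<infinity>" .
  next
    show "(\<lambda>(x, t). cauchy_kernel \<epsilon> x t * f t * cnj (?g x)) \<in> borel_measurable (borel \<Otimes>\<^sub>M borel)"
      using sq_integrable_measurable[OF sq_integrable_cnj[OF g]] by measurable
  qed
  also have "\<dots> = (LBINT t. f t * cnj (cauchy_int \<epsilon> ?g t))"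
  proof (intro Bochner_Integration.integral_cong refl)
    fix t
    have "(LBINT x. cauchy_kernel \<epsilon> x t * f t * cnj (?g x)) = (LBINT x. f t * cnj (cauchy_kernel \<epsilon> t x * ?g x))"
      by (intro Bochner_Integration.integral_cong refl) (simp add: cnj_cauchy_kernel mult_ac)
    also have "\<dots> = f t * cnj (cauchy_int \<epsilon> ?g t)"
      unfolding cauchy_int_def[of \<epsilon>] by (simp only: integral_mult_right_zero Bochner_Integration.integral_cnj)
    finally show "(LBINT x. cauchy_kernel \<epsilon> x t * f t * cnj (?g x)) = f t * cnj (cauchy_int \<epsilon> ?g t)" .
  qed
  also have "\<dots> = (LBINT t. f t * cnj (cauchy_int (\<epsilon> + \<delta>) f t))"
    by (simp only: cauchy_int_cauchy_int[OF e f])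
  finally show ?thesis .
qed

lemma cauchy_int_norm_sq:
  assumes e: "\<epsilon> > 0" and f: "sq_integrable f" "integrable lborel f"
  shows "of_real ((L2nrm (cauchy_int (\<epsilon>/2) f))\<^sup>2) = (LBINT t. f t * cnj (cauchy_int \<epsilon> f t))"
  using cauchy_int_inner[of "\<epsilon>/2" "\<epsilon>/2" f] assms unfolding L2_norm_sq_eq by simp

text \<open>With \<eta> = 2 \<epsilon> the decomposition of the Poisson kernel gives <f, P f> = |D
  f|^2 + |D (cnj f)|^2, with P taken at \<eta> and D at \<epsilon>. Both terms are nonnegative, and
  the left side is at most |f|^2 because Poisson integrals are contractions.\<close>

lemma cauchy_int_bound_L1:
  assumes e: "\<epsilon> > 0" and f: "sq_integrable f" "integrable lborel f"
  shows "L2nrm (cauchy_int \<epsilon> f) \<le> L2nrm f"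
proof -
  define \<eta> where "\<eta> = 2 * \<epsilon>"
  have \<eta>: "\<eta> > 0" "\<epsilon> = \<eta> / 2" using e by (auto simp: \<eta>_def)
  let ?f = "\<lambda>t. cnj (f t)"
  have f': "sq_integrable ?f" "integrable lborel ?f" using f by (auto intro: sq_integrable_cnj)
  have P: "cnj (poisson_int \<eta> f t) = cnj (cauchy_int \<eta> f t) + cauchy_int \<eta> ?f t" for t
  proof -
    note i = cauchy_int_integrable[OF \<eta>(1) f(1), of t] cauchy_int_integrable[OF \<eta>(1) f'(1), of t, THEN integrable_cnj]
    have "poisson_int \<eta> f t = (LBINT s. cauchy_kernel \<eta> t s * f s + cnj (cauchy_kernel \<eta> t s * ?f s))"
      unfolding poisson_int_def
      by (intro Bochner_Integration.integral_cong refl)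
         (simp add: cauchy_kernel_add_cnj[OF \<eta>(1), symmetric] distrib_right cnj_cauchy_kernel)
    also have "\<dots> = cauchy_int \<eta> f t + cnj (cauchy_int \<eta> ?f t)"
      unfolding cauchy_int_def Bochner_Integration.integral_cnj[symmetric] by (rule Bochner_Integration.integral_add[OF i])
    finally show ?thesis by simp
  qed
  have "(LBINT t. f t * cnj (poisson_int \<eta> f t))
      = (LBINT t. f t * cnj (cauchy_int \<eta> f t) + cnj (?f t * cnj (cauchy_int \<eta> ?f t)))"
    by (simp add: P distrib_left)
  also have "\<dots> = (LBINT t. f t * cnj (cauchy_int \<eta> f t)) + cnj (LBINT t. ?f t * cnj (cauchy_int \<eta> ?f t))"
  proof (subst Bochner_Integration.integral_cnj[symmetric], rule Bochner_Integration.integral_add)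
    show "integrable lborel (\<lambda>t. f t * cnj (cauchy_int \<eta> f t))"
      by (intro L2_Cauchy_Schwarz f sq_integrable_cnj sq_integrable_cauchy_int_L1 \<eta>)
    show "integrable lborel (\<lambda>t. cnj (?f t * cnj (cauchy_int \<eta> ?f t)))"
      by (intro integrable_cnj L2_Cauchy_Schwarz f' sq_integrable_cnj sq_integrable_cauchy_int_L1 \<eta>)
  qed
  also have "\<dots> = of_real ((L2nrm (cauchy_int \<epsilon> f))\<^sup>2 + (L2nrm (cauchy_int \<epsilon> ?f))\<^sup>2)"
    unfolding \<eta>(2) cauchy_int_norm_sq[OF \<eta>(1) f, symmetric] cauchy_int_norm_sq[OF \<eta>(1) f', symmetric]
    by (simp only: of_real_add complex_cnj_complex_of_real)
  finally have "(L2nrm (cauchy_int \<epsilon> f))\<^sup>2 + (L2nrm (cauchy_int \<epsilon> ?f))\<^sup>2 = cmod (LBINT t. f t * cnj (poisson_int \<eta> f t))"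
    by (simp only: norm_of_real) simp
  also have "\<dots> \<le> L2nrm f * L2nrm (\<lambda>t. cnj (poisson_int \<eta> f t))"
    by (intro L2_Cauchy_Schwarz f sq_integrable_cnj poisson_int_bound \<eta>)
  also have "\<dots> \<le> L2nrm f * L2nrm f"
    using poisson_int_bound[OF \<eta>(1) f(1)] by (simp add: mult_left_mono)
  finally have "(L2nrm (cauchy_int \<epsilon> f))\<^sup>2 \<le> (L2nrm f)\<^sup>2"
    unfolding power2_eq_square[of "L2nrm f"] using zero_le_power2[of "L2nrm (cauchy_int \<epsilon> ?f)"] by linarith
  then show ?thesis by (simp add: power2_le_iff_abs_le)
qed

section \<open>All square-integrable functions, and the L2 boundary value of the Cauchy
  integral\<close>

definition cutoff :: "nat \<Rightarrow> (real \<Rightarrow> complex) \<Rightarrow> real \<Rightarrow> complex" where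
  "cutoff n f t = indicator {- real n..real n} t * f t"

lemma cutoff:
  assumes f: "sq_integrable f"
  shows "sq_integrable (cutoff n f)" "integrable lborel (cutoff n f)"
    "(\<lambda>n. L2nrm (\<lambda>t. f t - cutoff n f t)) \<longlonglongrightarrow> 0"
proof -
  have [measurable]: "f \<in> borel_measurable borel" using f by (simp add: sq_integrable_def)
  show "sq_integrable (cutoff n f)"
    unfolding cutoff_def by (intro sq_integrable_mono[OF f]) (auto simp: indicator_def)
  have "(\<lambda>t. (cmod (indicator {- real n..real n} t))\<^sup>2) = indicat_real {- real n..real n}"
    by (auto simp: indicator_def fun_eq_iff)
  then have "sq_integrable (indicator {- real n..real n} :: real \<Rightarrow> complex)"
    using integrable_real_indicator[of "{- real n..real n}" lborel] by (simp add: sq_integrable_def)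
  then show "integrable lborel (cutoff n f)"
    unfolding cutoff_def by (intro L2_Cauchy_Schwarz f)
  have "\<forall>\<^sub>F n in sequentially. t \<in> {- real n..real n}" for t
    using eventually_ge_at_top[of "nat \<lceil>\<bar>t\<bar>\<rceil>"] by eventually_elim auto
  then show "(\<lambda>n. L2nrm (\<lambda>t. f t - cutoff n f t)) \<longlonglongrightarrow> 0"
    unfolding cutoff_def by (intro L2_cutoff_tendsto f AE_I2 impI) simp_all
qed

lemma L2_continuous_functional:
  assumes k: "sq_integrable k" and f: "\<And>n. sq_integrable (f n)" "sq_integrable g"
    and lim: "((\<lambda>n. L2nrm (\<lambda>t. f n t - g t)) \<longlongrightarrow> 0) F"
  shows "((\<lambda>n. LBINT t. k t * f n t) \<longlongrightarrow> (LBINT t. k t * g t)) F"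
proof (rule Lim_null[THEN iffD2], rule Lim_null_comparison[OF always_eventually[OF allI]])
  fix n
  have "(LBINT t. k t * f n t) - (LBINT t. k t * g t) = (LBINT t. k t * (f n t - g t))"
    using L2_Cauchy_Schwarz(1)[OF k f(1), of n] L2_Cauchy_Schwarz(1)[OF k f(2)]
    by (simp add: right_diff_distrib)
  then show "cmod ((LBINT t. k t * f n t) - (LBINT t. k t * g t)) \<le> L2nrm k * L2nrm (\<lambda>t. f n t - g t)"
    using L2_Cauchy_Schwarz(3)[OF k sq_integrable_diff[OF f(1) f(2)], of n] by simp
next
  show "((\<lambda>n. L2nrm k * L2nrm (\<lambda>t. f n t - g t)) \<longlongrightarrow> 0) F"
    using tendsto_mult_left[OF lim, of "L2nrm k"] by simp
qed

text \<open>For fixed \<epsilon> and x the kernel is in L2, so the Cauchy integrals of the cutoffs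
  converge at every x, and Fatou passes on their uniform bound.\<close>

lemma cauchy_int_bound:
  assumes e: "\<epsilon> > 0" and f: "sq_integrable f"
  shows "sq_integrable (cauchy_int \<epsilon> f)" "L2nrm (cauchy_int \<epsilon> f) \<le> L2nrm f"
proof -
  have [measurable]: "f \<in> borel_measurable borel" using f by (simp add: sq_integrable_def)
  have le: "L2nrm (cauchy_int \<epsilon> (cutoff n f)) \<le> L2nrm f" for n
  proof -
    have "L2nrm (cauchy_int \<epsilon> (cutoff n f)) \<le> L2nrm (cutoff n f)"
      by (intro cauchy_int_bound_L1 e cutoff f)
    also have "\<dots> \<le> L2nrm f"
      unfolding cutoff_def by (intro sq_integrable_mono[OF f]) (auto simp: indicator_def)
    finally show ?thesis .
  qed
  have lim: "(\<lambda>n. cauchy_int \<epsilon> (cutoff n f) x) \<longlonglongrightarrow> cauchy_int \<epsilon> f x" for x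
    unfolding cauchy_int_def
  proof (rule L2_continuous_functional)
    show "(\<lambda>n. L2nrm (\<lambda>t. cutoff n f t - f t)) \<longlonglongrightarrow> 0"
      using cutoff(3)[OF f] by (simp add: L2nrm_minus_commute)
  qed (use cutoff f cauchy_kernel_sq_integrable e in auto)
  show "sq_integrable (cauchy_int \<epsilon> f)" "L2nrm (cauchy_int \<epsilon> f) \<le> L2nrm f"
    using L2_Fatou[of "\<lambda>n. cauchy_int \<epsilon> (cutoff n f)" "cauchy_int \<epsilon> f" "L2nrm f"]
      lim le cutoff[OF f] sq_integrable_cauchy_int_L1[OF e] by auto
qed

text \<open>Increasing the parameter amounts to applying a Poisson integral, which is a
  contraction.\<close>

lemma cauchy_int_norm_antimono:
  assumes "0 < \<epsilon>" "\<epsilon> \<le> \<delta>" and f: "sq_integrable f"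
  shows "L2nrm (cauchy_int \<delta> f) \<le> L2nrm (cauchy_int \<epsilon> f)"
proof (cases "\<epsilon> = \<delta>")
  case False
  then have d: "\<delta> - \<epsilon> > 0" using assms by simp
  have "cauchy_int \<delta> f = poisson_int (\<delta> - \<epsilon>) (cauchy_int \<epsilon> f)"
    using poisson_int_cauchy_int[OF assms(1) d f] by auto
  then show ?thesis using poisson_int_bound(2)[OF d cauchy_int_bound(1)[OF assms(1) f]] by simp
qed simp

text \<open>Expanding the square, both cross terms equal the squared norm at the mean parameter
  (\<epsilon> + \<delta>)/2, which by monotonicity is at least the one at \<delta>. Convergence of a
  bounded monotone sequence of norms thereby becomes a Cauchy property in L2.\<close>

lemma cauchy_int_diff_norm:
  assumes e: "0 < \<epsilon>" "\<epsilon> \<le> \<delta>" and f: "sq_integrable f" "integrable lborel f"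
  shows "(L2nrm (\<lambda>t. cauchy_int \<epsilon> f t - cauchy_int \<delta> f t))\<^sup>2 \<le> (L2nrm (cauchy_int \<epsilon> f))\<^sup>2 - (L2nrm (cauchy_int \<delta> f))\<^sup>2"
proof -
  have d: "\<delta> > 0" "\<epsilon> + \<delta> > 0" using e by auto
  let ?u = "cauchy_int \<epsilon> f" and ?v = "cauchy_int \<delta> f" and ?w = "cauchy_int ((\<epsilon> + \<delta>)/2) f"
  have u: "sq_integrable ?u" and v: "sq_integrable ?v" using cauchy_int_bound e d f by auto
  have uv: "(LBINT x. ?u x * cnj (?v x)) = of_real ((L2nrm ?w)\<^sup>2)" "(LBINT x. ?v x * cnj (?u x)) = of_real ((L2nrm ?w)\<^sup>2)"
    using cauchy_int_inner[OF e(1) d(1) f] cauchy_int_inner[OF d(1) e(1) f] cauchy_int_norm_sq[OF d(2) f]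
    by (simp_all add: add.commute)
  have "complex_of_real ((L2nrm (\<lambda>t. ?u t - ?v t))\<^sup>2)
      = (LBINT t. (?u t * cnj (?u t) - ?u t * cnj (?v t)) - (?v t * cnj (?u t) - ?v t * cnj (?v t)))"
    unfolding L2_norm_sq_eq by (simp add: algebra_simps)
  also have "\<dots> = ((LBINT t. ?u t * cnj (?u t)) - (LBINT t. ?u t * cnj (?v t))) - ((LBINT t. ?v t * cnj (?u t)) - (LBINT t. ?v t * cnj (?v t)))"
    using L2_Cauchy_Schwarz(1)[OF u sq_integrable_cnj[OF u]] L2_Cauchy_Schwarz(1)[OF u sq_integrable_cnj[OF v]]
      L2_Cauchy_Schwarz(1)[OF v sq_integrable_cnj[OF u]] L2_Cauchy_Schwarz(1)[OF v sq_integrable_cnj[OF v]]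
    by simp
  also have "\<dots> = of_real ((L2nrm ?u)\<^sup>2 + (L2nrm ?v)\<^sup>2 - 2 * (L2nrm ?w)\<^sup>2)"
    unfolding uv L2_norm_sq_eq[symmetric] by simp
  finally have "(L2nrm (\<lambda>t. ?u t - ?v t))\<^sup>2 = (L2nrm ?u)\<^sup>2 + (L2nrm ?v)\<^sup>2 - 2 * (L2nrm ?w)\<^sup>2"
    by (simp only: of_real_eq_iff)
  moreover have "(L2nrm ?v)\<^sup>2 \<le> (L2nrm ?w)\<^sup>2"
    using e f by (intro power_mono cauchy_int_norm_antimono) auto
  ultimately show ?thesis by simp
qed

definition null_seq :: "nat \<Rightarrow> real" where "null_seq n = 1 / (real n + 1)"

lemma null_seq: "null_seq n > 0" "null_seq \<longlonglongrightarrow> 0" "filterlim null_seq (at_right 0) sequentially" "m \<le> n \<Longrightarrow> null_seq n \<le> null_seq m"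
proof -
  show p: "null_seq n > 0" for n by (simp add: null_seq_def)
  show l: "null_seq \<longlonglongrightarrow> 0" unfolding null_seq_def using LIMSEQ_inverse_real_of_nat by (simp add: divide_inverse add.commute)
  show "filterlim null_seq (at_right 0) sequentially" using p l by (simp add: tendsto_imp_filterlim_at_right)
  show "m \<le> n \<Longrightarrow> null_seq n \<le> null_seq m" by (simp add: null_seq_def frac_le)
qed

lemma cauchy_int_Cauchy:
  assumes f: "sq_integrable f" and "e > 0"
  shows "\<exists>N. \<forall>m\<ge>N. \<forall>n\<ge>N. L2nrm (\<lambda>t. cauchy_int (null_seq m) f t - cauchy_int (null_seq n) f t) < e"
proof -
  \<comment> \<open>The difference estimate is available for integrable functions only. A cutoff
    with error below e/4 costs, by contractivity at both indices, less than e/2; the other e/2 is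
    left for the cutoff itself.\<close>
  have "\<forall>\<^sub>F k in sequentially. L2nrm (\<lambda>t. f t - cutoff k f t) < e/4"
    using cutoff(3)[OF f] \<open>e > 0\<close> by (intro order_tendstoD) auto
  then obtain k where k: "L2nrm (\<lambda>t. f t - cutoff k f t) < e/4"
    by (auto simp: eventually_sequentially)
  define g where "g = cutoff k f"
  have g: "sq_integrable g" "integrable lborel g" unfolding g_def by (intro cutoff f)+
  define a where "a n = (L2nrm (cauchy_int (null_seq n) g))\<^sup>2" for n
  have "incseq a" unfolding a_def
    by (intro incseq_SucI power_mono cauchy_int_norm_antimono g null_seq) auto
  moreover have "a n \<le> (L2nrm g)\<^sup>2" for n
    unfolding a_def by (intro power_mono cauchy_int_bound g null_seq) auto
  ultimately have "convergent a" by (metis incseq_convergent convergentI)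
  then have "Cauchy a" by (rule convergent_Cauchy)
  then obtain N where N: "\<And>m n. m \<ge> N \<Longrightarrow> n \<ge> N \<Longrightarrow> dist (a m) (a n) < (e/2)\<^sup>2"
    using \<open>e > 0\<close> unfolding Cauchy_def by (metis half_gt_zero zero_less_power)
  have est: "L2nrm (\<lambda>t. cauchy_int (null_seq m) g t - cauchy_int (null_seq n) g t) < e/2" if "m \<ge> N" "n \<ge> N" "n \<le> m" for m n
  proof -
    have "(L2nrm (\<lambda>t. cauchy_int (null_seq m) g t - cauchy_int (null_seq n) g t))\<^sup>2 \<le> a m - a n"
      unfolding a_def by (intro cauchy_int_diff_norm null_seq g that)
    also have "\<dots> < (e/2)\<^sup>2" using N[OF that(1,2)] by (simp add: dist_real_def)
    finally show ?thesis by (rule power2_less_imp_less) (use \<open>e > 0\<close> in auto)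
  qed
  have "L2nrm (\<lambda>t. cauchy_int (null_seq m) f t - cauchy_int (null_seq n) f t) < e" if "m \<ge> N" "n \<ge> N" for m n
  proof -
    let ?D = "\<lambda>n h. cauchy_int (null_seq n) h"
    let ?h = "\<lambda>t. f t - g t"
    have h: "sq_integrable ?h" by (intro sq_integrable_diff f g)
    have s: "sq_integrable (?D n u)" "L2nrm (?D n u) \<le> L2nrm u" if "sq_integrable u" for n u
      by (intro cauchy_int_bound null_seq that)+
    have "(\<lambda>t. ?D m f t - ?D n f t) = (\<lambda>t. (?D m g t - ?D n g t) + (?D m ?h t - ?D n ?h t))"
      using cauchy_int_diff[OF null_seq(1) f g(1)] by auto
    then have "L2nrm (\<lambda>t. ?D m f t - ?D n f t) \<le> L2nrm (\<lambda>t. ?D m g t - ?D n g t) + L2nrm (\<lambda>t. ?D m ?h t - ?D n ?h t)"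
      using L2nrm_triangle[OF sq_integrable_diff[OF s(1) s(1)] sq_integrable_diff[OF s(1) s(1)], OF g(1) g(1) h h] by simp
    also have "L2nrm (\<lambda>t. ?D m ?h t - ?D n ?h t) \<le> L2nrm (?D m ?h) + L2nrm (?D n ?h)"
      by (intro L2nrm_triangle_diff s h)
    also have "\<dots> \<le> L2nrm ?h + L2nrm ?h" by (intro add_mono s h)
    also have "\<dots> < e/2" using k by (simp add: g_def)
    finally have "L2nrm (\<lambda>t. ?D m f t - ?D n f t) < L2nrm (\<lambda>t. ?D m g t - ?D n g t) + e/2" by simp
    moreover have "L2nrm (\<lambda>t. ?D m g t - ?D n g t) < e/2"
      using est[of m n] est[of n m] that L2nrm_minus_commute[of "?D m g" "?D n g"] by (cases "n \<le> m") auto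
    ultimately show ?thesis by simp
  qed
  then show ?thesis by blast
qed

lemma cauchy_kernel_tendsto:
  assumes "\<delta> > 0"
  shows "(\<lambda>n. cauchy_kernel (\<delta> + null_seq n) x t) \<longlonglongrightarrow> cauchy_kernel \<delta> x t"
proof -
  have "(\<lambda>n. \<delta> + null_seq n) \<longlonglongrightarrow> \<delta> + 0" by (intro tendsto_add tendsto_const null_seq)
  then show ?thesis
    using shift_nonzero[of \<delta> "t - x"] assms unfolding cauchy_kernel_def
    by (intro tendsto_divide tendsto_const tendsto_diff tendsto_mult tendsto_of_real) (auto simp del: of_real_diff)
qed

text \<open>The last clause results from letting n tend to infinity in P D = D at parameters
  \<delta>, \<open>null_seq n\<close> and \<open>\<delta> + null_seq n\<close>. It ties D at every
  positive parameter to the single function g, so that convergence along one sequence can become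
  convergence for all \<epsilon>.\<close>

lemma cauchy_int_limit:
  assumes f: "sq_integrable f"
  shows "\<exists>g. sq_integrable g \<and> L2nrm g \<le> L2nrm f \<and>
    (\<lambda>n. L2nrm (\<lambda>t. cauchy_int (null_seq n) f t - g t)) \<longlonglongrightarrow> 0 \<and>
    (\<forall>\<delta>>0. \<forall>x. poisson_int \<delta> g x = cauchy_int \<delta> f x)"
proof -
  have [measurable]: "f \<in> borel_measurable borel" using f by (simp add: sq_integrable_def)
  let ?D = "\<lambda>n. cauchy_int (null_seq n) f"
  have D: "sq_integrable (?D n)" "L2nrm (?D n) \<le> L2nrm f" for n by (intro cauchy_int_bound null_seq f)+
  obtain g where g: "sq_integrable g" "(\<lambda>n. L2nrm (\<lambda>t. ?D n t - g t)) \<longlonglongrightarrow> 0"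
    by (rule L2_complete[of ?D, OF D(1) cauchy_int_Cauchy[OF f]])
  have "L2nrm g \<le> L2nrm f"
  proof (rule LIMSEQ_le[OF tendsto_const])
    show "(\<lambda>n. L2nrm f + L2nrm (\<lambda>t. ?D n t - g t)) \<longlonglongrightarrow> L2nrm f"
      using tendsto_add[OF tendsto_const g(2)] by simp
    have "L2nrm g \<le> L2nrm f + L2nrm (\<lambda>t. ?D n t - g t)" for n
      using L2nrm_triangle_diff[OF D(1) sq_integrable_diff[OF D(1) g(1)], of n n] D(2)[of n] by simp
    then show "\<exists>N. \<forall>n\<ge>N. L2nrm g \<le> L2nrm f + L2nrm (\<lambda>t. ?D n t - g t)" by blast
  qed
  moreover have "poisson_int \<delta> g x = cauchy_int \<delta> f x" if d: "\<delta> > 0" for \<delta> x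
  proof (rule LIMSEQ_unique)
    have "sq_integrable (\<lambda>t. complex_of_real (poisson_kernel \<delta> x t))"
      unfolding cauchy_kernel_add_cnj[OF d, symmetric] by (intro sq_integrable_add cauchy_kernel_sq_integrable d)
    then show "(\<lambda>n. poisson_int \<delta> (?D n) x) \<longlonglongrightarrow> poisson_int \<delta> g x"
      unfolding poisson_int_def by (intro L2_continuous_functional D g)
    have "(\<lambda>n. cauchy_int (\<delta> + null_seq n) f x) \<longlonglongrightarrow> cauchy_int \<delta> f x"
      unfolding cauchy_int_def
    proof (rule integral_dominated_convergence[where w="\<lambda>t. cmod (cauchy_kernel \<delta> x t * f t)"])
      show "AE t in lborel. (\<lambda>n. cauchy_kernel (\<delta> + null_seq n) x t * f t) \<longlonglongrightarrow> cauchy_kernel \<delta> x t * f t"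
        by (intro AE_I2 tendsto_mult tendsto_const cauchy_kernel_tendsto d)
      show "AE t in lborel. cmod (cauchy_kernel (\<delta> + null_seq n) x t * f t) \<le> cmod (cauchy_kernel \<delta> x t * f t)" for n
        using d null_seq(1)[of n] by (intro AE_I2) (auto simp: norm_mult intro!: mult_right_mono cmod_cauchy_kernel_antimono)
      show "integrable lborel (\<lambda>t. cmod (cauchy_kernel \<delta> x t * f t))"
        by (intro integrable_norm cauchy_int_integrable d f)
    qed measurable
    then show "(\<lambda>n. poisson_int \<delta> (?D n) x) \<longlonglongrightarrow> cauchy_int \<delta> f x"
      by (simp add: poisson_int_cauchy_int[OF null_seq(1) d f])
  qed
  ultimately show ?thesis using g by blast
qed

subsection \<open>The maximal inequality and Lebesgue points\<close>

text \<open>Vitali's covering argument: among the balls carrying mass above a times their radius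
  take disjoint ones whose fivefold enlargements cover the rest. An enlargement of radius 5u has
  length 10u against mass at least a u, whence 10/a. The exceptional set is the union of the
  enlargements, which is open, so no maximal function has to be measured.\<close>

lemma Hardy_Littlewood_weak:
  fixes \<phi> :: "real \<Rightarrow> ennreal"
  assumes [measurable]: "\<phi> \<in> borel_measurable borel" and a: "a > 0"
    and fin: "(\<integral>\<^sup>+t. \<phi> t \<partial>lborel) < \<infinity>"
  shows "\<exists>E\<in>sets borel. emeasure lborel E \<le> ennreal (10 / a) * (\<integral>\<^sup>+t. \<phi> t \<partial>lborel) \<and>
    (\<forall>x. x \<notin> E \<longrightarrow> (\<forall>u>0. (\<integral>\<^sup>+t. \<phi> t * indicator (cball x u) t \<partial>lborel) \<le> ennreal (a * u)))"
proof -
  define \<nu> where "\<nu> = density lborel \<phi>"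
  have \<nu>: "emeasure \<nu> A = (\<integral>\<^sup>+t. \<phi> t * indicator A t \<partial>lborel)" if "A \<in> sets borel" for A
    unfolding \<nu>_def using that by (simp add: emeasure_density)
  have sets_\<nu>: "sets \<nu> = sets borel" by (simp add: \<nu>_def)
  define I where "I = (\<integral>\<^sup>+t. \<phi> t \<partial>lborel)"
  have \<nu>_le: "emeasure \<nu> A \<le> I" if "A \<in> sets borel" for A
    unfolding \<nu>[OF that] I_def by (intro nn_integral_mono) (auto simp: indicator_def)
  define K where "K = {p :: real \<times> real. snd p > 0 \<and> emeasure \<nu> (cball (fst p) (snd p)) > ennreal (a * snd p)}"
  \<comment> \<open>Vitali's lemma requires bounded radii: the mass a u of such a ball cannot exceed
    the total mass \<open>I\<close>.\<close>
  have bd: "0 < snd p \<and> snd p \<le> enn2real I / a" if "p \<in> K" for p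
  proof -
    have "ennreal (a * snd p) < I" "snd p > 0"
      using that \<nu>_le[of "cball (fst p) (snd p)"] unfolding K_def by auto
    moreover have "I < top" using fin by (simp add: I_def)
    ultimately have "a * snd p \<le> enn2real I"
      using a by (metis enn2real_mono enn2real_ennreal less_imp_le mult_nonneg_nonneg)
    then show ?thesis using a \<open>snd p > 0\<close> by (simp add: field_simps)
  qed
  obtain C where C: "countable C" "C \<subseteq> K"
     "pairwise (\<lambda>i j. disjnt (cball (fst i) (snd i)) (cball (fst j) (snd j))) C"
     "\<And>i. i \<in> K \<Longrightarrow> \<exists>j. j \<in> C \<and> \<not> disjnt (cball (fst i) (snd i)) (cball (fst j) (snd j)) \<and>
                        cball (fst i) (snd i) \<subseteq> ball (fst j) (5 * snd j)"
    by (rule Vitali_covering_lemma_cballs_balls[of K snd "enn2real I / a" fst, OF bd]) (assumption, rule that, assumption, assumption, assumption, blast)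
  \<comment> \<open>The countable family is renumbered by naturals, with the empty set outside
    \<open>J\<close>, so that countable subadditivity and additivity apply to plain
    sequences.\<close>
  define J where "J = to_nat_on C ` C"
  define p where "p = inv_into C (to_nat_on C)"
  have p: "p i \<in> C" if "i \<in> J" for i using that unfolding J_def p_def by (rule inv_into_into)
  have p_inj: "p i \<noteq> p j" if "i \<in> J" "j \<in> J" "i \<noteq> j" for i j
    using inv_into_injective[of C "to_nat_on C" i j] that by (auto simp: J_def p_def)
  have C_p: "\<exists>i\<in>J. p i = j" if "j \<in> C" for j
    using that C(1) unfolding J_def p_def by (auto simp: inv_into_f_f inj_on_to_nat_on)
  define X where "X i = (if i \<in> J then ball (fst (p i)) (5 * snd (p i)) else {})" for i
  define Y where "Y i = (if i \<in> J then cball (fst (p i)) (snd (p i)) else {})" for i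
  have [measurable]: "X i \<in> sets borel" "Y i \<in> sets borel" for i by (auto simp: X_def Y_def)
  have disj: "disjoint_family Y"
    unfolding disjoint_family_on_def
  proof (intro ballI impI)
    fix i j :: nat assume "i \<noteq> j"
    show "Y i \<inter> Y j = {}"
    proof (cases "i \<in> J \<and> j \<in> J")
      case True
      then show ?thesis using pairwiseD[OF C(3) p p p_inj] \<open>i \<noteq> j\<close> by (auto simp: Y_def disjnt_def)
    qed (auto simp: Y_def)
  qed
  have XY: "emeasure lborel (X i) \<le> ennreal (10 / a) * emeasure \<nu> (Y i)" for i
  proof (cases "i \<in> J")
    case True
    then have "p i \<in> K" using p C(2) by blast
    then have q: "snd (p i) > 0" "ennreal (a * snd (p i)) \<le> emeasure \<nu> (Y i)" using True by (auto simp: K_def Y_def)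
    have "emeasure lborel (X i) = ennreal (10 / a) * ennreal (a * snd (p i))"
      using True q a by (simp add: X_def ball_eq_greaterThanLessThan ennreal_mult[symmetric])
    then show ?thesis using q(2) by (simp add: mult_left_mono)
  qed (simp add: X_def)
  have "emeasure lborel (\<Union>i. X i) \<le> (\<Sum>i. emeasure lborel (X i))"
    by (intro emeasure_subadditive_countably) auto
  also have "\<dots> \<le> (\<Sum>i. ennreal (10 / a) * emeasure \<nu> (Y i))" by (intro suminf_le XY) auto
  also have "\<dots> = ennreal (10 / a) * emeasure \<nu> (\<Union>i. Y i)"
    using disj by (subst suminf_emeasure[symmetric]) (auto simp: sets_\<nu>)
  also have "\<dots> \<le> ennreal (10 / a) * I"
    by (intro mult_left_mono \<nu>_le) auto
  finally have m: "emeasure lborel (\<Union>i. X i) \<le> ennreal (10 / a) * I" .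
  have "emeasure \<nu> (cball x u) \<le> ennreal (a * u)" if "x \<notin> (\<Union>i. X i)" "u > 0" for x u
  proof (rule ccontr)
    assume "\<not> ?thesis"
    then have "(x, u) \<in> K" using that by (auto simp: K_def)
    then obtain j where j: "j \<in> C" "cball x u \<subseteq> ball (fst j) (5 * snd j)" using C(4) by force
    then obtain i where "i \<in> J" "p i = j" using C_p by blast
    moreover have "x \<in> ball (fst j) (5 * snd j)" using subsetD[OF j(2), of x] that(2) by simp
    ultimately have "x \<in> X i" by (auto simp: X_def)
    then show False using that by blast
  qed
  then show ?thesis using m \<nu> unfolding I_def by (intro bexI[of _ "\<Union>i. X i"]) auto
qed

text \<open>A positive superposition of indicators of the intervals |v| \<le> u: bounds for
  integrals over balls become bounds for Poisson integrals.\<close>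

lemma layer_cake:
  assumes "\<epsilon> > 0"
  shows "ennreal (1 / (v\<^sup>2 + \<epsilon>\<^sup>2)) = (\<integral>\<^sup>+u. ennreal (2 * u / (u\<^sup>2 + \<epsilon>\<^sup>2)\<^sup>2) * indicator {\<bar>v\<bar>..} u \<partial>lborel)"
proof -
  have nz: "u\<^sup>2 + \<epsilon>\<^sup>2 \<noteq> 0" for u :: real using sum_square_pos[OF assms, of u] by linarith
  have "(\<integral>\<^sup>+u. ennreal (2 * u / (u\<^sup>2 + \<epsilon>\<^sup>2)\<^sup>2) * indicator {\<bar>v\<bar>..} u \<partial>lborel) = ennreal (0 - (- 1 / (\<bar>v\<bar>\<^sup>2 + \<epsilon>\<^sup>2)))"
  proof (rule nn_integral_FTC_atLeast)
    fix u :: real assume u: "\<bar>v\<bar> \<le> u"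
    show "((\<lambda>u. - 1 / (u\<^sup>2 + \<epsilon>\<^sup>2)) has_real_derivative 2 * u / (u\<^sup>2 + \<epsilon>\<^sup>2)\<^sup>2) (at u)"
      using nz[of u] by (auto intro!: derivative_eq_intros simp: power2_eq_square)
    show "0 \<le> 2 * u / (u\<^sup>2 + \<epsilon>\<^sup>2)\<^sup>2" using u by simp
  next
    show "((\<lambda>u. - 1 / (u\<^sup>2 + \<epsilon>\<^sup>2)) \<longlongrightarrow> 0) at_top"
      by real_asymp
  qed measurable
  then show ?thesis by simp
qed

lemma poisson_maximal:
  fixes \<phi> :: "real \<Rightarrow> ennreal"
  assumes [measurable]: "\<phi> \<in> borel_measurable borel" and a: "a > 0"
    and le: "\<And>u. u > 0 \<Longrightarrow> (\<integral>\<^sup>+t. \<phi> t * indicator (cball x u) t \<partial>lborel) \<le> ennreal (a * u)"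
    and e: "\<epsilon> > 0"
  shows "(\<integral>\<^sup>+t. ennreal (poisson_kernel \<epsilon> x t) * \<phi> t \<partial>lborel) \<le> ennreal (2 * a)"
proof -
  have "(\<integral>\<^sup>+t. ennreal (poisson_kernel \<epsilon> x t) * \<phi> t \<partial>lborel)
      = (\<integral>\<^sup>+t. (\<integral>\<^sup>+u. ennreal (\<epsilon> / pi) * ennreal (2 * u / (u\<^sup>2 + \<epsilon>\<^sup>2)\<^sup>2) * indicator {p. \<bar>snd p - x\<bar> \<le> fst p} (u, t) * \<phi> t \<partial>lborel) \<partial>lborel)"
  proof (intro nn_integral_cong)
    fix t
    have "ennreal (poisson_kernel \<epsilon> x t) = ennreal (\<epsilon> / pi) * ennreal (1 / ((t - x)\<^sup>2 + \<epsilon>\<^sup>2))"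
      using e by (simp add: poisson_kernel_def ennreal_mult[symmetric])
    also have "\<dots> * \<phi> t = (\<integral>\<^sup>+u. ennreal (\<epsilon> / pi) * (ennreal (2 * u / (u\<^sup>2 + \<epsilon>\<^sup>2)\<^sup>2) * indicator {\<bar>t - x\<bar>..} u) \<partial>lborel) * \<phi> t"
      unfolding layer_cake[OF e] by (simp add: nn_integral_cmult)
    also have "\<dots> = (\<integral>\<^sup>+u. ennreal (\<epsilon> / pi) * (ennreal (2 * u / (u\<^sup>2 + \<epsilon>\<^sup>2)\<^sup>2) * indicator {\<bar>t - x\<bar>..} u) * \<phi> t \<partial>lborel)"
      by (simp add: nn_integral_multc)
    also have "\<dots> = (\<integral>\<^sup>+u. ennreal (\<epsilon> / pi) * ennreal (2 * u / (u\<^sup>2 + \<epsilon>\<^sup>2)\<^sup>2) * indicator {p. \<bar>snd p - x\<bar> \<le> fst p} (u, t) * \<phi> t \<partial>lborel)"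
      by (intro nn_integral_cong) (auto simp: indicator_def mult_ac)
    finally show "ennreal (poisson_kernel \<epsilon> x t) * \<phi> t = (\<integral>\<^sup>+u. ennreal (\<epsilon> / pi) * ennreal (2 * u / (u\<^sup>2 + \<epsilon>\<^sup>2)\<^sup>2) * indicator {p. \<bar>snd p - x\<bar> \<le> fst p} (u, t) * \<phi> t \<partial>lborel)" .
  qed
  also have "\<dots> = (\<integral>\<^sup>+u. (\<integral>\<^sup>+t. ennreal (\<epsilon> / pi) * ennreal (2 * u / (u\<^sup>2 + \<epsilon>\<^sup>2)\<^sup>2) * indicator {p. \<bar>snd p - x\<bar> \<le> fst p} (u, t) * \<phi> t \<partial>lborel) \<partial>lborel)"
    by (intro lborel_pair.Fubini') measurable
  \<comment> \<open>The ball estimate contributes a factor a u, and u^2 \<le> u^2 + \<epsilon>^2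
    cancels one power of the denominator. What remains is 2a times a Poisson kernel centred at 0,
    whose total mass is 1.\<close>
  also have "\<dots> \<le> (\<integral>\<^sup>+u. ennreal (2 * a) * ennreal (poisson_kernel \<epsilon> 0 u) \<partial>lborel)"
  proof (intro nn_integral_mono_AE)
    have "AE u in lborel. u \<noteq> (0::real)" by (rule AE_lborel_singleton)
    then show "AE u in lborel. (\<integral>\<^sup>+t. ennreal (\<epsilon> / pi) * ennreal (2 * u / (u\<^sup>2 + \<epsilon>\<^sup>2)\<^sup>2) * indicator {p. \<bar>snd p - x\<bar> \<le> fst p} (u, t) * \<phi> t \<partial>lborel)
        \<le> ennreal (2 * a) * ennreal (poisson_kernel \<epsilon> 0 u)"
    proof eventually_elim
      case (elim u)
      show ?case
      proof (cases "u > 0")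
        case True
        have [measurable]: "cball x u \<in> sets borel" by simp
        have "(\<integral>\<^sup>+t. ennreal (\<epsilon> / pi) * ennreal (2 * u / (u\<^sup>2 + \<epsilon>\<^sup>2)\<^sup>2) * indicator {p. \<bar>snd p - x\<bar> \<le> fst p} (u, t) * \<phi> t \<partial>lborel)
            = (\<integral>\<^sup>+t. ennreal (\<epsilon> / pi) * ennreal (2 * u / (u\<^sup>2 + \<epsilon>\<^sup>2)\<^sup>2) * (\<phi> t * indicator (cball x u) t) \<partial>lborel)"
          by (intro nn_integral_cong) (auto simp: indicator_def dist_real_def abs_minus_commute mult_ac)
        also have "\<dots> = ennreal (\<epsilon> / pi) * ennreal (2 * u / (u\<^sup>2 + \<epsilon>\<^sup>2)\<^sup>2) * (\<integral>\<^sup>+t. \<phi> t * indicator (cball x u) t \<partial>lborel)"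
          by (intro nn_integral_cmult) measurable
        also have "\<dots> \<le> ennreal (\<epsilon> / pi) * ennreal (2 * u / (u\<^sup>2 + \<epsilon>\<^sup>2)\<^sup>2) * ennreal (a * u)"
          by (intro mult_left_mono le True) auto
        also have "\<dots> = ennreal (2 * a * (\<epsilon> / pi) * (u\<^sup>2 / (u\<^sup>2 + \<epsilon>\<^sup>2)\<^sup>2))"
          using True e a by (simp add: ennreal_mult[symmetric] power2_eq_square mult_ac)
        also have "\<dots> \<le> ennreal (2 * a * (\<epsilon> / pi) * (1 / (u\<^sup>2 + \<epsilon>\<^sup>2)))"
        proof (intro ennreal_leI mult_left_mono)
          have "u\<^sup>2 / (u\<^sup>2 + \<epsilon>\<^sup>2)\<^sup>2 \<le> (u\<^sup>2 + \<epsilon>\<^sup>2) / (u\<^sup>2 + \<epsilon>\<^sup>2)\<^sup>2" by (intro divide_right_mono) auto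
          also have "\<dots> = 1 / (u\<^sup>2 + \<epsilon>\<^sup>2)" using sum_square_pos[OF e, of u] by (simp add: power2_eq_square[of "u\<^sup>2 + \<epsilon>\<^sup>2"])
          finally show "u\<^sup>2 / (u\<^sup>2 + \<epsilon>\<^sup>2)\<^sup>2 \<le> 1 / (u\<^sup>2 + \<epsilon>\<^sup>2)" .
        qed (use a e in auto)
        also have "\<dots> = ennreal (2 * a) * ennreal (poisson_kernel \<epsilon> 0 u)"
          using a e by (simp add: poisson_kernel_def ennreal_mult[symmetric])
        finally show ?thesis .
      next
        case False
        then have "(\<integral>\<^sup>+t. ennreal (\<epsilon> / pi) * ennreal (2 * u / (u\<^sup>2 + \<epsilon>\<^sup>2)\<^sup>2) * indicator {p. \<bar>snd p - x\<bar> \<le> fst p} (u, t) * \<phi> t \<partial>lborel)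
            = (\<integral>\<^sup>+t. 0 \<partial>(lborel :: real measure))" using elim
          by (intro nn_integral_cong) (auto simp: indicator_def)
        then show ?thesis by simp
      qed
    qed
  qed
  also have "\<dots> = ennreal (2 * a)" by (simp add: nn_integral_cmult poisson_kernel_nn_integral[OF e])
  finally show ?thesis .
qed

text \<open>For fixed a the exceptional sets of measure at most 1/(m+1) intersect in a null set;
  then a runs through countably many values. Since the exceptional sets are supplied by the caller,
  the upper limit over uncountably many \<epsilon> is never measured.\<close>

lemma AE_tendsto_zero_scheme:
  fixes F :: "real \<Rightarrow> real \<Rightarrow> ennreal"
  assumes "\<And>a e. a > 0 \<Longrightarrow> e > 0 \<Longrightarrow> \<exists>E\<in>sets lborel. emeasure lborel E \<le> ennreal e \<and>
    (AE x in lborel. x \<notin> E \<longrightarrow> (\<forall>\<^sub>F \<epsilon> in at_right 0. F \<epsilon> x \<le> ennreal a))"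
  shows "AE x in lborel. ((\<lambda>\<epsilon>. F \<epsilon> x) \<longlongrightarrow> 0) (at_right 0)"
proof -
  have "AE x in lborel. \<forall>\<^sub>F \<epsilon> in at_right 0. F \<epsilon> x \<le> ennreal a" if a: "a > 0" for a
  proof -
    have "\<forall>m. \<exists>E\<in>sets lborel. emeasure lborel E \<le> ennreal (null_seq m) \<and>
        (AE x in lborel. x \<notin> E \<longrightarrow> (\<forall>\<^sub>F \<epsilon> in at_right 0. F \<epsilon> x \<le> ennreal a))"
      using assms a null_seq(1) by blast
    then obtain E where E: "\<And>m. E m \<in> sets lborel" "\<And>m. emeasure lborel (E m) \<le> ennreal (null_seq m)"
      "\<And>m. AE x in lborel. x \<notin> E m \<longrightarrow> (\<forall>\<^sub>F \<epsilon> in at_right 0. F \<epsilon> x \<le> ennreal a)"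
      unfolding bchoice_iff Bex_def by (atomize_elim) (drule choice, blast)
    have "emeasure lborel (\<Inter>m. E m) \<le> ennreal (null_seq m)" for m
      using emeasure_mono[of "\<Inter>m. E m" "E m" lborel] E by (meson INF_lower UNIV_I order_trans)
    moreover have "(\<lambda>m. ennreal (null_seq m)) \<longlonglongrightarrow> ennreal 0"
      by (intro tendsto_ennrealI null_seq)
    ultimately have "emeasure lborel (\<Inter>m. E m) \<le> ennreal 0"
      by (intro LIMSEQ_le[OF tendsto_const]) auto
    then have "AE x in lborel. x \<notin> (\<Inter>m. E m)"
      using E(1) by (intro AE_not_in) (auto simp: null_sets_def)
    moreover have "AE x in lborel. \<forall>m. x \<notin> E m \<longrightarrow> (\<forall>\<^sub>F \<epsilon> in at_right 0. F \<epsilon> x \<le> ennreal a)"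
      by (subst AE_all_countable) (use E(3) in blast)
    ultimately show ?thesis by eventually_elim auto
  qed
  then have "AE x in lborel. \<forall>n. \<forall>\<^sub>F \<epsilon> in at_right 0. F \<epsilon> x \<le> ennreal (null_seq n)"
    by (simp add: AE_all_countable null_seq)
  then show ?thesis
  proof eventually_elim
    case (elim x)
    show ?case
    proof (rule order_tendstoI)
      fix y :: ennreal assume "y > 0"
      have "(\<lambda>m. ennreal (null_seq m)) \<longlonglongrightarrow> ennreal 0" by (intro tendsto_ennrealI null_seq)
      then have "\<forall>\<^sub>F m in sequentially. ennreal (null_seq m) < y" using \<open>y > 0\<close> by (intro order_tendstoD) auto
      then obtain m where "ennreal (null_seq m) < y" by (auto simp: eventually_sequentially)
      then show "\<forall>\<^sub>F \<epsilon> in at_right 0. F \<epsilon> x < y"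
        using elim[rule_format, of m] by (auto elim!: eventually_mono)
    qed simp
  qed
qed

text \<open>Its convergence to 0 says that x is a Lebesgue point for Poisson averages. The absolute
  value inside the integral makes this usable for any kernel dominated by the Poisson
  kernel.\<close>

definition poisson_osc :: "(real \<Rightarrow> complex) \<Rightarrow> real \<Rightarrow> real \<Rightarrow> ennreal" where
  "poisson_osc f \<epsilon> x = (\<integral>\<^sup>+t. ennreal (poisson_kernel \<epsilon> x t) * ennreal (cmod (f t - f x)) \<partial>lborel)"

text \<open>At distance at least d from x the Poisson kernel is of order \<epsilon>; using the
  kernel with parameter 1 as majorant keeps the decay at infinity.\<close>

lemma poisson_kernel_far:
  assumes "\<epsilon> > 0" "d > 0" "\<bar>t - x\<bar> \<ge> d"
  shows "poisson_kernel \<epsilon> x t \<le> \<epsilon> * (1 + 1 / d\<^sup>2) * poisson_kernel 1 x t"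
proof -
  define v where "v = (t - x)\<^sup>2"
  have v: "d\<^sup>2 \<le> v" "v > 0" using assms power_mono[of d "\<bar>t - x\<bar>" 2] by (auto simp: v_def)
  have "1 \<le> v / d\<^sup>2" using v assms by (simp add: field_simps)
  then have "v + 1 \<le> (1 + 1 / d\<^sup>2) * v" by (simp add: distrib_right)
  then have "v + 1 \<le> (1 + 1 / d\<^sup>2) * (v + \<epsilon>\<^sup>2)"
    by (rule order_trans) (intro mult_left_mono; simp)
  then have "1 / (v + \<epsilon>\<^sup>2) \<le> (1 + 1 / d\<^sup>2) / (v + 1)"
    using v by (simp add: divide_simps add_pos_nonneg)
  then have "\<epsilon> / pi * (1 / (v + \<epsilon>\<^sup>2)) \<le> \<epsilon> / pi * ((1 + 1 / d\<^sup>2) / (v + 1))"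
    using assms by (intro mult_left_mono) auto
  then show ?thesis by (simp add: poisson_kernel_def v_def)
qed

lemma poisson_far_tendsto:
  fixes \<phi> :: "real \<Rightarrow> ennreal"
  assumes [measurable]: "\<phi> \<in> borel_measurable borel" and "d > 0"
    and far: "\<And>t. \<bar>t - x\<bar> < d \<Longrightarrow> \<phi> t = 0"
    and fin: "(\<integral>\<^sup>+t. ennreal (poisson_kernel 1 x t) * \<phi> t \<partial>lborel) < \<infinity>"
  shows "((\<lambda>\<epsilon>. \<integral>\<^sup>+t. ennreal (poisson_kernel \<epsilon> x t) * \<phi> t \<partial>lborel) \<longlongrightarrow> 0) (at_right 0)"
proof -
  define I where "I = (\<integral>\<^sup>+t. ennreal (poisson_kernel 1 x t) * \<phi> t \<partial>lborel)"
  have "(\<integral>\<^sup>+t. ennreal (poisson_kernel \<epsilon> x t) * \<phi> t \<partial>lborel) \<le> ennreal (\<epsilon> * (1 + 1 / d\<^sup>2)) * I" if "\<epsilon> > 0" for \<epsilon>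
  proof -
    have "(\<integral>\<^sup>+t. ennreal (poisson_kernel \<epsilon> x t) * \<phi> t \<partial>lborel)
        \<le> (\<integral>\<^sup>+t. ennreal (\<epsilon> * (1 + 1 / d\<^sup>2)) * (ennreal (poisson_kernel 1 x t) * \<phi> t) \<partial>lborel)"
    proof (intro nn_integral_mono)
      fix t
      show "ennreal (poisson_kernel \<epsilon> x t) * \<phi> t \<le> ennreal (\<epsilon> * (1 + 1 / d\<^sup>2)) * (ennreal (poisson_kernel 1 x t) * \<phi> t)"
      proof (cases "\<bar>t - x\<bar> < d")
        case False
        have "ennreal (poisson_kernel \<epsilon> x t) \<le> ennreal (\<epsilon> * (1 + 1 / d\<^sup>2)) * ennreal (poisson_kernel 1 x t)"
          using poisson_kernel_far[of \<epsilon> d t x] False that \<open>d > 0\<close> by (simp add: ennreal_mult'[symmetric] ennreal_leI)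
        then show ?thesis by (simp add: mult.assoc[symmetric] mult_right_mono)
      qed (simp add: far)
    qed
    also have "\<dots> = ennreal (\<epsilon> * (1 + 1 / d\<^sup>2)) * I" unfolding I_def by (intro nn_integral_cmult) measurable
    finally show ?thesis .
  qed
  then have 1: "\<forall>\<^sub>F \<epsilon> in at_right 0. (\<integral>\<^sup>+t. ennreal (poisson_kernel \<epsilon> x t) * \<phi> t \<partial>lborel) \<le> ennreal (\<epsilon> * (1 + 1 / d\<^sup>2)) * I"
    using eventually_at_right_less[of "0::real"] by (auto elim: eventually_mono)
  have 2: "((\<lambda>\<epsilon>. ennreal (\<epsilon> * (1 + 1 / d\<^sup>2)) * I) \<longlongrightarrow> 0) (at_right 0)"
  proof -
    obtain r where r: "I = ennreal r" "r \<ge> 0" using fin by (cases I) (auto simp: I_def)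
    have "((\<lambda>\<epsilon>. ennreal (\<epsilon> * (1 + 1 / d\<^sup>2) * r)) \<longlongrightarrow> ennreal (0 * (1 + 1 / d\<^sup>2) * r)) (at_right 0)"
      by (intro tendsto_ennrealI tendsto_intros)
    moreover have "ennreal (\<epsilon> * (1 + 1 / d\<^sup>2) * r) = ennreal (\<epsilon> * (1 + 1 / d\<^sup>2)) * I" for \<epsilon>
      using r by (simp add: ennreal_mult'')
    ultimately show ?thesis by simp
  qed
  show ?thesis
    by (rule tendsto_sandwich[OF always_eventually[OF allI[OF zero_le]] 1 tendsto_const 2])
qed

text \<open>Outer regularity gives an open T containing A with T - A small. The complement of T
  stays at positive distance from each x in A, hence vanishes in the limit, and T - A is controlled
  off a small set by the maximal inequality.\<close>

lemma density_point:
  assumes A[measurable]: "A \<in> sets borel"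
  shows "AE x in lborel. x \<in> A \<longrightarrow> ((\<lambda>\<epsilon>. \<integral>\<^sup>+t. ennreal (poisson_kernel \<epsilon> x t) * indicator (- A) t \<partial>lborel) \<longlongrightarrow> 0) (at_right 0)"
proof -
  have "AE x in lborel. ((\<lambda>\<epsilon>. indicator A x * (\<integral>\<^sup>+t. ennreal (poisson_kernel \<epsilon> x t) * indicator (- A) t \<partial>lborel)) \<longlongrightarrow> 0) (at_right 0)"
  proof (rule AE_tendsto_zero_scheme)
    fix a e :: real assume "a > 0" "e > 0"
    \<comment> \<open>The complement of T contributes at most b and the maximal estimate 2b, in
      total below a = 4b. The tolerance e b/10 for T - A is what the factor 10/b turns into
      e.\<close>
    define b where "b = a / 4"
    have b: "b > 0" using \<open>a > 0\<close> by (simp add: b_def)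
    have pos: "e * b / 10 > 0" using b \<open>e > 0\<close> by simp
    have "A \<in> sets lebesgue" using A by simp
    then obtain T where T: "open T" "A \<subseteq> T" "emeasure lebesgue (T - A) < ennreal (e * b / 10)"
      using sets_lebesgue_outer_open[OF _ pos] by metis
    have [measurable]: "T \<in> sets borel" using T(1) by simp
    have m: "emeasure lborel (T - A) < ennreal (e * b / 10)"
      using T(3) by (simp del: ennreal_less_iff)
    then have "(\<integral>\<^sup>+t. indicator (T - A) t \<partial>lborel) < \<infinity>" using less_trans[OF m ennreal_less_top] by simp
    then obtain E where E: "E \<in> sets borel" "emeasure lborel E \<le> ennreal (10 / b) * (\<integral>\<^sup>+t. indicator (T - A) t \<partial>lborel)"
      "\<And>x u. x \<notin> E \<Longrightarrow> u > 0 \<Longrightarrow> (\<integral>\<^sup>+t. indicator (T - A) t * indicator (cball x u) t \<partial>lborel) \<le> ennreal (b * u)"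
      using Hardy_Littlewood_weak[of "indicator (T - A)" b] b by auto
    have "emeasure lborel E \<le> ennreal (10 / b) * ennreal (e * b / 10)"
      using E(2) m by (simp add: order_trans[OF _ mult_left_mono] less_imp_le)
    also have "\<dots> = ennreal e" using b \<open>e > 0\<close> by (simp add: ennreal_mult[symmetric])
    finally have "emeasure lborel E \<le> ennreal e" .
    moreover have "\<forall>\<^sub>F \<epsilon> in at_right 0. indicator A x * (\<integral>\<^sup>+t. ennreal (poisson_kernel \<epsilon> x t) * indicator (- A) t \<partial>lborel) \<le> ennreal a"
      if x: "x \<notin> E" for x
    proof (cases "x \<in> A")
      case True
      then obtain d where d: "d > 0" "ball x d \<subseteq> T" using T by (meson openE subsetD)
      have "((\<lambda>\<epsilon>. \<integral>\<^sup>+t. ennreal (poisson_kernel \<epsilon> x t) * indicator (- T) t \<partial>lborel) \<longlongrightarrow> 0) (at_right 0)"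
      proof (rule poisson_far_tendsto[OF _ d(1)])
        show "indicator (- T) t = 0" if "\<bar>t - x\<bar> < d" for t
          using that d(2) by (auto simp: indicator_def dist_real_def abs_minus_commute subset_iff)
        have "(\<integral>\<^sup>+t. ennreal (poisson_kernel 1 x t) * indicator (- T) t \<partial>lborel) \<le> (\<integral>\<^sup>+t. ennreal (poisson_kernel 1 x t) \<partial>lborel)"
          by (intro nn_integral_mono) (auto simp: indicator_def)
        then show "(\<integral>\<^sup>+t. ennreal (poisson_kernel 1 x t) * indicator (- T) t \<partial>lborel) < \<infinity>"
          by (simp add: poisson_kernel_nn_integral order_le_less_trans)
      qed measurable
      then have "\<forall>\<^sub>F \<epsilon> in at_right 0. (\<integral>\<^sup>+t. ennreal (poisson_kernel \<epsilon> x t) * indicator (- T) t \<partial>lborel) < ennreal b"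
        using b by (intro order_tendstoD) auto
      then show ?thesis
        using eventually_at_right_less[of "0::real"]
      proof eventually_elim
        case (elim \<epsilon>)
        have "(\<integral>\<^sup>+t. ennreal (poisson_kernel \<epsilon> x t) * indicator (- A) t \<partial>lborel)
          \<le> (\<integral>\<^sup>+t. ennreal (poisson_kernel \<epsilon> x t) * indicator (- T) t + ennreal (poisson_kernel \<epsilon> x t) * indicator (T - A) t \<partial>lborel)"
          by (intro nn_integral_mono) (auto simp: indicator_def)
        also have "\<dots> = (\<integral>\<^sup>+t. ennreal (poisson_kernel \<epsilon> x t) * indicator (- T) t \<partial>lborel) + (\<integral>\<^sup>+t. ennreal (poisson_kernel \<epsilon> x t) * indicator (T - A) t \<partial>lborel)"
          by (intro nn_integral_add) measurable
        also have "\<dots> \<le> ennreal b + ennreal (2 * b)"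
          using elim E(3)[OF x] b by (intro add_mono poisson_maximal) (auto simp: less_imp_le)
        also have "\<dots> \<le> ennreal a" using b by (simp add: b_def ennreal_plus[symmetric] del: ennreal_plus)
        finally show ?case using True by simp
      qed
    qed simp
    ultimately show "\<exists>E\<in>sets lborel. emeasure lborel E \<le> ennreal e \<and> (AE x in lborel. x \<notin> E \<longrightarrow>
      (\<forall>\<^sub>F \<epsilon> in at_right 0. indicator A x * (\<integral>\<^sup>+t. ennreal (poisson_kernel \<epsilon> x t) * indicator (- A) t \<partial>lborel) \<le> ennreal a))"
      using E(1) by (intro bexI[of _ E]) auto
  qed
  then show ?thesis
  proof eventually_elim
    case (elim x)
    then show ?case by (cases "x \<in> A") auto
  qed
qed

lemma poisson_osc_indicator:
  assumes A[measurable]: "A \<in> sets borel"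
  shows "AE x in lborel. ((\<lambda>\<epsilon>. poisson_osc (\<lambda>x. indicator A x *\<^sub>R c) \<epsilon> x) \<longlongrightarrow> 0) (at_right 0)"
proof -
  have eq: "poisson_osc (\<lambda>x. indicator A x *\<^sub>R c) \<epsilon> x = ennreal (cmod c) * (\<integral>\<^sup>+t. ennreal (poisson_kernel \<epsilon> x t) * indicator (- B) t \<partial>lborel)"
    if "B \<in> sets borel" "(B = A \<and> x \<in> A) \<or> (B = - A \<and> x \<notin> A)" for \<epsilon> x B
  proof -
    have [measurable]: "B \<in> sets borel" by fact
    have "poisson_osc (\<lambda>x. indicator A x *\<^sub>R c) \<epsilon> x = (\<integral>\<^sup>+t. ennreal (cmod c) * (ennreal (poisson_kernel \<epsilon> x t) * indicator (- B) t) \<partial>lborel)"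
      unfolding poisson_osc_def using that by (intro nn_integral_cong) (auto simp: indicator_def mult.commute)
    then show ?thesis by (simp add: nn_integral_cmult)
  qed
  have "AE x in lborel. x \<in> A \<longrightarrow> ((\<lambda>\<epsilon>. \<integral>\<^sup>+t. ennreal (poisson_kernel \<epsilon> x t) * indicator (- A) t \<partial>lborel) \<longlongrightarrow> 0) (at_right 0)"
    by (rule density_point) measurable
  moreover have "AE x in lborel. x \<in> - A \<longrightarrow> ((\<lambda>\<epsilon>. \<integral>\<^sup>+t. ennreal (poisson_kernel \<epsilon> x t) * indicator (- (- A)) t \<partial>lborel) \<longlongrightarrow> 0) (at_right 0)"
    by (rule density_point) measurable
  ultimately show ?thesis
  proof eventually_elim
    case (elim x)
    define B where "B = (if x \<in> A then A else - A)"
    have B: "B \<in> sets borel" "(B = A \<and> x \<in> A) \<or> (B = - A \<and> x \<notin> A)" by (auto simp: B_def)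
    have "((\<lambda>\<epsilon>. \<integral>\<^sup>+t. ennreal (poisson_kernel \<epsilon> x t) * indicator (- B) t \<partial>lborel) \<longlongrightarrow> 0) (at_right 0)"
      using elim by (auto simp: B_def)
    then have "((\<lambda>\<epsilon>. ennreal (cmod c) * (\<integral>\<^sup>+t. ennreal (poisson_kernel \<epsilon> x t) * indicator (- B) t \<partial>lborel)) \<longlongrightarrow> ennreal (cmod c) * 0) (at_right 0)"
      by (intro ennreal_tendsto_cmult) auto
    then show ?case unfolding eq[OF B] by simp
  qed
qed

lemma poisson_osc_triangle:
  assumes [measurable]: "g \<in> borel_measurable borel" "h \<in> borel_measurable borel" and "\<epsilon> > 0"
  shows "poisson_osc (\<lambda>t. g t + h t) \<epsilon> x
    \<le> poisson_osc g \<epsilon> x + (\<integral>\<^sup>+t. ennreal (poisson_kernel \<epsilon> x t) * ennreal (cmod (h t)) \<partial>lborel) + ennreal (cmod (h x))"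
proof -
  have "poisson_osc (\<lambda>t. g t + h t) \<epsilon> x \<le> (\<integral>\<^sup>+t. (ennreal (poisson_kernel \<epsilon> x t) * ennreal (cmod (g t - g x)) 
      + ennreal (poisson_kernel \<epsilon> x t) * ennreal (cmod (h t))) + ennreal (poisson_kernel \<epsilon> x t) * ennreal (cmod (h x)) \<partial>lborel)"
    unfolding poisson_osc_def
  proof (intro nn_integral_mono)
    fix t
    have "cmod (g t + h t - (g x + h x)) \<le> cmod (g t - g x) + cmod (h t) + cmod (h x)"
      using norm_triangle_ineq[of "g t - g x" "h t - h x"] norm_triangle_ineq4[of "h t" "h x"] by (simp add: algebra_simps)
    then have "ennreal (cmod (g t + h t - (g x + h x))) \<le> ennreal (cmod (g t - g x)) + ennreal (cmod (h t)) + ennreal (cmod (h x))"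
      by (simp add: ennreal_plus[symmetric] del: ennreal_plus)
    then show "ennreal (poisson_kernel \<epsilon> x t) * ennreal (cmod (g t + h t - (g x + h x)))
      \<le> ennreal (poisson_kernel \<epsilon> x t) * ennreal (cmod (g t - g x)) 
      + ennreal (poisson_kernel \<epsilon> x t) * ennreal (cmod (h t)) + ennreal (poisson_kernel \<epsilon> x t) * ennreal (cmod (h x))"
      unfolding distrib_left[symmetric] by (intro mult_left_mono) auto
  qed
  also have "\<dots> = poisson_osc g \<epsilon> x + (\<integral>\<^sup>+t. ennreal (poisson_kernel \<epsilon> x t) * ennreal (cmod (h t)) \<partial>lborel)
      + (\<integral>\<^sup>+t. ennreal (poisson_kernel \<epsilon> x t) * ennreal (cmod (h x)) \<partial>lborel)"
    unfolding poisson_osc_def by (subst nn_integral_add, measurable)+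
  also have "(\<integral>\<^sup>+t. ennreal (poisson_kernel \<epsilon> x t) * ennreal (cmod (h x)) \<partial>lborel) = ennreal (cmod (h x))"
    by (simp add: nn_integral_multc poisson_kernel_nn_integral assms)
  finally show ?thesis .
qed

text \<open>Density argument: the property holds for indicators and is additive. For a limit, the
  small remainder h enters through its Poisson average, controlled by the weak-type inequality, and
  through |h(x)|, controlled by Chebyshev.\<close>

lemma poisson_osc_L1:
  assumes f: "integrable lborel f"
  shows "AE x in lborel. ((\<lambda>\<epsilon>. poisson_osc f \<epsilon> x) \<longlongrightarrow> 0) (at_right 0)"
  using f
proof (induction f rule: integrable_induct)
  case (base A c)
  then show ?case using poisson_osc_indicator[of A c] by simp
next
  case (add f g)
  have [measurable]: "f \<in> borel_measurable borel" "g \<in> borel_measurable borel"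
    using add.hyps by auto
  from add.IH show ?case
  proof eventually_elim
    case (elim x)
    have "((\<lambda>\<epsilon>. poisson_osc f \<epsilon> x + poisson_osc g \<epsilon> x) \<longlongrightarrow> 0 + 0) (at_right 0)"
      by (intro tendsto_add elim)
    then have 2: "((\<lambda>\<epsilon>. poisson_osc f \<epsilon> x + poisson_osc g \<epsilon> x) \<longlongrightarrow> 0) (at_right 0)" by simp
    have "poisson_osc (\<lambda>t. f t + g t) \<epsilon> x \<le> poisson_osc f \<epsilon> x + poisson_osc g \<epsilon> x" if "\<epsilon> > 0" for \<epsilon>
    proof -
      have "poisson_osc (\<lambda>t. f t + g t) \<epsilon> x \<le> (\<integral>\<^sup>+t. ennreal (poisson_kernel \<epsilon> x t) * ennreal (cmod (f t - f x)) 
          + ennreal (poisson_kernel \<epsilon> x t) * ennreal (cmod (g t - g x)) \<partial>lborel)"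
        unfolding poisson_osc_def
      proof (intro nn_integral_mono)
        fix t
        have "cmod (f t + g t - (f x + g x)) \<le> cmod (f t - f x) + cmod (g t - g x)"
          using norm_triangle_ineq[of "f t - f x" "g t - g x"] by (simp add: algebra_simps)
        then have "ennreal (cmod (f t + g t - (f x + g x))) \<le> ennreal (cmod (f t - f x)) + ennreal (cmod (g t - g x))"
          by (simp add: ennreal_plus[symmetric] del: ennreal_plus)
        then show "ennreal (poisson_kernel \<epsilon> x t) * ennreal (cmod (f t + g t - (f x + g x)))
          \<le> ennreal (poisson_kernel \<epsilon> x t) * ennreal (cmod (f t - f x)) + ennreal (poisson_kernel \<epsilon> x t) * ennreal (cmod (g t - g x))"
          unfolding distrib_left[symmetric] by (intro mult_left_mono) auto
      qed
      also have "\<dots> = poisson_osc f \<epsilon> x + poisson_osc g \<epsilon> x"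
        unfolding poisson_osc_def by (intro nn_integral_add) measurable
      finally show ?thesis .
    qed
    then have 1: "\<forall>\<^sub>F \<epsilon> in at_right 0. poisson_osc (\<lambda>t. f t + g t) \<epsilon> x \<le> poisson_osc f \<epsilon> x + poisson_osc g \<epsilon> x"
      using eventually_at_right_less[of "0::real"] by (auto elim: eventually_mono)
    show ?case by (rule tendsto_sandwich[OF always_eventually[OF allI[OF zero_le]] 1 tendsto_const 2])
  qed
next
  case (lim f s)
  have [measurable]: "f \<in> borel_measurable borel" "s i \<in> borel_measurable borel" for i
    using lim.hyps by auto
  have L1: "(\<lambda>i. LBINT t. cmod (f t - s i t)) \<longlonglongrightarrow> integral\<^sup>L lborel (\<lambda>t::real. 0::real)"
  proof (rule integral_dominated_convergence[where w="\<lambda>t. 3 * cmod (f t)"])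
    show "AE t in lborel. (\<lambda>i. cmod (f t - s i t)) \<longlonglongrightarrow> 0"
    proof (rule AE_I2)
      fix t :: real
      have "(\<lambda>i. cmod (f t - s i t)) \<longlonglongrightarrow> cmod (f t - f t)"
        using lim.hyps(2)[of t] by (intro tendsto_intros) auto
      then show "(\<lambda>i. cmod (f t - s i t)) \<longlonglongrightarrow> 0" by simp
    qed
    show "AE t in lborel. norm (cmod (f t - s i t)) \<le> 3 * cmod (f t)" for i
    proof (rule AE_I2)
      fix t :: real
      show "norm (cmod (f t - s i t)) \<le> 3 * cmod (f t)"
        using lim.hyps(3)[of t i] norm_triangle_ineq4[of "f t" "s i t"] by simp
    qed
    show "integrable lborel (\<lambda>t. 3 * cmod (f t))" using lim.hyps(4) by auto
  qed measurable
  show ?case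
  proof (rule AE_tendsto_zero_scheme)
    fix a e :: real assume ae: "a > 0" "e > 0"
    define b where "b = a / 4"
    have b: "b > 0" using ae by (simp add: b_def)
    \<comment> \<open>The first bound gives (10/b)(e b/20) = e/2 for the maximal set, the second
      (1/b)(e b/2) = e/2 for the Chebyshev set. The value b = a/4 leaves room for b + 2b +
      b.\<close>
    have "min (e * b / 20) (e * b / 2) > 0" using b ae by simp
    then have "\<forall>\<^sub>F i in sequentially. (LBINT t. cmod (f t - s i t)) < min (e * b / 20) (e * b / 2)"
      using L1 by (intro order_tendstoD) auto
    then obtain i where "(LBINT t. cmod (f t - s i t)) < min (e * b / 20) (e * b / 2)"
      by (auto simp: eventually_sequentially)
    then have i: "(LBINT t. cmod (f t - s i t)) \<le> e * b / 20" "(LBINT t. cmod (f t - s i t)) \<le> e * b / 2" by auto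
    define h where "h t = f t - s i t" for t
    have [measurable]: "h \<in> borel_measurable borel" unfolding h_def by measurable
    have "integrable lborel h" unfolding h_def using lim.hyps by auto
    then have "integrable lborel (\<lambda>t. cmod (h t))" by (rule integrable_norm)
    then have I: "(\<integral>\<^sup>+t. ennreal (cmod (h t)) \<partial>lborel) = ennreal (LBINT t. cmod (f t - s i t))"
      by (subst nn_integral_eq_integral) (auto simp: h_def)
    then have "(\<integral>\<^sup>+t. ennreal (cmod (h t)) \<partial>lborel) < \<infinity>" by simp
    then obtain E where E: "E \<in> sets borel" "emeasure lborel E \<le> ennreal (10 / b) * (\<integral>\<^sup>+t. ennreal (cmod (h t)) \<partial>lborel)"
      "\<And>x u. x \<notin> E \<Longrightarrow> u > 0 \<Longrightarrow> (\<integral>\<^sup>+t. ennreal (cmod (h t)) * indicator (cball x u) t \<partial>lborel) \<le> ennreal (b * u)"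
      using Hardy_Littlewood_weak[of "\<lambda>t. ennreal (cmod (h t))" b] b by auto
    have "emeasure lborel E \<le> ennreal (10 / b) * ennreal (e * b / 20)"
      using E(2) i(1) unfolding I by (meson ennreal_leI mult_left_mono order_trans zero_le)
    also have "\<dots> = ennreal (e / 2)" using b ae by (simp add: ennreal_mult[symmetric])
    finally have mE: "emeasure lborel E \<le> ennreal (e / 2)" .
    define H where "H = {x. b \<le> cmod (h x)}"
    have H[measurable]: "H \<in> sets borel" unfolding H_def by measurable
    have "emeasure lborel H = (\<integral>\<^sup>+t. indicator H t \<partial>lborel)" by simp
    also have "\<dots> \<le> (\<integral>\<^sup>+t. ennreal (1 / b) * ennreal (cmod (h t)) \<partial>lborel)"
      using b by (intro nn_integral_mono) (auto simp: H_def indicator_def ennreal_mult[symmetric])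
    also have "\<dots> \<le> ennreal (1 / b) * ennreal (e * b / 2)"
      using i(2) by (simp add: nn_integral_cmult I mult_left_mono ennreal_leI)
    also have "\<dots> = ennreal (e / 2)" using b ae by (simp add: ennreal_mult[symmetric])
    finally have mH: "emeasure lborel H \<le> ennreal (e / 2)" .
    have "emeasure lborel (E \<union> H) \<le> emeasure lborel E + emeasure lborel H"
      using E(1) by (intro emeasure_subadditive) auto
    also have "\<dots> \<le> ennreal (e / 2) + ennreal (e / 2)" by (intro add_mono mE mH)
    also have "\<dots> = ennreal e" using ae by (simp add: ennreal_plus[symmetric] del: ennreal_plus)
    finally have m: "emeasure lborel (E \<union> H) \<le> ennreal e" .
    have "AE x in lborel. x \<notin> E \<union> H \<longrightarrow> (\<forall>\<^sub>F \<epsilon> in at_right 0. poisson_osc f \<epsilon> x \<le> ennreal a)"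
      using lim.IH[of i]
    proof eventually_elim
      case (elim x)
      show ?case
      proof
        assume x: "x \<notin> E \<union> H"
        have "\<forall>\<^sub>F \<epsilon> in at_right 0. poisson_osc (s i) \<epsilon> x < ennreal b"
          using elim b by (intro order_tendstoD) auto
        then show "\<forall>\<^sub>F \<epsilon> in at_right 0. poisson_osc f \<epsilon> x \<le> ennreal a"
          using eventually_at_right_less[of "0::real"]
        proof eventually_elim
          case (elim \<epsilon>)
          have "poisson_osc f \<epsilon> x = poisson_osc (\<lambda>t. s i t + h t) \<epsilon> x" by (simp add: h_def)
          also have "\<dots> \<le> poisson_osc (s i) \<epsilon> x + (\<integral>\<^sup>+t. ennreal (poisson_kernel \<epsilon> x t) * ennreal (cmod (h t)) \<partial>lborel) + ennreal (cmod (h x))"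
            using elim by (intro poisson_osc_triangle) auto
          also have "\<dots> \<le> ennreal b + ennreal (2 * b) + ennreal b"
            using elim E(3)[of x] x b by (intro add_mono poisson_maximal) (auto simp: H_def less_imp_le intro!: ennreal_leI)
          also have "\<dots> = ennreal a" using b by (simp add: b_def ennreal_plus[symmetric] del: ennreal_plus)
          finally show ?case .
        qed
      qed
    qed
    then show "\<exists>E\<in>sets lborel. emeasure lborel E \<le> ennreal e \<and> (AE x in lborel. x \<notin> E \<longrightarrow> (\<forall>\<^sub>F \<epsilon> in at_right 0. poisson_osc f \<epsilon> x \<le> ennreal a))"
      using m E(1) by (intro bexI[of _ "E \<union> H"]) auto
  qed
qed

lemma poisson_kernel_sq_integrable:
  "\<epsilon> > 0 \<Longrightarrow> sq_integrable (\<lambda>t. complex_of_real (poisson_kernel \<epsilon> x t))"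
  unfolding cauchy_kernel_add_cnj[symmetric] by (intro sq_integrable_add cauchy_kernel_sq_integrable)

text \<open>Being a Lebesgue point is local: once n is at least |x| + 1, the cutoff agrees with f
  within distance 1 of x. The remainder vanishes near x and is integrable against the Poisson kernel
  by Cauchy-Schwarz.\<close>

lemma poisson_osc_L2:
  assumes f: "sq_integrable f"
  shows "AE x in lborel. ((\<lambda>\<epsilon>. poisson_osc f \<epsilon> x) \<longlongrightarrow> 0) (at_right 0)"
proof -
  have [measurable]: "f \<in> borel_measurable borel" using f by (simp add: sq_integrable_def)
  have [measurable]: "cutoff n f \<in> borel_measurable borel" for n
    using cutoff(1)[OF f] by (rule sq_integrable_measurable)
  have "AE x in lborel. \<forall>n. ((\<lambda>\<epsilon>. poisson_osc (cutoff n f) \<epsilon> x) \<longlongrightarrow> 0) (at_right 0)"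
    by (subst AE_all_countable) (intro allI poisson_osc_L1 cutoff f)
  then show ?thesis
  proof eventually_elim
    case (elim x)
    obtain n :: nat where n: "\<bar>x\<bar> + 1 \<le> real n" using real_arch_simple by blast
    let ?h = "\<lambda>t. f t - cutoff n f t"
    have h0: "?h t = 0" if "\<bar>t - x\<bar> < 1" for t
      using that n by (auto simp: cutoff_def indicator_def)
    have h: "cmod (?h t) \<le> cmod (f t)" for t by (auto simp: cutoff_def indicator_def)
    have "(\<integral>\<^sup>+t. ennreal (poisson_kernel 1 x t) * ennreal (cmod (?h t)) \<partial>lborel)
        \<le> (\<integral>\<^sup>+t. ennreal (cmod (of_real (poisson_kernel 1 x t) * f t)) \<partial>lborel)"
      using h by (intro nn_integral_mono) (auto simp: norm_mult poisson_kernel_nonneg ennreal_mult intro!: mult_left_mono ennreal_leI)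
    also have "\<dots> < \<infinity>"
      using L2_Cauchy_Schwarz(1)[OF poisson_kernel_sq_integrable[of 1 x] f] by (simp add: integrable_iff_bounded)
    finally have "((\<lambda>\<epsilon>. \<integral>\<^sup>+t. ennreal (poisson_kernel \<epsilon> x t) * ennreal (cmod (?h t)) \<partial>lborel) \<longlongrightarrow> 0) (at_right 0)"
      by (intro poisson_far_tendsto[of _ 1]) (auto simp: h0)
    then have "((\<lambda>\<epsilon>. poisson_osc (cutoff n f) \<epsilon> x + (\<integral>\<^sup>+t. ennreal (poisson_kernel \<epsilon> x t) * ennreal (cmod (?h t)) \<partial>lborel)) \<longlongrightarrow> 0 + 0) (at_right 0)"
      using elim by (intro tendsto_add) auto
    then have 2: "((\<lambda>\<epsilon>. poisson_osc (cutoff n f) \<epsilon> x + (\<integral>\<^sup>+t. ennreal (poisson_kernel \<epsilon> x t) * ennreal (cmod (?h t)) \<partial>lborel)) \<longlongrightarrow> 0) (at_right 0)"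
      by simp
    have "poisson_osc f \<epsilon> x \<le> poisson_osc (cutoff n f) \<epsilon> x + (\<integral>\<^sup>+t. ennreal (poisson_kernel \<epsilon> x t) * ennreal (cmod (?h t)) \<partial>lborel)" if "\<epsilon> > 0" for \<epsilon>
      using poisson_osc_triangle[of "cutoff n f" ?h \<epsilon> x] that h0[of x] by simp
    then have 1: "\<forall>\<^sub>F \<epsilon> in at_right 0. poisson_osc f \<epsilon> x \<le> poisson_osc (cutoff n f) \<epsilon> x + (\<integral>\<^sup>+t. ennreal (poisson_kernel \<epsilon> x t) * ennreal (cmod (?h t)) \<partial>lborel)"
      using eventually_at_right_less[of "0::real"] by (auto elim: eventually_mono)
    show ?case by (rule tendsto_sandwich[OF always_eventually[OF allI[OF zero_le]] 1 tendsto_const 2])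
  qed
qed

text \<open>An approximate identity of mass c with Poisson majorant. It is applied to the Poisson
  kernel and the boundary function, and to the difference of regularised and truncated kernels and f
  itself.\<close>

lemma poisson_dominated_tendsto:
  assumes f: "sq_integrable f" and osc: "((\<lambda>\<epsilon>. poisson_osc f \<epsilon> x) \<longlongrightarrow> 0) (at_right 0)"
    and m: "\<And>\<epsilon>. \<epsilon> > 0 \<Longrightarrow> m \<epsilon> \<in> borel_measurable borel"
    and le: "\<And>\<epsilon> t. \<epsilon> > 0 \<Longrightarrow> cmod (m \<epsilon> t) \<le> C * poisson_kernel \<epsilon> x t"
    and int: "\<And>\<epsilon>. \<epsilon> > 0 \<Longrightarrow> (LBINT t. m \<epsilon> t) = c"
  shows "\<And>\<epsilon>. \<epsilon> > 0 \<Longrightarrow> integrable lborel (\<lambda>t. m \<epsilon> t * f t)"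
    and "((\<lambda>\<epsilon>. LBINT t. m \<epsilon> t * f t) \<longlongrightarrow> c * f x) (at_right 0)"
proof -
  have [measurable]: "f \<in> borel_measurable borel" using f by (simp add: sq_integrable_def)
  have C: "C \<ge> 0"
    using order_trans[OF norm_ge_zero le[of 1 x]] pi_gt_zero by (auto simp: poisson_kernel_def zero_le_divide_iff)
  show i: "integrable lborel (\<lambda>t. m \<epsilon> t * f t)" if "\<epsilon> > 0" for \<epsilon>
  proof (intro L2_Cauchy_Schwarz f)
    show "sq_integrable (m \<epsilon>)"
      using le[OF that] m[OF that] C that
      by (intro sq_integrable_mono[OF sq_integrable_cmult[OF poisson_kernel_sq_integrable[OF that], of "of_real C" x]])
         (auto simp: norm_mult poisson_kernel_nonneg)
  qed
  have "ennreal (cmod ((LBINT t. m \<epsilon> t * f t) - c * f x)) \<le> ennreal C * poisson_osc f \<epsilon> x" if e: "\<epsilon> > 0" for \<epsilon>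
  proof -
    have [measurable]: "m \<epsilon> \<in> borel_measurable borel" using m e .
    have "integrable lborel (m \<epsilon>)"
      by (rule Bochner_Integration.integrable_bound[OF integrable_mult_right[OF poisson_kernel_integral(1)[OF e, of x], of C]])
         (use le[OF e] in \<open>auto intro: order_trans[OF _ abs_ge_self]\<close>)
    then have "(LBINT t. m \<epsilon> t * (f t - f x)) = (LBINT t. m \<epsilon> t * f t) - c * f x"
      using i[OF e] int[OF e] by (simp add: right_diff_distrib)
    then have "ennreal (cmod ((LBINT t. m \<epsilon> t * f t) - c * f x)) \<le> (\<integral>\<^sup>+t. ennreal (cmod (m \<epsilon> t * (f t - f x))) \<partial>lborel)"
      using norm_integral_le_nn_integral[of lborel "\<lambda>t. m \<epsilon> t * (f t - f x)"] by simp
    also have "\<dots> \<le> (\<integral>\<^sup>+t. ennreal C * (ennreal (poisson_kernel \<epsilon> x t) * ennreal (cmod (f t - f x))) \<partial>lborel)"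
      using le[OF e] C e by (intro nn_integral_mono) (auto simp: norm_mult ennreal_mult[symmetric] poisson_kernel_nonneg mult.assoc[symmetric] intro!: ennreal_leI mult_right_mono)
    also have "\<dots> = ennreal C * poisson_osc f \<epsilon> x"
      unfolding poisson_osc_def by (intro nn_integral_cmult) measurable
    finally show ?thesis .
  qed
  then have 1: "\<forall>\<^sub>F \<epsilon> in at_right 0. ennreal (cmod ((LBINT t. m \<epsilon> t * f t) - c * f x)) \<le> ennreal C * poisson_osc f \<epsilon> x"
    using eventually_at_right_less[of "0::real"] by (auto elim: eventually_mono)
  have "((\<lambda>\<epsilon>. ennreal C * poisson_osc f \<epsilon> x) \<longlongrightarrow> ennreal C * 0) (at_right 0)"
    by (intro ennreal_tendsto_cmult osc) auto
  then have 2: "((\<lambda>\<epsilon>. ennreal C * poisson_osc f \<epsilon> x) \<longlongrightarrow> 0) (at_right 0)" by simp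
  have "((\<lambda>\<epsilon>. ennreal (cmod ((LBINT t. m \<epsilon> t * f t) - c * f x))) \<longlongrightarrow> ennreal 0) (at_right 0)"
    using tendsto_sandwich[OF always_eventually[OF allI[OF zero_le]] 1 tendsto_const 2] by simp
  then have "((\<lambda>\<epsilon>. cmod ((LBINT t. m \<epsilon> t * f t) - c * f x)) \<longlongrightarrow> 0) (at_right 0)"
    by (subst (asm) tendsto_ennreal_iff) auto
  then show "((\<lambda>\<epsilon>. LBINT t. m \<epsilon> t * f t) \<longlongrightarrow> c * f x) (at_right 0)"
    by (rule Lim_null[THEN iffD2, OF tendsto_norm_zero_cancel])
qed

section \<open>Truncated kernels and the Plemelj formula\<close>

definition truncated_kernel :: "real \<Rightarrow> real \<Rightarrow> real \<Rightarrow> complex" where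
  "truncated_kernel \<epsilon> x t = (if \<epsilon> < \<bar>t - x\<bar> then 1 / of_real (t - x) else 0)"

lemma truncated_kernel_measurable [measurable]: "truncated_kernel \<epsilon> x \<in> borel_measurable borel"
  unfolding truncated_kernel_def by measurable

text \<open>Let q = |u - i \<epsilon>|. Outside the truncation the difference has modulus
  \<epsilon>/(|u| q) with q \<le> 2|u|; inside it is 1/q with q \<le> 2 \<epsilon>. Both are at most
  2 \<epsilon>/q^2.\<close>

lemma truncated_kernel_diff:
  assumes e: "\<epsilon> > 0"
  shows "cmod (2 * of_real pi * \<i> * cauchy_kernel \<epsilon> x t - truncated_kernel \<epsilon> x t) \<le> 2 * pi * poisson_kernel \<epsilon> x t"
proof -
  define u where "u = t - x"
  define q where "q = sqrt (u\<^sup>2 + \<epsilon>\<^sup>2)"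
  have q: "q > 0" "q\<^sup>2 = u\<^sup>2 + \<epsilon>\<^sup>2" "cmod (of_real u - \<i> * of_real \<epsilon>) = q"
    using sum_square_pos[OF e, of u] by (auto simp: q_def cmod_def power2_commute)
  have nz: "of_real u - \<i> * of_real \<epsilon> \<noteq> 0" using shift_nonzero[of \<epsilon> u] e by simp
  have c: "2 * of_real pi * \<i> * cauchy_kernel \<epsilon> x t = 1 / (of_real u - \<i> * of_real \<epsilon>)"
    by (simp add: cauchy_kernel_def u_def)
  have p: "2 * pi * poisson_kernel \<epsilon> x t = 2 * \<epsilon> / q\<^sup>2" by (simp add: poisson_kernel_def u_def q)
  show ?thesis
  proof (cases "\<epsilon> < \<bar>u\<bar>")
    case True
    then have u: "u \<noteq> 0" using e by auto
    have "\<epsilon>\<^sup>2 \<le> u\<^sup>2" using power_mono[of \<epsilon> "\<bar>u\<bar>" 2] True e by simp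
    then have "q\<^sup>2 \<le> 4 * u\<^sup>2" using zero_le_power2[of u] unfolding q(2) by linarith
    also have "\<dots> = (2 * \<bar>u\<bar>)\<^sup>2" by (simp add: power_mult_distrib)
    finally have "q \<le> 2 * \<bar>u\<bar>" by (rule power2_le_imp_le) simp
    have "1 / (of_real u - \<i> * of_real \<epsilon>) - 1 / of_real u = \<i> * of_real \<epsilon> / (of_real u * (of_real u - \<i> * of_real \<epsilon>))"
      using u nz by (simp add: field_simps)
    then have "cmod (1 / (of_real u - \<i> * of_real \<epsilon>) - 1 / of_real u) = \<epsilon> / (\<bar>u\<bar> * q)"
      using e by (simp add: norm_divide norm_mult q(3))
    also have "\<dots> \<le> 2 * \<epsilon> / q\<^sup>2"
      using \<open>q \<le> 2 * \<bar>u\<bar>\<close> q(1) u e by (simp add: divide_simps power2_eq_square)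
    finally show ?thesis using True unfolding c p truncated_kernel_def by (simp add: u_def)
  next
    case False
    then have "u\<^sup>2 \<le> \<epsilon>\<^sup>2" using power_mono[of "\<bar>u\<bar>" \<epsilon> 2] by simp
    then have "q\<^sup>2 \<le> 4 * \<epsilon>\<^sup>2" using zero_le_power2[of \<epsilon>] unfolding q(2) by linarith
    also have "\<dots> = (2 * \<epsilon>)\<^sup>2" by (simp add: power_mult_distrib)
    finally have "q \<le> 2 * \<epsilon>" by (rule power2_le_imp_le) (use e in simp)
    then have "1 / q \<le> 2 * \<epsilon> / q\<^sup>2" using q(1) by (simp add: field_simps power2_eq_square)
    then show ?thesis using False unfolding c p truncated_kernel_def by (simp add: u_def[symmetric] norm_divide q(3) del: of_real_diff)
  qed
qed

text \<open>Under the reflection of t about x the truncated kernel is odd while the Cauchy kernel is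
  conjugated. Adding the integral to its reflection leaves 2 \<pi> i times the Poisson kernel, of
  mass 1.\<close>

lemma truncated_kernel_integral:
  assumes e: "\<epsilon> > 0"
  shows "(LBINT t. 2 * of_real pi * \<i> * cauchy_kernel \<epsilon> x t - truncated_kernel \<epsilon> x t) = of_real pi * \<i>"
proof -
  define m where "m t = 2 * of_real pi * \<i> * cauchy_kernel \<epsilon> x t - truncated_kernel \<epsilon> x t" for t
  have [measurable]: "m \<in> borel_measurable borel" unfolding m_def by measurable
  have i: "integrable lborel m"
    by (rule Bochner_Integration.integrable_bound[OF integrable_mult_right[OF poisson_kernel_integral(1)[OF e, of x], of "2 * pi"]])
       (use truncated_kernel_diff[OF e, of x] poisson_kernel_nonneg[of \<epsilon> x] e in \<open>auto simp: m_def abs_mult\<close>)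
  have i': "integrable lborel (\<lambda>t. m (2 * x + (-1) * t))" by (rule lborel_integrable_real_affine[OF i]) simp
  have sym: "m t + m (2 * x + (-1) * t) = 2 * of_real pi * \<i> * of_real (poisson_kernel \<epsilon> x t)" for t
  proof -
    have "cauchy_kernel \<epsilon> x (2 * x + (-1) * t) = cauchy_kernel \<epsilon> t x" by (simp add: cauchy_kernel_def)
    moreover have "truncated_kernel \<epsilon> x (2 * x + (-1) * t) = - truncated_kernel \<epsilon> x t"
    proof -
      have "2 * x + (-1) * t - x = - (t - x)" by simp
      then show ?thesis unfolding truncated_kernel_def by (simp only: abs_minus_cancel of_real_minus) (simp only: divide_minus_right minus_zero if_distrib[of uminus])
    qed
    ultimately show ?thesis by (simp add: m_def cauchy_kernel_add_cnj[OF e, symmetric] algebra_simps)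
  qed
  have "2 * (LBINT t. m t) = (LBINT t. m t) + (LBINT t. m (2 * x + (-1) * t))"
    using lborel_integral_real_affine[of "-1" m "2 * x"] by simp
  also have "\<dots> = (LBINT t. 2 * of_real pi * \<i> * of_real (poisson_kernel \<epsilon> x t))"
    using i i' unfolding sym[symmetric] by (simp only: Bochner_Integration.integral_add)
  also have "\<dots> = 2 * of_real pi * \<i>"
    using poisson_kernel_integral(2)[OF e] by simp
  finally show ?thesis by (simp add: m_def)
qed

text \<open>Plemelj's formula: the truncated integral is 2 \<pi> i times the Cauchy integral minus
  an approximate identity of mass \<pi> i, which accounts for the term -f.\<close>

lemma cauchy_int_boundary:
  assumes f: "sq_integrable f"
  obtains g where "sq_integrable g" "L2nrm g \<le> L2nrm f"
    "(\<lambda>n. L2nrm (\<lambda>t. cauchy_int (null_seq n) f t - g t)) \<longlonglongrightarrow> 0"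
    "AE x in lborel. ((\<lambda>\<epsilon>. cauchy_int \<epsilon> f x) \<longlongrightarrow> g x) (at_right 0)"
    "AE x in lborel. ((\<lambda>\<epsilon>. LBINT t. truncated_kernel \<epsilon> x t * f t) \<longlongrightarrow> of_real pi * \<i> * (2 * g x - f x)) (at_right 0)"
proof -
  obtain g where g: "sq_integrable g" "L2nrm g \<le> L2nrm f"
    "(\<lambda>n. L2nrm (\<lambda>t. cauchy_int (null_seq n) f t - g t)) \<longlonglongrightarrow> 0"
    "\<And>\<delta> x. \<delta> > 0 \<Longrightarrow> poisson_int \<delta> g x = cauchy_int \<delta> f x"
    using cauchy_int_limit[OF f] by blast
  have ae: "AE x in lborel. ((\<lambda>\<epsilon>. cauchy_int \<epsilon> f x) \<longlongrightarrow> g x) (at_right 0)"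
    using poisson_osc_L2[OF g(1)]
  proof eventually_elim
    case (elim x)
    have "((\<lambda>\<epsilon>. LBINT t. of_real (poisson_kernel \<epsilon> x t) * g t) \<longlongrightarrow> 1 * g x) (at_right 0)"
      by (rule poisson_dominated_tendsto(2)[OF g(1) elim, where C=1])
         (auto simp: poisson_kernel_nonneg poisson_kernel_integral)
    moreover have "\<forall>\<^sub>F \<epsilon> in at_right 0. (LBINT t. of_real (poisson_kernel \<epsilon> x t) * g t) = cauchy_int \<epsilon> f x"
      using eventually_at_right_less[of "0::real"] g(4) by (auto elim!: eventually_mono simp: poisson_int_def)
    ultimately show ?case by (simp add: tendsto_cong)
  qed
  moreover have "AE x in lborel. ((\<lambda>\<epsilon>. LBINT t. truncated_kernel \<epsilon> x t * f t) \<longlongrightarrow> of_real pi * \<i> * (2 * g x - f x)) (at_right 0)"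
    using poisson_osc_L2[OF f] ae
  proof eventually_elim
    case (elim x)
    let ?m = "\<lambda>\<epsilon> t. 2 * of_real pi * \<i> * cauchy_kernel \<epsilon> x t - truncated_kernel \<epsilon> x t"
    have i: "integrable lborel (\<lambda>t. ?m \<epsilon> t * f t)" if "\<epsilon> > 0" for \<epsilon>
      by (rule poisson_dominated_tendsto(1)[OF f elim(1), where C="2 * pi" and c="of_real pi * \<i>"])
         (auto intro: truncated_kernel_diff simp: truncated_kernel_integral that)
    have "((\<lambda>\<epsilon>. LBINT t. ?m \<epsilon> t * f t) \<longlongrightarrow> of_real pi * \<i> * f x) (at_right 0)"
      by (rule poisson_dominated_tendsto(2)[OF f elim(1), where C="2 * pi"])
         (auto intro: truncated_kernel_diff simp: truncated_kernel_integral)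
    then have "((\<lambda>\<epsilon>. 2 * of_real pi * \<i> * cauchy_int \<epsilon> f x - (LBINT t. ?m \<epsilon> t * f t)) \<longlongrightarrow> 2 * of_real pi * \<i> * g x - of_real pi * \<i> * f x) (at_right 0)"
      by (intro tendsto_diff tendsto_mult tendsto_const elim(2))
    moreover have "\<forall>\<^sub>F \<epsilon> in at_right 0. 2 * of_real pi * \<i> * cauchy_int \<epsilon> f x - (LBINT t. ?m \<epsilon> t * f t) = (LBINT t. truncated_kernel \<epsilon> x t * f t)"
      using eventually_at_right_less[of "0::real"]
    proof eventually_elim
      case (elim \<epsilon>)
      have *: "p * (k * y) - (p * k - q) * y = q * y" for p q k y :: complex
        by (simp add: left_diff_distrib)
      have "2 * of_real pi * \<i> * cauchy_int \<epsilon> f x = (LBINT t. 2 * of_real pi * \<i> * (cauchy_kernel \<epsilon> x t * f t))"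
        unfolding cauchy_int_def by (rule integral_mult_right_zero[symmetric])
      then have "2 * of_real pi * \<i> * cauchy_int \<epsilon> f x - (LBINT t. ?m \<epsilon> t * f t)
          = (LBINT t. 2 * of_real pi * \<i> * (cauchy_kernel \<epsilon> x t * f t)) - (LBINT t. ?m \<epsilon> t * f t)"
        by (rule arg_cong)
      also have "\<dots> = (LBINT t. 2 * of_real pi * \<i> * (cauchy_kernel \<epsilon> x t * f t) - ?m \<epsilon> t * f t)"
        by (intro Bochner_Integration.integral_diff[symmetric] integrable_mult_right cauchy_int_integrable f elim i)
      also have "\<dots> = (LBINT t. truncated_kernel \<epsilon> x t * f t)"
        by (simp only: *)
      finally show ?case .
    qed
    ultimately have "((\<lambda>\<epsilon>. LBINT t. truncated_kernel \<epsilon> x t * f t) \<longlongrightarrow> 2 * of_real pi * \<i> * g x - of_real pi * \<i> * f x) (at_right 0)"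
      by (rule Lim_transform_eventually)
    moreover have "2 * of_real pi * \<i> * g x - of_real pi * \<i> * f x = of_real pi * \<i> * (2 * g x - f x)"
      by (simp add: right_diff_distrib)
    ultimately show ?case by simp
  qed
  ultimately show thesis using g that by blast
qed

section \<open>Power weights on the half-line\<close>

text \<open>With the exponential of \<alpha> ln t, additivity in the exponent and non-vanishing hold
  at every real t; \<open>cpow_powr\<close> identifies it with \<open>powr\<close> on t > 0.\<close>

definition cpow :: "complex \<Rightarrow> real \<Rightarrow> complex" where
  "cpow \<alpha> t = exp (\<alpha> * of_real (ln t))"

lemma cpow_measurable [measurable]: "cpow \<alpha> \<in> borel_measurable borel"
  unfolding cpow_def by measurable

lemma cpow_add: "cpow (\<alpha> + \<beta>) t = cpow \<alpha> t * cpow \<beta> t"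
  by (simp add: cpow_def distrib_right exp_add)

lemma cpow_0 [simp]: "cpow 0 t = 1"
  by (simp add: cpow_def)

lemma cpow_minus: "cpow \<alpha> t * cpow (- \<alpha>) t = 1"
  using cpow_add[of \<alpha> "-\<alpha>" t] by simp

lemma cpow_nonzero [simp]: "cpow \<alpha> t \<noteq> 0"
  by (simp add: cpow_def)

lemma cmod_cpow: "t > 0 \<Longrightarrow> cmod (cpow \<alpha> t) = t powr Re \<alpha>"
  by (simp add: cpow_def powr_def)

lemma cpow_powr: "t > 0 \<Longrightarrow> of_real t powr \<alpha> = cpow \<alpha> t"
  by (simp add: cpow_def powr_def Ln_of_real)

section \<open>Majorants homogeneous of degree -1\<close>

definition hom_kernel :: "real \<Rightarrow> real \<Rightarrow> real \<Rightarrow> real" where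
  "hom_kernel b s r = (if 0 < s \<and> 0 < r then max s r powr (b - 1) * min s r powr (- b) else 0)"

lemma hom_kernel_measurable [measurable]: "case_prod (hom_kernel b) \<in> borel_measurable (borel \<Otimes>\<^sub>M borel)"
  unfolding hom_kernel_def by measurable

lemma hom_kernel_nonneg: "0 \<le> hom_kernel b s r"
  by (simp add: hom_kernel_def)

lemma hom_kernel_commute: "hom_kernel b s r = hom_kernel b r s"
  by (simp add: hom_kernel_def max.commute min.commute conj_commute)

lemma nn_integral_powr_from_0:
  "a > -1 \<Longrightarrow> c \<ge> 0 \<Longrightarrow> (\<integral>\<^sup>+x. ennreal (x powr a) * indicator {0..c} x \<partial>lborel) = ennreal (c powr (a + 1) / (a + 1))"
  by (rule nn_integral_has_integral_lebesgue'[OF _ has_integral_powr_from_0]) auto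

lemma nn_integral_powr_to_inf:
  "a < -1 \<Longrightarrow> c > 0 \<Longrightarrow> (\<integral>\<^sup>+x. ennreal (x powr a) * indicator {c..} x \<partial>lborel) = ennreal (- (c powr (a + 1)) / (a + 1))"
  by (rule nn_integral_has_integral_lebesgue'[OF _ has_integral_powr_to_inf]) auto

text \<open>The test function r^(-1/2) suited to kernels homogeneous of degree -1; the value 1 off
  the half-line only keeps it positive, as Schur's test demands.\<close>

definition hom_weight :: "real \<Rightarrow> real" where
  "hom_weight r = (if 0 < r then r powr (-1/2) else 1)"

text \<open>Below s the integrand is a multiple of r^(-b-1/2), above s of r^(b-3/2). Both integrals
  converge because b < 1/2, and each contributes s^(-1/2)/(1/2 - b).\<close>

lemma hom_kernel_Schur:
  assumes b: "0 < b" "b < 1/2"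
  shows "(\<integral>\<^sup>+r. ennreal (hom_kernel b s r * hom_weight r) \<partial>lborel) \<le> ennreal (2 / (1/2 - b) * hom_weight s)"
proof (cases "s > 0")
  case True
  have "(\<integral>\<^sup>+r. ennreal (hom_kernel b s r * hom_weight r) \<partial>lborel)
      \<le> (\<integral>\<^sup>+r. ennreal (s powr (b - 1)) * (ennreal (r powr (- b - 1/2)) * indicator {0..s} r)
        + ennreal (s powr (- b)) * (ennreal (r powr (b - 3/2)) * indicator {s..} r) \<partial>lborel)"
  proof (intro nn_integral_mono)
    fix r :: real
    consider "r \<le> 0" | "0 < r" "r \<le> s" | "s < r" by linarith
    then show "ennreal (hom_kernel b s r * hom_weight r) \<le> ennreal (s powr (b - 1)) * (ennreal (r powr (- b - 1/2)) * indicator {0..s} r)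
        + ennreal (s powr (- b)) * (ennreal (r powr (b - 3/2)) * indicator {s..} r)"
    proof cases
      case 2
      then have "hom_kernel b s r * hom_weight r = s powr (b - 1) * r powr (- b - 1/2)"
        using True by (simp add: hom_kernel_def hom_weight_def max_def min_def mult.assoc flip: powr_add)
      then have "ennreal (hom_kernel b s r * hom_weight r) = ennreal (s powr (b - 1)) * (ennreal (r powr (- b - 1/2)) * indicator {0..s} r)"
        using 2 by (simp add: ennreal_mult)
      then show ?thesis by simp
    next
      case 3
      have "r powr (b - 1) * r powr (-1/2) = r powr (b - 3/2)" by (simp flip: powr_add)
      then have "hom_kernel b s r * hom_weight r = s powr (- b) * r powr (b - 3/2)"
        using True 3 by (simp add: hom_kernel_def hom_weight_def max_def min_def mult_ac)
      then have "ennreal (hom_kernel b s r * hom_weight r) = ennreal (s powr (- b)) * (ennreal (r powr (b - 3/2)) * indicator {s..} r)"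
        using 3 by (simp add: ennreal_mult)
      then show ?thesis by simp
    qed (simp add: hom_kernel_def)
  qed
  also have "\<dots> = ennreal (s powr (b - 1)) * (\<integral>\<^sup>+r. ennreal (r powr (- b - 1/2)) * indicator {0..s} r \<partial>lborel)
      + ennreal (s powr (- b)) * (\<integral>\<^sup>+r. ennreal (r powr (b - 3/2)) * indicator {s..} r \<partial>lborel)"
    by (subst nn_integral_add, measurable) (simp add: nn_integral_cmult)
  also have "\<dots> = ennreal (s powr (b - 1)) * ennreal (s powr (1/2 - b) / (1/2 - b))
      + ennreal (s powr (- b)) * ennreal (s powr (b - 1/2) / (1/2 - b))"
  proof -
    have "- b - 1/2 + 1 = 1/2 - b" "b - 3/2 + 1 = b - 1/2" by auto
    moreover have "- (s powr (b - 1/2)) / (b - 1/2) = s powr (b - 1/2) / (1/2 - b)"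
      using b by (simp add: field_simps)
    ultimately show ?thesis
      using nn_integral_powr_from_0[of "- b - 1/2" s] nn_integral_powr_to_inf[of "b - 3/2" s] b True by simp
  qed
  also have "\<dots> = ennreal (s powr (b - 1) * s powr (1/2 - b) / (1/2 - b) + s powr (- b) * s powr (b - 1/2) / (1/2 - b))"
    using b by (simp add: ennreal_mult[symmetric] ennreal_plus[symmetric] del: ennreal_plus)
  also have "s powr (b - 1) * s powr (1/2 - b) / (1/2 - b) + s powr (- b) * s powr (b - 1/2) / (1/2 - b) = 2 / (1/2 - b) * hom_weight s"
    using True by (simp add: hom_weight_def flip: powr_add)
  finally show ?thesis .
qed (simp add: hom_kernel_def)

lemma hom_weight_pos: "0 < hom_weight r"
  by (simp add: hom_weight_def)

lemma hom_weight_measurable [measurable]: "hom_weight \<in> borel_measurable borel"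
  unfolding hom_weight_def by measurable

lemma hom_kernel_operator:
  assumes b: "0 < b" "b < 1/2" and M: "0 \<le> M"
    and k: "case_prod k \<in> borel_measurable (borel \<Otimes>\<^sub>M borel)" "\<And>x t. cmod (k x t) \<le> M * hom_kernel b x t"
    and f: "sq_integrable f"
  shows "sq_integrable (\<lambda>x. LBINT t. k x t * f t)" "L2nrm (\<lambda>x. LBINT t. k x t * f t) \<le> M * (2 / (1/2 - b)) * L2nrm f"
proof -
  have 1: "(\<integral>\<^sup>+t. ennreal (M * hom_kernel b x t * hom_weight t) \<partial>lborel) \<le> ennreal (M * (2 / (1/2 - b)) * hom_weight x)" for x
  proof -
    have "(\<integral>\<^sup>+t. ennreal (M * hom_kernel b x t * hom_weight t) \<partial>lborel) = ennreal M * (\<integral>\<^sup>+t. ennreal (hom_kernel b x t * hom_weight t) \<partial>lborel)"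
      using M by (subst nn_integral_cmult[symmetric]) (auto simp: ennreal_mult'[symmetric] mult.assoc)
    also have "\<dots> \<le> ennreal M * ennreal (2 / (1/2 - b) * hom_weight x)"
      by (intro mult_left_mono hom_kernel_Schur b) auto
    finally show ?thesis using M b hom_weight_pos[of x] by (simp add: ennreal_mult'[symmetric] mult.assoc)
  qed
  have 2: "(\<integral>\<^sup>+x. ennreal (M * hom_kernel b x t * hom_weight x) \<partial>lborel) \<le> ennreal (M * (2 / (1/2 - b)) * hom_weight t)" for t
    using 1[of t] by (simp add: hom_kernel_commute[of b t])
  show "sq_integrable (\<lambda>x. LBINT t. k x t * f t)" "L2nrm (\<lambda>x. LBINT t. k x t * f t) \<le> M * (2 / (1/2 - b)) * L2nrm f"
    by (rule Schur_operator[of "\<lambda>x t. M * hom_kernel b x t" hom_weight "M * (2 / (1/2 - b))" k f, OF _ _ _ _ _ 1 2 k f];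
        use b M in \<open>auto simp: hom_kernel_nonneg hom_weight_pos intro!: mult_nonneg_nonneg\<close>)+
qed

lemma hom_kernel_integrable:
  assumes b: "0 < b" "b < 1/2" and f: "sq_integrable f"
  shows "AE x in lborel. integrable lborel (\<lambda>t. hom_kernel b x t * cmod (f t))"
    and "sq_integrable (\<lambda>x. of_real (LBINT t. hom_kernel b x t * cmod (f t)))"
proof -
  have [measurable]: "f \<in> borel_measurable borel" using f by (simp add: sq_integrable_def)
  have [measurable]: "hom_kernel b x \<in> borel_measurable borel" for x
    unfolding hom_kernel_def by measurable
  have [measurable]: "case_prod (hom_kernel b) \<in> borel_measurable (borel \<Otimes>\<^sub>M lborel)"
    "case_prod (hom_kernel b) \<in> borel_measurable (lborel \<Otimes>\<^sub>M lborel)"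
    by (simp_all cong: measurable_cong_sets)
  have "(\<integral>\<^sup>+x. (\<integral>\<^sup>+t. ennreal (hom_kernel b x t * cmod (f t)) \<partial>lborel)\<^sup>2 \<partial>lborel) \<le> ennreal (2 / (1/2 - b) * (2 / (1/2 - b)) * (L2nrm f)\<^sup>2)"
    using b hom_kernel_Schur[OF b]
    by (intro Schur_test[where h=hom_weight] f) (auto simp: hom_kernel_nonneg hom_weight_pos hom_kernel_commute[of b _ t for t])
  then have "(\<integral>\<^sup>+x. (\<integral>\<^sup>+t. ennreal (hom_kernel b x t * cmod (f t)) \<partial>lborel)\<^sup>2 \<partial>lborel) \<noteq> \<infinity>"
    by (metis ennreal_less_top infinity_ennreal_def leD)
  then have "AE x in lborel. (\<integral>\<^sup>+t. ennreal (hom_kernel b x t * cmod (f t)) \<partial>lborel)\<^sup>2 \<noteq> \<infinity>"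
    by (intro nn_integral_PInf_AE) auto
  then show "AE x in lborel. integrable lborel (\<lambda>t. hom_kernel b x t * cmod (f t))"
  proof eventually_elim
    case (elim x)
    then have "(\<integral>\<^sup>+t. ennreal (hom_kernel b x t * cmod (f t)) \<partial>lborel) < \<infinity>"
      by (auto simp: less_top power2_eq_square ennreal_mult_eq_top_iff)
    then show ?case by (intro integrableI_bounded) (auto simp: hom_kernel_nonneg)
  qed
  have "sq_integrable (\<lambda>x. LBINT t. of_real (hom_kernel b x t) * of_real (cmod (f t)))"
  proof (rule hom_kernel_operator(1)[OF b, where M=1])
    show "sq_integrable (\<lambda>t. complex_of_real (cmod (f t)))"
      by (rule sq_integrable_mono[OF f]) auto
  qed (auto simp: hom_kernel_nonneg split_beta')
  then show "sq_integrable (\<lambda>x. of_real (LBINT t. hom_kernel b x t * cmod (f t)))"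
    unfolding integral_complex_of_real[symmetric] by simp
qed

lemma norm_exp_diff_1_le: "cmod (exp w - 1) \<le> cmod w * exp \<bar>Re w\<bar>"
proof -
  have "cmod (exp w - exp 0) \<le> exp \<bar>Re w\<bar> * cmod (w - 0)"
  proof (rule field_differentiable_bound[of "closed_segment 0 w"])
    fix z assume "z \<in> closed_segment 0 w"
    then obtain u where "0 \<le> u" "u \<le> 1" "z = u *\<^sub>R w" by (auto simp: in_segment)
    then have "Re z \<le> u * \<bar>Re w\<bar>"
      using abs_ge_self[of "u * Re w"] by (simp add: abs_mult)
    also have "\<dots> \<le> \<bar>Re w\<bar>" using \<open>0 \<le> u\<close> \<open>u \<le> 1\<close> by (intro mult_left_le_one_le) auto
    finally have "Re z \<le> \<bar>Re w\<bar>" .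
    then show "cmod (exp z) \<le> exp \<bar>Re w\<bar>" by simp
    show "(exp has_field_derivative exp z) (at z within closed_segment 0 w)"
      by (rule DERIV_subset[OF DERIV_exp]) simp
  qed auto
  then show ?thesis by (simp add: mult.commute)
qed

text \<open>The kernel with weight (s/r)^\<alpha> minus the kernel without it. The numerator
  vanishes at r = s, so no singularity remains; on the diagonal itself the value is 0 by division by
  zero.\<close>

definition weight_kernel :: "complex \<Rightarrow> real \<Rightarrow> real \<Rightarrow> complex" where
  "weight_kernel \<alpha> s r = (if 0 < s \<and> 0 < r then (cpow \<alpha> s * cpow (- \<alpha>) r - 1) / of_real (r - s) else 0)"

lemma weight_kernel_measurable [measurable]: "case_prod (weight_kernel \<alpha>) \<in> borel_measurable (borel \<Otimes>\<^sub>M borel)"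
  unfolding weight_kernel_def by measurable

text \<open>L is the logarithm of a ratio of arguments. Near the diagonal the numerator of
  \<open>weight_kernel\<close> is of size L and the denominator of size 1 - exp(-L), which balance;
  for large L the linear growth is absorbed by exp(c L) with c as small as desired.\<close>

lemma linear_exp_bound:
  assumes "c > 0" "0 \<le> (L::real)"
  shows "L \<le> (1/c + 1) * (1 - exp (- L)) * exp (c * L)"
proof -
  have "1 + L \<le> (1/c + 1) * (1 + c * L)" using assms by (simp add: field_simps)
  also have "\<dots> \<le> (1/c + 1) * exp (c * L)"
    using assms exp_ge_add_one_self[of "c * L"] by (intro mult_left_mono) auto
  finally have 1: "1 + L \<le> (1/c + 1) * exp (c * L)" .
  have "exp (- L) \<le> 1 / (1 + L)"
    using exp_ge_add_one_self[of L] assms by (simp add: exp_minus inverse_eq_divide frac_le)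
  then have 2: "L / (1 + L) \<le> 1 - exp (- L)" using assms by (simp add: field_simps)
  have "L = L / (1 + L) * (1 + L)" using assms by simp
  also have "\<dots> \<le> (1 - exp (- L)) * ((1/c + 1) * exp (c * L))"
    using 1 2 assms by (intro mult_mono) auto
  finally show ?thesis by (simp add: mult_ac)
qed

text \<open>With L = ln(M/m) the numerator is at most |\<alpha>| L exp(|Re \<alpha>| L) and the
  denominator is M (1 - exp(-L)). The slack c = b - |Re \<alpha>| is spent on absorbing the factor
  L.\<close>

lemma weight_kernel_bound:
  assumes b: "\<bar>Re \<alpha>\<bar> < b" 
  shows "cmod (weight_kernel \<alpha> s r) \<le> cmod \<alpha> * (1 / (b - \<bar>Re \<alpha>\<bar>) + 1) * hom_kernel b s r"
proof (cases "0 < s \<and> 0 < r \<and> s \<noteq> r")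
  case True
  define m M L where "m = min s r" and "M = max s r" and "L = ln M - ln m"
  define c where "c = b - \<bar>Re \<alpha>\<bar>"
  have c: "c > 0" using b by (simp add: c_def)
  have mM: "0 < m" "m < M" "0 < M" "\<bar>r - s\<bar> = M - m" using True by (auto simp: m_def M_def)
  have L: "0 \<le> L" using mM by (simp add: L_def)
  have abs: "\<bar>ln s - ln r\<bar> = L" using True by (auto simp: L_def m_def M_def max_def min_def)
  have "cpow \<alpha> s * cpow (- \<alpha>) r = exp (\<alpha> * of_real (ln s - ln r))"
    by (simp add: cpow_def exp_add[symmetric] algebra_simps)
  then have "cmod (cpow \<alpha> s * cpow (- \<alpha>) r - 1) \<le> cmod (\<alpha> * of_real (ln s - ln r)) * exp \<bar>Re (\<alpha> * of_real (ln s - ln r))\<bar>"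
    using norm_exp_diff_1_le[of "\<alpha> * of_real (ln s - ln r)"] by simp
  also have "\<dots> = cmod \<alpha> * (L * exp (\<bar>Re \<alpha>\<bar> * L))"
    using abs by (simp add: norm_mult abs_mult del: of_real_diff)
  also have "\<dots> \<le> cmod \<alpha> * ((1/c + 1) * (1 - exp (- L)) * exp (c * L) * exp (\<bar>Re \<alpha>\<bar> * L))"
    using linear_exp_bound[OF c L] by (intro mult_left_mono mult_right_mono) auto
  also have "\<dots> = cmod \<alpha> * (1/c + 1) * ((1 - exp (- L)) * exp (b * L))"
  proof -
    have "exp (c * L) * exp (\<bar>Re \<alpha>\<bar> * L) = exp (b * L)" by (simp add: c_def exp_add[symmetric] algebra_simps)
    then show ?thesis by (simp only: mult.assoc)
  qed
  also have "(1 - exp (- L)) * exp (b * L) = (M - m) * (M powr (b - 1) * m powr (- b))"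
  proof -
    have e: "exp (- L) = m / M" using mM by (simp add: L_def exp_diff)
    have "exp (b * L) = M powr b * m powr (- b)"
      using mM by (simp add: L_def powr_def exp_add[symmetric] algebra_simps)
    moreover have "M powr b = M powr (b - 1) * M" using mM by (simp add: powr_diff)
    ultimately show ?thesis using mM unfolding e by (simp add: field_simps)
  qed
  finally have "cmod (cpow \<alpha> s * cpow (- \<alpha>) r - 1) \<le> (cmod \<alpha> * (1/c + 1) * (M powr (b - 1) * m powr (- b))) * (M - m)"
    by (simp add: mult_ac)
  then have "cmod (cpow \<alpha> s * cpow (- \<alpha>) r - 1) / (M - m) \<le> cmod \<alpha> * (1/c + 1) * (M powr (b - 1) * m powr (- b))"
    using mM by (simp add: pos_divide_le_eq)
  then show ?thesis
    using True mM by (simp add: weight_kernel_def hom_kernel_def norm_divide m_def M_def c_def del: of_real_diff)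
next
  case False
  then have "weight_kernel \<alpha> s r = 0" by (auto simp: weight_kernel_def)
  then show ?thesis using assms by (auto intro!: mult_nonneg_nonneg simp: hom_kernel_nonneg)
qed

text \<open>Halfway between |Re \<alpha>| and 1/2: the kernel bound requires a larger exponent than
  |Re \<alpha>|, Schur's test a smaller one than 1/2.\<close>

definition mid_exponent :: "complex \<Rightarrow> real" where
  "mid_exponent \<alpha> = (\<bar>Re \<alpha>\<bar> + 1/2) / 2"

definition weight_const :: "complex \<Rightarrow> real" where
  "weight_const \<alpha> = cmod \<alpha> * (1 / (mid_exponent \<alpha> - \<bar>Re \<alpha>\<bar>) + 1)"

lemma mid_exponent:
  assumes "\<bar>Re \<alpha>\<bar> < 1/2"
  shows "0 < mid_exponent \<alpha>" "mid_exponent \<alpha> < 1/2" "\<bar>Re \<alpha>\<bar> < mid_exponent \<alpha>" "0 \<le> weight_const \<alpha>"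
    "cmod (weight_kernel \<alpha> s r) \<le> weight_const \<alpha> * hom_kernel (mid_exponent \<alpha>) s r"
proof -
  show *: "0 < mid_exponent \<alpha>" "mid_exponent \<alpha> < 1/2" "\<bar>Re \<alpha>\<bar> < mid_exponent \<alpha>"
    using assms by (auto simp: mid_exponent_def)
  then show "0 \<le> weight_const \<alpha>" by (simp add: weight_const_def)
  show "cmod (weight_kernel \<alpha> s r) \<le> weight_const \<alpha> * hom_kernel (mid_exponent \<alpha>) s r"
    unfolding weight_const_def by (rule weight_kernel_bound[OF *(3)])
qed

subsection \<open>Weighted Cauchy integrals\<close>

text \<open>One representative is fixed for each function, so identities between boundary functions
  can be expected only almost everywhere.\<close>

definition boundary :: "(real \<Rightarrow> complex) \<Rightarrow> real \<Rightarrow> complex" where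
  "boundary f = (SOME g. sq_integrable g \<and> L2nrm g \<le> L2nrm f \<and>
    (\<lambda>n. L2nrm (\<lambda>t. cauchy_int (null_seq n) f t - g t)) \<longlonglongrightarrow> 0 \<and>
    (AE x in lborel. ((\<lambda>\<epsilon>. cauchy_int \<epsilon> f x) \<longlongrightarrow> g x) (at_right 0)) \<and>
    (AE x in lborel. ((\<lambda>\<epsilon>. LBINT t. truncated_kernel \<epsilon> x t * f t) \<longlongrightarrow> of_real pi * \<i> * (2 * g x - f x)) (at_right 0)))"

lemma boundary:
  assumes "sq_integrable f"
  shows "sq_integrable (boundary f)" "L2nrm (boundary f) \<le> L2nrm f"
    "(\<lambda>n. L2nrm (\<lambda>t. cauchy_int (null_seq n) f t - boundary f t)) \<longlonglongrightarrow> 0"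
    "AE x in lborel. ((\<lambda>\<epsilon>. cauchy_int \<epsilon> f x) \<longlongrightarrow> boundary f x) (at_right 0)"
    "AE x in lborel. ((\<lambda>\<epsilon>. LBINT t. truncated_kernel \<epsilon> x t * f t) \<longlongrightarrow> of_real pi * \<i> * (2 * boundary f x - f x)) (at_right 0)"
proof -
  have "\<exists>g. sq_integrable g \<and> L2nrm g \<le> L2nrm f \<and>
    (\<lambda>n. L2nrm (\<lambda>t. cauchy_int (null_seq n) f t - g t)) \<longlonglongrightarrow> 0 \<and>
    (AE x in lborel. ((\<lambda>\<epsilon>. cauchy_int \<epsilon> f x) \<longlongrightarrow> g x) (at_right 0)) \<and>
    (AE x in lborel. ((\<lambda>\<epsilon>. LBINT t. truncated_kernel \<epsilon> x t * f t) \<longlongrightarrow> of_real pi * \<i> * (2 * g x - f x)) (at_right 0))"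
    by (rule cauchy_int_boundary[OF assms]) blast
  from someI_ex[OF this] show "sq_integrable (boundary f)" "L2nrm (boundary f) \<le> L2nrm f"
    "(\<lambda>n. L2nrm (\<lambda>t. cauchy_int (null_seq n) f t - boundary f t)) \<longlonglongrightarrow> 0"
    "AE x in lborel. ((\<lambda>\<epsilon>. cauchy_int \<epsilon> f x) \<longlongrightarrow> boundary f x) (at_right 0)"
    "AE x in lborel. ((\<lambda>\<epsilon>. LBINT t. truncated_kernel \<epsilon> x t * f t) \<longlongrightarrow> of_real pi * \<i> * (2 * boundary f x - f x)) (at_right 0)"
    unfolding boundary_def[symmetric] by blast+
qed

definition half_line :: "(real \<Rightarrow> complex) \<Rightarrow> bool" where
  "half_line f \<longleftrightarrow> sq_integrable f \<and> (\<forall>t\<le>0. f t = 0)"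

lemma half_lineD: "half_line f \<Longrightarrow> sq_integrable f" "half_line f \<Longrightarrow> t \<le> 0 \<Longrightarrow> f t = 0"
  by (auto simp: half_line_def)

definition weight_int :: "complex \<Rightarrow> (real \<Rightarrow> complex) \<Rightarrow> real \<Rightarrow> complex" where
  "weight_int \<alpha> f x = (LBINT t. weight_kernel \<alpha> x t * f t)"

text \<open>The factor 2 is chosen so that the limit at \<alpha> = 0 is 2 Df, that is Sf +
  f.\<close>

definition wcauchy :: "complex \<Rightarrow> real \<Rightarrow> (real \<Rightarrow> complex) \<Rightarrow> real \<Rightarrow> complex" where
  "wcauchy \<alpha> \<epsilon> f x = 2 * cpow \<alpha> x * cauchy_int \<epsilon> (\<lambda>t. cpow (- \<alpha>) t * f t) x"

text \<open>Defined through the bounded pieces rather than as a limit, so that boundedness is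
  immediate; \<open>wcauchy_tendsto\<close> shows that it is the boundary value of
  \<open>wcauchy\<close>.\<close>

definition wboundary :: "complex \<Rightarrow> (real \<Rightarrow> complex) \<Rightarrow> real \<Rightarrow> complex" where
  "wboundary \<alpha> f x = (if 0 < x then 2 * boundary f x + 1 / (of_real pi * \<i>) * weight_int \<alpha> f x else 0)"

lemma weight_int_bound:
  assumes \<alpha>: "\<bar>Re \<alpha>\<bar> < 1/2" and f: "sq_integrable f"
  shows "sq_integrable (weight_int \<alpha> f)"
    "L2nrm (weight_int \<alpha> f) \<le> weight_const \<alpha> * (2 / (1/2 - mid_exponent \<alpha>)) * L2nrm f"
  unfolding weight_int_def
  by (rule hom_kernel_operator[OF mid_exponent(1,2)[OF \<alpha>] mid_exponent(4)[OF \<alpha>] weight_kernel_measurable mid_exponent(5)[OF \<alpha>] f])+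

lemma weight_int_AE_integrable:
  assumes \<alpha>: "\<bar>Re \<alpha>\<bar> < 1/2" and f: "sq_integrable f"
  shows "AE x in lborel. integrable lborel (\<lambda>t. weight_kernel \<alpha> x t * f t)"
  using hom_kernel_integrable(1)[OF mid_exponent(1,2)[OF \<alpha>] f]
proof eventually_elim
  case (elim x)
  have [measurable]: "f \<in> borel_measurable borel" using f by (simp add: sq_integrable_def)
  have [measurable]: "weight_kernel \<alpha> x \<in> borel_measurable borel" unfolding weight_kernel_def by measurable
  show ?case
  proof (rule Bochner_Integration.integrable_bound[OF integrable_mult_right[OF elim, of "weight_const \<alpha>"]])
    show "AE t in lborel. norm (weight_kernel \<alpha> x t * f t) \<le> norm (weight_const \<alpha> * (hom_kernel (mid_exponent \<alpha>) x t * cmod (f t)))"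
      using mid_exponent(4,5)[OF \<alpha>] hom_kernel_nonneg
      by (intro AE_I2) (auto simp: norm_mult abs_mult mult.assoc[symmetric] intro!: mult_right_mono)
  qed measurable
qed

lemma wboundary_half_line:
  assumes \<alpha>: "\<bar>Re \<alpha>\<bar> < 1/2" and f: "half_line f"
  shows "half_line (wboundary \<alpha> f)"
    "L2nrm (wboundary \<alpha> f) \<le> (2 + weight_const \<alpha> * (2 / (1/2 - mid_exponent \<alpha>)) / pi) * L2nrm f"
proof -
  note f' = half_lineD(1)[OF f]
  let ?h = "\<lambda>x. 2 * boundary f x + 1 / (of_real pi * \<i>) * weight_int \<alpha> f x"
  have s: "sq_integrable (\<lambda>x. 2 * boundary f x)" "sq_integrable (\<lambda>x. 1 / (of_real pi * \<i>) * weight_int \<alpha> f x)"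
    by (intro sq_integrable_cmult boundary f' weight_int_bound[OF \<alpha>])+
  then have h: "sq_integrable ?h" by (rule sq_integrable_add)
  have [measurable]: "boundary f \<in> borel_measurable borel" "weight_int \<alpha> f \<in> borel_measurable borel"
    using boundary(1)[OF f'] weight_int_bound(1)[OF \<alpha> f'] by (auto simp: sq_integrable_def)
  have m: "wboundary \<alpha> f \<in> borel_measurable borel" unfolding wboundary_def by measurable
  have le: "AE x in lborel. cmod (wboundary \<alpha> f x) \<le> cmod (?h x)" by (auto simp: wboundary_def)
  show "half_line (wboundary \<alpha> f)"
    unfolding half_line_def
  proof
    show "sq_integrable (wboundary \<alpha> f)" by (rule sq_integrable_mono(1)[OF h m le])
  qed (simp add: wboundary_def)
  have "L2nrm (wboundary \<alpha> f) \<le> L2nrm ?h" by (rule sq_integrable_mono(2)[OF h m le])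
  also have "\<dots> \<le> L2nrm (\<lambda>x. 2 * boundary f x) + L2nrm (\<lambda>x. 1 / (of_real pi * \<i>) * weight_int \<alpha> f x)"
    by (rule L2nrm_triangle[OF s])
  also have "\<dots> = 2 * L2nrm (boundary f) + 1 / pi * L2nrm (weight_int \<alpha> f)"
    unfolding L2nrm_cmult by (simp add: norm_divide norm_mult)
  also have "\<dots> \<le> 2 * L2nrm f + 1 / pi * (weight_const \<alpha> * (2 / (1/2 - mid_exponent \<alpha>)) * L2nrm f)"
    by (intro add_mono mult_left_mono boundary f' weight_int_bound[OF \<alpha>]) auto
  also have "\<dots> = (2 + weight_const \<alpha> * (2 / (1/2 - mid_exponent \<alpha>)) / pi) * L2nrm f"
    by (simp only: distrib_right) simp
  finally show "L2nrm (wboundary \<alpha> f) \<le> (2 + weight_const \<alpha> * (2 / (1/2 - mid_exponent \<alpha>)) / pi) * L2nrm f" .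
qed

text \<open>Dividing out the singularity: the weighted and the unweighted Cauchy kernels differ by
  an absolutely convergent kernel.\<close>

definition damping :: "real \<Rightarrow> real \<Rightarrow> complex" where
  "damping \<epsilon> u = of_real u / (of_real u - \<i> * of_real \<epsilon>)"

lemma damping_le: "cmod (damping \<epsilon> u) \<le> 1"
proof -
  have "\<bar>u\<bar> \<le> cmod (of_real u - \<i> * of_real \<epsilon>)"
    using abs_Re_le_cmod[of "of_real u - \<i> * of_real \<epsilon>"] by simp
  then show ?thesis by (cases "of_real u - \<i> * of_real \<epsilon> = 0") (auto simp: damping_def norm_divide divide_simps)
qed

lemma damping_tendsto:
  assumes "u \<noteq> 0" shows "((\<lambda>\<epsilon>. damping \<epsilon> u) \<longlongrightarrow> 1) (at_right 0)"
proof -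
  have "((\<lambda>\<epsilon>. damping \<epsilon> u) \<longlongrightarrow> of_real u / (of_real u - \<i> * of_real 0)) (at_right 0)"
    unfolding damping_def using assms by (intro tendsto_intros) auto
  then show ?thesis using assms by simp
qed

lemma wcauchy_kernel_split:
  assumes "\<epsilon> > 0" "x > 0" "t > 0"
  shows "2 * cpow \<alpha> x * (cauchy_kernel \<epsilon> x t * cpow (- \<alpha>) t)
    = 2 * cauchy_kernel \<epsilon> x t + 1 / (of_real pi * \<i>) * (weight_kernel \<alpha> x t * damping \<epsilon> (t - x))"
proof -
  define D where "D = complex_of_real (t - x) - \<i> * of_real \<epsilon>"
  have D: "D \<noteq> 0" using shift_nonzero[of \<epsilon> "t - x"] assms by (simp add: D_def)
  define P where "P = cpow \<alpha> x * cpow (- \<alpha>) t"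
  have w: "weight_kernel \<alpha> x t * damping \<epsilon> (t - x) = (P - 1) / D"
  proof (cases "t = x")
    case True
    then have "P = 1" by (simp add: P_def cpow_minus)
    then show ?thesis using True by (simp add: damping_def)
  next
    case False
    then show ?thesis using assms by (simp add: weight_kernel_def damping_def P_def D_def del: of_real_diff)
  qed
  have c: "2 * cauchy_kernel \<epsilon> x t = 1 / (of_real pi * \<i>) * (1 / D)"
    by (simp add: cauchy_kernel_def D_def)
  have "2 * cpow \<alpha> x * (cauchy_kernel \<epsilon> x t * cpow (- \<alpha>) t) = (2 * cauchy_kernel \<epsilon> x t) * P"
    by (simp add: P_def)
  also have "\<dots> = 2 * cauchy_kernel \<epsilon> x t + 1 / (of_real pi * \<i>) * ((P - 1) / D)"
    unfolding c by (simp add: diff_divide_distrib right_diff_distrib)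
  finally show ?thesis unfolding w .
qed

lemma wcauchy_split:
  assumes e: "\<epsilon> > 0" and x: "x > 0" and f: "half_line f"
    and i: "integrable lborel (\<lambda>t. weight_kernel \<alpha> x t * f t)"
  shows "wcauchy \<alpha> \<epsilon> f x = 2 * cauchy_int \<epsilon> f x
      + 1 / (of_real pi * \<i>) * (LBINT t. damping \<epsilon> (t - x) * (weight_kernel \<alpha> x t * f t))"
    and "integrable lborel (\<lambda>t. damping \<epsilon> (t - x) * (weight_kernel \<alpha> x t * f t))"
proof -
  have [measurable]: "f \<in> borel_measurable borel" using half_lineD(1)[OF f] by (simp add: sq_integrable_def)
  have [measurable]: "weight_kernel \<alpha> x \<in> borel_measurable borel" unfolding weight_kernel_def by measurable
  show i2: "integrable lborel (\<lambda>t. damping \<epsilon> (t - x) * (weight_kernel \<alpha> x t * f t))"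
  proof (rule Bochner_Integration.integrable_bound[OF i])
    show "(\<lambda>t. damping \<epsilon> (t - x) * (weight_kernel \<alpha> x t * f t)) \<in> borel_measurable lborel"
      unfolding damping_def by measurable
    show "AE t in lborel. cmod (damping \<epsilon> (t - x) * (weight_kernel \<alpha> x t * f t)) \<le> cmod (weight_kernel \<alpha> x t * f t)"
      using damping_le[of \<epsilon>] by (intro AE_I2) (subst norm_mult, rule mult_left_le_one_le; simp)
  qed
  have "wcauchy \<alpha> \<epsilon> f x = (LBINT t. 2 * cpow \<alpha> x * (cauchy_kernel \<epsilon> x t * (cpow (- \<alpha>) t * f t)))"
    unfolding wcauchy_def cauchy_int_def by (rule integral_mult_right_zero[symmetric])
  also have "\<dots> = (LBINT t. 2 * (cauchy_kernel \<epsilon> x t * f t) + 1 / (of_real pi * \<i>) * (damping \<epsilon> (t - x) * (weight_kernel \<alpha> x t * f t)))"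
  proof (rule Bochner_Integration.integral_cong[OF refl])
    fix t
    show "2 * cpow \<alpha> x * (cauchy_kernel \<epsilon> x t * (cpow (- \<alpha>) t * f t))
        = 2 * (cauchy_kernel \<epsilon> x t * f t) + 1 / (of_real pi * \<i>) * (damping \<epsilon> (t - x) * (weight_kernel \<alpha> x t * f t))"
    proof (cases "t > 0")
      case True
      have "2 * cpow \<alpha> x * (cauchy_kernel \<epsilon> x t * (cpow (- \<alpha>) t * f t)) = (2 * cpow \<alpha> x * (cauchy_kernel \<epsilon> x t * cpow (- \<alpha>) t)) * f t"
        by (simp add: mult.assoc)
      also have "\<dots> = (2 * cauchy_kernel \<epsilon> x t + 1 / (of_real pi * \<i>) * (weight_kernel \<alpha> x t * damping \<epsilon> (t - x))) * f t"
        by (simp only: wcauchy_kernel_split[OF e x True])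
      finally show ?thesis by (simp only: distrib_right mult.assoc mult.left_commute[of "damping \<epsilon> (t - x)" "weight_kernel \<alpha> x t"])
    qed (use half_lineD(2)[OF f] in auto)
  qed
  also have "\<dots> = (LBINT t. 2 * (cauchy_kernel \<epsilon> x t * f t)) + (LBINT t. 1 / (of_real pi * \<i>) * (damping \<epsilon> (t - x) * (weight_kernel \<alpha> x t * f t)))"
    by (intro Bochner_Integration.integral_add integrable_mult_right cauchy_int_integrable e half_lineD(1)[OF f] i2)
  finally show "wcauchy \<alpha> \<epsilon> f x = 2 * cauchy_int \<epsilon> f x
      + 1 / (of_real pi * \<i>) * (LBINT t. damping \<epsilon> (t - x) * (weight_kernel \<alpha> x t * f t))"
    unfolding cauchy_int_def integral_mult_right_zero .
qed

lemma at_right_dominated_convergence: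
  fixes s :: "real \<Rightarrow> real \<Rightarrow> complex"
  assumes s: "\<And>\<epsilon>. \<epsilon> > 0 \<Longrightarrow> s \<epsilon> \<in> borel_measurable lborel" and f: "f \<in> borel_measurable lborel"
    and w: "integrable lborel w"
    and lim: "AE t in lborel. ((\<lambda>\<epsilon>. s \<epsilon> t) \<longlongrightarrow> f t) (at_right 0)"
    and le: "\<And>\<epsilon> t. \<epsilon> > 0 \<Longrightarrow> cmod (s \<epsilon> t) \<le> w t"
  shows "((\<lambda>\<epsilon>. LBINT t. s \<epsilon> t) \<longlongrightarrow> (LBINT t. f t)) (at_right 0)"
proof -
  have "((\<lambda>y. LBINT t. s (inverse y) t) \<longlongrightarrow> (LBINT t. f t)) at_top"
  proof -
    have "((\<lambda>y. LBINT t. (if 0 < y then s (inverse y) t else 0)) \<longlongrightarrow> (LBINT t. f t)) at_top"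
    proof (rule integral_dominated_convergence_at_top[where w=w])
      show "AE t in lborel. ((\<lambda>y. if 0 < y then s (inverse y) t else 0) \<longlongrightarrow> f t) at_top"
        using lim
      proof eventually_elim
        case (elim t)
        have "((\<lambda>y. s (inverse y) t) \<longlongrightarrow> f t) at_top"
          by (rule filterlim_compose[OF elim filterlim_inverse_at_right_top])
        moreover have "\<forall>\<^sub>F y in at_top. s (inverse y) t = (if 0 < y then s (inverse y) t else 0)"
          using eventually_gt_at_top[of "0::real"] by eventually_elim simp
        ultimately show ?case by (rule Lim_transform_eventually)
      qed
      have w0: "0 \<le> w t" for t using le[of 1 t] norm_ge_zero[of "s 1 t"] by linarith
      show "\<forall>\<^sub>F y in at_top. AE t in lborel. norm (if 0 < y then s (inverse y) t else 0) \<le> w t"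
        using le w0 by (intro always_eventually allI AE_I2) auto
      show "(\<lambda>t. if 0 < y then s (inverse y) t else 0) \<in> borel_measurable lborel" for y
        using s[of "inverse y"] by (cases "0 < y") auto
    qed (use f w in auto)
    moreover have "\<forall>\<^sub>F y in at_top. (LBINT t. (if 0 < y then s (inverse y) t else 0)) = (LBINT t. s (inverse y) t)"
      using eventually_gt_at_top[of "0::real"] by eventually_elim simp
    ultimately show ?thesis by (rule Lim_transform_eventually)
  qed
  then show ?thesis by (simp add: filterlim_at_right_to_top)
qed

lemma wcauchy_tendsto:
  assumes \<alpha>: "\<bar>Re \<alpha>\<bar> < 1/2" and f: "half_line f"
  shows "AE x in lborel. 0 < x \<longrightarrow> ((\<lambda>\<epsilon>. wcauchy \<alpha> \<epsilon> f x) \<longlongrightarrow> wboundary \<alpha> f x) (at_right 0)"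
  using weight_int_AE_integrable[OF \<alpha> half_lineD(1)[OF f]] boundary(4)[OF half_lineD(1)[OF f]]
proof eventually_elim
  case (elim x)
  have [measurable]: "f \<in> borel_measurable borel" using half_lineD(1)[OF f] by (simp add: sq_integrable_def)
  have [measurable]: "weight_kernel \<alpha> x \<in> borel_measurable borel" unfolding weight_kernel_def by measurable
  show ?case
  proof
    assume x: "0 < x"
    have "((\<lambda>\<epsilon>. LBINT t. damping \<epsilon> (t - x) * (weight_kernel \<alpha> x t * f t)) \<longlongrightarrow> (LBINT t. weight_kernel \<alpha> x t * f t)) (at_right 0)"
    proof (rule at_right_dominated_convergence[OF _ _ integrable_norm[OF elim(1)]])
      show "(\<lambda>t. damping \<epsilon> (t - x) * (weight_kernel \<alpha> x t * f t)) \<in> borel_measurable lborel" for \<epsilon>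
        unfolding damping_def by measurable
      have "AE t in lborel. t \<noteq> x" by (rule AE_lborel_singleton)
      then show "AE t in lborel. ((\<lambda>\<epsilon>. damping \<epsilon> (t - x) * (weight_kernel \<alpha> x t * f t)) \<longlongrightarrow> weight_kernel \<alpha> x t * f t) (at_right 0)"
      proof eventually_elim
        case (elim t)
        have "((\<lambda>\<epsilon>. damping \<epsilon> (t - x) * (weight_kernel \<alpha> x t * f t)) \<longlongrightarrow> 1 * (weight_kernel \<alpha> x t * f t)) (at_right 0)"
          using elim by (intro tendsto_mult tendsto_const damping_tendsto) auto
        then show ?case by simp
      qed
      show "cmod (damping \<epsilon> (t - x) * (weight_kernel \<alpha> x t * f t)) \<le> cmod (weight_kernel \<alpha> x t * f t)" for \<epsilon> t
        using damping_le[of \<epsilon>] by (subst norm_mult, intro mult_left_le_one_le) auto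
    qed measurable
    then have "((\<lambda>\<epsilon>. 2 * cauchy_int \<epsilon> f x + 1 / (of_real pi * \<i>) * (LBINT t. damping \<epsilon> (t - x) * (weight_kernel \<alpha> x t * f t))) 
        \<longlongrightarrow> 2 * boundary f x + 1 / (of_real pi * \<i>) * (LBINT t. weight_kernel \<alpha> x t * f t)) (at_right 0)"
      by (intro tendsto_add tendsto_mult tendsto_const elim(2))
    moreover have "\<forall>\<^sub>F \<epsilon> in at_right 0. 2 * cauchy_int \<epsilon> f x + 1 / (of_real pi * \<i>) * (LBINT t. damping \<epsilon> (t - x) * (weight_kernel \<alpha> x t * f t)) = wcauchy \<alpha> \<epsilon> f x"
      using eventually_at_right_less[of "0::real"] by eventually_elim (rule wcauchy_split(1)[OF _ x f elim(1), symmetric])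
    ultimately have "((\<lambda>\<epsilon>. wcauchy \<alpha> \<epsilon> f x) \<longlongrightarrow> 2 * boundary f x + 1 / (of_real pi * \<i>) * (LBINT t. weight_kernel \<alpha> x t * f t)) (at_right 0)"
      by (rule Lim_transform_eventually)
    then show "((\<lambda>\<epsilon>. wcauchy \<alpha> \<epsilon> f x) \<longlongrightarrow> wboundary \<alpha> f x) (at_right 0)"
      using x by (simp add: wboundary_def weight_int_def)
  qed
qed

lemma norm_integral_le_integral:
  fixes f :: "'a \<Rightarrow> 'b::{banach, second_countable_topology}"
  assumes "integrable M g" "\<And>t. norm (f t) \<le> g t"
  shows "norm (integral\<^sup>L M f) \<le> integral\<^sup>L M g"
proof (cases "integrable M f")
  case False
  have "0 \<le> g t" for t using assms(2)[of t] norm_ge_zero order_trans by blast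
  then show ?thesis using False by (simp add: not_integrable_integral_eq)
next
  case True
  have "norm (integral\<^sup>L M f) \<le> (LINT t|M. norm (f t))" by (rule integral_norm_bound)
  also have "\<dots> \<le> integral\<^sup>L M g"
    using True assms by (intro Bochner_Integration.integral_mono) auto
  finally show ?thesis .
qed

text \<open>The unweighted part converges in L2. The correction converges by domination, with a
  majorant in L2 supplied by Schur's test. Pairing with a function supported on the half-line
  confines everything to x > 0, where the splitting is valid.\<close>

lemma wcauchy_weak_limit:
  assumes \<alpha>: "\<bar>Re \<alpha>\<bar> < 1/2" and f: "half_line f" and k: "half_line k"
  shows "(\<lambda>n. LBINT x. k x * wcauchy \<alpha> (null_seq n) f x) \<longlonglongrightarrow> (LBINT x. k x * wboundary \<alpha> f x)"
proof -
  note f' = half_lineD(1)[OF f] and k' = half_lineD(1)[OF k]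
  have [measurable]: "f \<in> borel_measurable borel" "k \<in> borel_measurable borel" 
    using f' k' by (simp_all add: sq_integrable_def)
  have [measurable]: "case_prod (weight_kernel \<alpha>) \<in> borel_measurable (borel \<Otimes>\<^sub>M lborel)"
    by (simp cong: measurable_cong_sets)
  let ?C = "\<lambda>n. cauchy_int (null_seq n) f"
  let ?d = "\<lambda>n x. LBINT t. damping (null_seq n) (t - x) * (weight_kernel \<alpha> x t * f t)"
  let ?N = "\<lambda>x. complex_of_real (LBINT t. hom_kernel (mid_exponent \<alpha>) x t * cmod (f t))"
  have dm[measurable]: "?d n \<in> borel_measurable borel" for n
    unfolding damping_def by measurable
  have wm[measurable]: "weight_int \<alpha> f \<in> borel_measurable borel"
    using weight_int_bound(1)[OF \<alpha> f'] by (simp add: sq_integrable_def)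
  have d_le: "AE x in lborel. cmod (?d n x) \<le> cmod (of_real (weight_const \<alpha>) * ?N x)" for n
    using hom_kernel_integrable(1)[OF mid_exponent(1,2)[OF \<alpha>] f']
  proof eventually_elim
    case (elim x)
    have "cmod (?d n x) \<le> (LBINT t. weight_const \<alpha> * (hom_kernel (mid_exponent \<alpha>) x t * cmod (f t)))"
    proof (rule norm_integral_le_integral)
      show "integrable lborel (\<lambda>t. weight_const \<alpha> * (hom_kernel (mid_exponent \<alpha>) x t * cmod (f t)))"
        by (intro integrable_mult_right elim)
      fix t
      have "cmod (damping (null_seq n) (t - x) * (weight_kernel \<alpha> x t * f t)) \<le> 1 * ((weight_const \<alpha> * hom_kernel (mid_exponent \<alpha>) x t) * cmod (f t))"
        unfolding norm_mult by (intro mult_mono damping_le mid_exponent \<alpha>) (auto simp: mid_exponent[OF \<alpha>] hom_kernel_nonneg)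
      then show "cmod (damping (null_seq n) (t - x) * (weight_kernel \<alpha> x t * f t)) \<le> weight_const \<alpha> * (hom_kernel (mid_exponent \<alpha>) x t * cmod (f t))"
        by (simp add: mult.assoc)
    qed
    also have "\<dots> \<le> cmod (of_real (weight_const \<alpha>) * ?N x)"
      by (simp add: norm_mult abs_ge_self mid_exponent[OF \<alpha>] mult_left_mono)
    finally show ?case .
  qed
  have N: "sq_integrable (\<lambda>x. of_real (weight_const \<alpha>) * ?N x)"
    by (intro sq_integrable_cmult hom_kernel_integrable(2)[OF mid_exponent(1,2)[OF \<alpha>] f'])
  have ds: "sq_integrable (?d n)" for n
    by (rule sq_integrable_mono(1)[OF N _ d_le]) measurable
  have 1: "(\<lambda>n. LBINT x. k x * ?C n x) \<longlonglongrightarrow> (LBINT x. k x * boundary f x)"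
    by (intro L2_continuous_functional k' cauchy_int_bound null_seq f' boundary)
  have 2: "(\<lambda>n. LBINT x. k x * ?d n x) \<longlonglongrightarrow> (LBINT x. k x * weight_int \<alpha> f x)"
  proof (rule integral_dominated_convergence[where w="\<lambda>x. cmod (k x * (of_real (weight_const \<alpha>) * ?N x))"])
    show "integrable lborel (\<lambda>x. cmod (k x * (of_real (weight_const \<alpha>) * ?N x)))"
      by (intro integrable_norm L2_Cauchy_Schwarz k' N)
    show "AE x in lborel. cmod (k x * ?d n x) \<le> cmod (k x * (of_real (weight_const \<alpha>) * ?N x))" for n
      using d_le[of n] by eventually_elim (unfold norm_mult[of "k _"], intro mult_left_mono, auto)
    show "AE x in lborel. (\<lambda>n. k x * ?d n x) \<longlonglongrightarrow> k x * weight_int \<alpha> f x"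
      using weight_int_AE_integrable[OF \<alpha> f']
    proof eventually_elim
      case (elim x)
      have [measurable]: "weight_kernel \<alpha> x \<in> borel_measurable borel" unfolding weight_kernel_def by measurable
      have "(\<lambda>n. ?d n x) \<longlonglongrightarrow> weight_int \<alpha> f x"
        unfolding weight_int_def
      proof (rule integral_dominated_convergence[OF _ _ integrable_norm[OF elim]])
        have "AE t in lborel. t \<noteq> x" by (rule AE_lborel_singleton)
        then show "AE t in lborel. (\<lambda>n. damping (null_seq n) (t - x) * (weight_kernel \<alpha> x t * f t)) \<longlonglongrightarrow> weight_kernel \<alpha> x t * f t"
        proof eventually_elim
          case (elim t)
          have "(\<lambda>n. damping (null_seq n) (t - x) * (weight_kernel \<alpha> x t * f t)) \<longlonglongrightarrow> 1 * (weight_kernel \<alpha> x t * f t)"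
            using elim by (intro tendsto_mult tendsto_const filterlim_compose[OF damping_tendsto null_seq(3)]) auto
          then show ?case by simp
        qed
        show "AE t in lborel. cmod (damping (null_seq n) (t - x) * (weight_kernel \<alpha> x t * f t)) \<le> cmod (weight_kernel \<alpha> x t * f t)" for n
          using damping_le[of "null_seq n"] by (intro AE_I2) (subst norm_mult, rule mult_left_le_one_le; simp)
        show "(\<lambda>t. damping (null_seq n) (t - x) * (weight_kernel \<alpha> x t * f t)) \<in> borel_measurable lborel" for n
          unfolding damping_def by measurable
      qed measurable
      then show ?case by (intro tendsto_mult tendsto_const)
    qed
  qed measurable
  have "(LBINT x. k x * wcauchy \<alpha> (null_seq n) f x) = 2 * (LBINT x. k x * ?C n x) + 1 / (of_real pi * \<i>) * (LBINT x. k x * ?d n x)" for n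
  proof -
    have [measurable]: "wcauchy \<alpha> (null_seq n) f \<in> borel_measurable borel"
      unfolding wcauchy_def by measurable
    have "(LBINT x. k x * wcauchy \<alpha> (null_seq n) f x) = (LBINT x. 2 * (k x * ?C n x) + 1 / (of_real pi * \<i>) * (k x * ?d n x))"
    proof (rule integral_cong_AE)
      show "AE x in lborel. k x * wcauchy \<alpha> (null_seq n) f x = 2 * (k x * ?C n x) + 1 / (of_real pi * \<i>) * (k x * ?d n x)"
        using weight_int_AE_integrable[OF \<alpha> f']
      proof eventually_elim
        case (elim x)
        show ?case
        proof (cases "x > 0")
          case True
          show ?thesis unfolding wcauchy_split(1)[OF null_seq(1) True f elim] by (simp add: distrib_left)
        qed (use half_lineD(2)[OF k] in auto)
      qed
    qed measurable
    also have "\<dots> = (LBINT x. 2 * (k x * ?C n x)) + (LBINT x. 1 / (of_real pi * \<i>) * (k x * ?d n x))"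
      by (intro Bochner_Integration.integral_add integrable_mult_right L2_Cauchy_Schwarz k' ds cauchy_int_bound null_seq f')
    finally show ?thesis unfolding integral_mult_right_zero .
  qed
  moreover have "(LBINT x. k x * wboundary \<alpha> f x) = 2 * (LBINT x. k x * boundary f x) + 1 / (of_real pi * \<i>) * (LBINT x. k x * weight_int \<alpha> f x)"
  proof -
    have "(LBINT x. k x * wboundary \<alpha> f x) = (LBINT x. 2 * (k x * boundary f x) + 1 / (of_real pi * \<i>) * (k x * weight_int \<alpha> f x))"
    proof (rule Bochner_Integration.integral_cong[OF refl])
      fix x show "k x * wboundary \<alpha> f x = 2 * (k x * boundary f x) + 1 / (of_real pi * \<i>) * (k x * weight_int \<alpha> f x)"
        using half_lineD(2)[OF k, of x] by (cases "x > 0") (simp_all add: wboundary_def distrib_left)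
    qed
    also have "\<dots> = (LBINT x. 2 * (k x * boundary f x)) + (LBINT x. 1 / (of_real pi * \<i>) * (k x * weight_int \<alpha> f x))"
      by (intro Bochner_Integration.integral_add integrable_mult_right L2_Cauchy_Schwarz k' boundary weight_int_bound[OF \<alpha>] f')
    finally show ?thesis unfolding integral_mult_right_zero .
  qed
  ultimately show ?thesis
    using tendsto_add[OF tendsto_mult_left[OF 1, of 2] tendsto_mult_left[OF 2, of "1 / (of_real pi * \<i>)"]] by simp
qed

text \<open>Off the excluded interval t^(-\<alpha>)/(t - x) is x^(-\<alpha>) times the sum of 1/(t -
  x) and \<open>weight_kernel\<close>. Plemelj's formula handles the first term and dominated
  convergence the second.\<close>

lemma weighted_principal_value:
  assumes \<alpha>: "\<bar>Re \<alpha>\<bar> < 1/2" and f: "half_line f"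
  shows "AE x in lborel. 0 < x \<longrightarrow> (\<forall>\<epsilon>>0. integrable lborel (\<lambda>t. truncated_kernel \<epsilon> x t * (cpow (- \<alpha>) t * f t))) \<and>
    ((\<lambda>\<epsilon>. cpow \<alpha> x * (LBINT t. truncated_kernel \<epsilon> x t * (cpow (- \<alpha>) t * f t)))
      \<longlongrightarrow> of_real pi * \<i> * (wboundary \<alpha> f x - f x)) (at_right 0)"
  using weight_int_AE_integrable[OF \<alpha> half_lineD(1)[OF f]] boundary(5)[OF half_lineD(1)[OF f]]
proof eventually_elim
  case (elim x)
  note f' = half_lineD(1)[OF f]
  have [measurable]: "f \<in> borel_measurable borel" using half_lineD(1)[OF f] by (simp add: sq_integrable_def)
  have [measurable]: "weight_kernel \<alpha> x \<in> borel_measurable borel" unfolding weight_kernel_def by measurable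
  show ?case
  proof
    assume x: "0 < x"
    let ?c = "\<lambda>\<epsilon> t. if \<epsilon> < \<bar>t - x\<bar> then weight_kernel \<alpha> x t * f t else 0"
    have split: "truncated_kernel \<epsilon> x t * (cpow (- \<alpha>) t * f t) = cpow (- \<alpha>) x * (truncated_kernel \<epsilon> x t * f t + ?c \<epsilon> t)"
      if "\<epsilon> > 0" for \<epsilon> t
    proof (cases "t > 0 \<and> \<epsilon> < \<bar>t - x\<bar>")
      case True
      define D where "D = complex_of_real (t - x)"
      have "truncated_kernel \<epsilon> x t * f t + ?c \<epsilon> t = (1 / D + (cpow \<alpha> x * cpow (- \<alpha>) t - 1) / D) * f t"
        using True x by (simp add: truncated_kernel_def weight_kernel_def D_def distrib_right del: of_real_diff)
      also have "\<dots> = cpow \<alpha> x * cpow (- \<alpha>) t / D * f t" by (simp add: diff_divide_distrib)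
      finally have "cpow (- \<alpha>) x * (truncated_kernel \<epsilon> x t * f t + ?c \<epsilon> t) = (cpow \<alpha> x * cpow (- \<alpha>) x) * (cpow (- \<alpha>) t / D * f t)"
        by (simp add: mult_ac)
      then show ?thesis using True by (simp add: cpow_minus truncated_kernel_def D_def mult_ac del: of_real_diff)
    qed (use half_lineD(2)[OF f, of t] in \<open>auto simp: truncated_kernel_def\<close>)
    have ci: "integrable lborel (?c \<epsilon>)" for \<epsilon>
      by (rule Bochner_Integration.integrable_bound[OF elim(1)]) auto
    have ti: "integrable lborel (\<lambda>t. truncated_kernel \<epsilon> x t * f t)" if "\<epsilon> > 0" for \<epsilon>
    proof (intro L2_Cauchy_Schwarz f')
      have "truncated_kernel \<epsilon> x = (\<lambda>t. 2 * of_real pi * \<i> * cauchy_kernel \<epsilon> x t - (2 * of_real pi * \<i> * cauchy_kernel \<epsilon> x t - truncated_kernel \<epsilon> x t))"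
        by auto
      moreover have "sq_integrable (\<lambda>t. 2 * of_real pi * \<i> * cauchy_kernel \<epsilon> x t - truncated_kernel \<epsilon> x t)"
        by (rule sq_integrable_mono[OF sq_integrable_cmult[OF poisson_kernel_sq_integrable[OF that], of "of_real (2 * pi)" x]])
           (use truncated_kernel_diff[OF that, of x] poisson_kernel_nonneg[of \<epsilon> x] that in \<open>auto simp: norm_mult\<close>)
      ultimately show "sq_integrable (truncated_kernel \<epsilon> x)"
        using sq_integrable_diff[OF sq_integrable_cmult[OF cauchy_kernel_sq_integrable(1)[OF that, of x], of "2 * of_real pi * \<i>"]] by metis
    qed
    have c1: "((\<lambda>\<epsilon>. LBINT t. ?c \<epsilon> t) \<longlongrightarrow> (LBINT t. weight_kernel \<alpha> x t * f t)) (at_right 0)"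
    proof (rule at_right_dominated_convergence[OF _ _ integrable_norm[OF elim(1)]])
      have "AE t in lborel. t \<noteq> x" by (rule AE_lborel_singleton)
      then show "AE t in lborel. ((\<lambda>\<epsilon>. ?c \<epsilon> t) \<longlongrightarrow> weight_kernel \<alpha> x t * f t) (at_right 0)"
      proof eventually_elim
        case (elim t)
        have "\<forall>\<^sub>F \<epsilon> in at_right 0. \<epsilon> < \<bar>t - x\<bar>"
          using elim eventually_at_right_field[of _ "0::real"] by (auto intro!: exI[of _ "\<bar>t - x\<bar>"])
        then show ?case by (rule tendsto_eventually[OF eventually_mono]) simp
      qed
    qed auto
    have I: "cpow \<alpha> x * (LBINT t. truncated_kernel \<epsilon> x t * (cpow (- \<alpha>) t * f t)) = (LBINT t. truncated_kernel \<epsilon> x t * f t) + (LBINT t. ?c \<epsilon> t)"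
      if "\<epsilon> > 0" for \<epsilon>
    proof -
      have "(LBINT t. truncated_kernel \<epsilon> x t * (cpow (- \<alpha>) t * f t)) = (LBINT t. cpow (- \<alpha>) x * (truncated_kernel \<epsilon> x t * f t + ?c \<epsilon> t))"
        by (rule Bochner_Integration.integral_cong[OF refl split[OF that]])
      also have "\<dots> = cpow (- \<alpha>) x * ((LBINT t. truncated_kernel \<epsilon> x t * f t) + (LBINT t. ?c \<epsilon> t))"
        unfolding integral_mult_right_zero by (rule arg_cong[OF Bochner_Integration.integral_add[OF ti[OF that] ci]])
      finally show ?thesis by (simp add: mult.assoc[symmetric] cpow_minus)
    qed
    have "((\<lambda>\<epsilon>. (LBINT t. truncated_kernel \<epsilon> x t * f t) + (LBINT t. ?c \<epsilon> t)) \<longlongrightarrow> of_real pi * \<i> * (2 * boundary f x - f x) + (LBINT t. weight_kernel \<alpha> x t * f t)) (at_right 0)"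
      by (intro tendsto_add elim(2) c1)
    moreover have "\<forall>\<^sub>F \<epsilon> in at_right 0. (LBINT t. truncated_kernel \<epsilon> x t * f t) + (LBINT t. ?c \<epsilon> t) = cpow \<alpha> x * (LBINT t. truncated_kernel \<epsilon> x t * (cpow (- \<alpha>) t * f t))"
      using eventually_at_right_less[of "0::real"] by eventually_elim (rule I[symmetric])
    ultimately have "((\<lambda>\<epsilon>. cpow \<alpha> x * (LBINT t. truncated_kernel \<epsilon> x t * (cpow (- \<alpha>) t * f t))) \<longlongrightarrow>
        of_real pi * \<i> * (2 * boundary f x - f x) + (LBINT t. weight_kernel \<alpha> x t * f t)) (at_right 0)"
      by (rule Lim_transform_eventually)
    moreover have "of_real pi * \<i> * (2 * boundary f x - f x) + (LBINT t. weight_kernel \<alpha> x t * f t) = of_real pi * \<i> * (wboundary \<alpha> f x - f x)"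
      using x by (simp add: wboundary_def weight_int_def distrib_left right_diff_distrib)
    moreover have "integrable lborel (\<lambda>t. truncated_kernel \<epsilon> x t * (cpow (- \<alpha>) t * f t))" if "\<epsilon> > 0" for \<epsilon>
      unfolding split[OF that] by (intro integrable_mult_right Bochner_Integration.integrable_add ti[OF that] ci)
    ultimately show "(\<forall>\<epsilon>>0. integrable lborel (\<lambda>t. truncated_kernel \<epsilon> x t * (cpow (- \<alpha>) t * f t))) \<and>
      ((\<lambda>\<epsilon>. cpow \<alpha> x * (LBINT t. truncated_kernel \<epsilon> x t * (cpow (- \<alpha>) t * f t))) \<longlongrightarrow> of_real pi * \<i> * (wboundary \<alpha> f x - f x)) (at_right 0)"
      by simp
  qed
qed

subsection \<open>A contour integral\<close>

definition pole_kernel :: "complex \<Rightarrow> complex \<Rightarrow> real \<Rightarrow> complex" where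
  "pole_kernel \<beta> z s = (if 0 < s then cpow \<beta> s / (of_real s - z) else 0)"

lemma pole_kernel_measurable [measurable]: "pole_kernel \<beta> z \<in> borel_measurable borel"
  unfolding pole_kernel_def by measurable

text \<open>Near 0 the square behaves like s^(2b), near infinity like s^(2b-2), where b = Re
  \<beta>; both are integrable since |b| < 1/2.\<close>

lemma pole_kernel_half_line:
  assumes \<beta>: "\<bar>Re \<beta>\<bar> < 1/2" and z: "Im z \<noteq> 0"
  shows "half_line (pole_kernel \<beta> z)"
proof -
  obtain C where C: "C > 0" "\<And>s. 1 + s\<^sup>2 \<le> C * (cmod (of_real s - z))\<^sup>2"
    using one_plus_square_le[OF z] by blast
  define b where "b = Re \<beta>"
  have le: "ennreal ((cmod (pole_kernel \<beta> z s))\<^sup>2) \<le> ennreal C * (ennreal (s powr (2 * b)) * indicator {0..1} s)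
      + ennreal C * (ennreal (s powr (2 * b - 2)) * indicator {1..} s)" for s
  proof (cases "s > 0")
    case True
    have nz: "of_real s - z \<noteq> 0" using z by auto
    have p: "(s powr b)\<^sup>2 = s powr (2 * b)" unfolding power2_eq_square powr_add[symmetric] by simp
    have sq: "(cmod (pole_kernel \<beta> z s))\<^sup>2 = s powr (2 * b) / (cmod (of_real s - z))\<^sup>2"
      using True by (simp add: pole_kernel_def norm_divide cmod_cpow power_divide p b_def[symmetric])
    have D: "(cmod (of_real s - z))\<^sup>2 > 0" using nz by simp
    have "1 / (cmod (of_real s - z))\<^sup>2 \<le> C / (1 + s\<^sup>2)"
      using C(2)[of s] D by (simp add: divide_simps add_pos_nonneg mult.commute)
    then have le: "(cmod (pole_kernel \<beta> z s))\<^sup>2 \<le> s powr (2 * b) * (C / (1 + s\<^sup>2))"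
      unfolding sq using mult_left_mono[of "1 / (cmod (of_real s - z))\<^sup>2" "C / (1 + s\<^sup>2)" "s powr (2 * b)"] by simp
    show ?thesis
    proof (cases "s \<le> 1")
      case True
      have "C / (1 + s\<^sup>2) \<le> C" using C(1) by (simp add: divide_le_eq add_pos_nonneg)
      then have "(cmod (pole_kernel \<beta> z s))\<^sup>2 \<le> C * s powr (2 * b)"
        using order_trans[OF le mult_left_mono[of "C / (1 + s\<^sup>2)" C "s powr (2 * b)"]] by (simp add: mult.commute)
      then have "ennreal ((cmod (pole_kernel \<beta> z s))\<^sup>2) \<le> ennreal C * (ennreal (s powr (2 * b)) * indicator {0..1} s)"
        using True \<open>s > 0\<close> C(1) by (simp add: ennreal_mult[symmetric] ennreal_leI)
      then show ?thesis by (simp add: add_increasing2)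
    next
      case False
      have "C / (1 + s\<^sup>2) \<le> C / s\<^sup>2" using C(1) \<open>s > 0\<close> by (intro divide_left_mono) (auto intro!: mult_pos_pos add_pos_nonneg)
      moreover have "s powr (2 * b) * (C / s\<^sup>2) = C * s powr (2 * b - 2)" using \<open>s > 0\<close> by (simp add: powr_diff powr_numeral)
      ultimately have "(cmod (pole_kernel \<beta> z s))\<^sup>2 \<le> C * s powr (2 * b - 2)"
        using order_trans[OF le mult_left_mono[of "C / (1 + s\<^sup>2)" "C / s\<^sup>2" "s powr (2 * b)"]] by simp
      then have "ennreal ((cmod (pole_kernel \<beta> z s))\<^sup>2) \<le> ennreal C * (ennreal (s powr (2 * b - 2)) * indicator {1..} s)"
        using False C(1) by (simp add: ennreal_mult[symmetric] ennreal_leI)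
      then show ?thesis by (simp add: add_increasing)
    qed
  qed (simp add: pole_kernel_def)
  have "(\<integral>\<^sup>+s. ennreal ((cmod (pole_kernel \<beta> z s))\<^sup>2) \<partial>lborel) \<le> (\<integral>\<^sup>+s. ennreal C * (ennreal (s powr (2 * b)) * indicator {0..1} s)
      + ennreal C * (ennreal (s powr (2 * b - 2)) * indicator {1..} s) \<partial>lborel)"
    by (intro nn_integral_mono le)
  also have "\<dots> = ennreal C * (\<integral>\<^sup>+s. ennreal (s powr (2 * b)) * indicator {0..1} s \<partial>lborel)
      + ennreal C * (\<integral>\<^sup>+s. ennreal (s powr (2 * b - 2)) * indicator {1..} s \<partial>lborel)"
    by (subst nn_integral_add, measurable) (simp add: nn_integral_cmult)
  also have "\<dots> < \<infinity>"
    using nn_integral_powr_from_0[of "2 * b" 1] nn_integral_powr_to_inf[of "2 * b - 2" 1] \<beta> 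
    by (simp add: b_def ennreal_mult_less_top)
  finally have "sq_integrable (pole_kernel \<beta> z)"
    by (intro sq_integrableI_finite) auto
  then show ?thesis by (auto simp: half_line_def pole_kernel_def)
qed

lemma pole_kernel_product:
  "pole_kernel \<beta> z s * pole_kernel \<gamma> w s = (if 0 < s then cpow (\<beta> + \<gamma>) s / ((of_real s - z) * (of_real s - w)) else 0)"
  by (simp add: pole_kernel_def cpow_add)

text \<open>Giving half of the exponent to each pole makes both factors square-integrable under the
  condition |Re \<gamma>| < 1.\<close>

lemma integrable_power_two_poles:
  assumes "\<bar>Re \<gamma>\<bar> < 1" "Im z \<noteq> 0" "Im w \<noteq> 0"
  shows "integrable lborel (\<lambda>s. if 0 < s then cpow \<gamma> s / ((of_real s - z) * (of_real s - w)) else 0)"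
proof -
  have "integrable lborel (\<lambda>s. pole_kernel (\<gamma>/2) z s * pole_kernel (\<gamma>/2) w s)"
    using assms by (intro L2_Cauchy_Schwarz half_lineD(1)[OF pole_kernel_half_line]) auto
  moreover have h: "\<gamma> / 2 + \<gamma> / 2 = \<gamma>" by simp
  ultimately show ?thesis unfolding pole_kernel_product h by simp
qed

locale strip_poles =
  fixes \<gamma> L M :: complex
  assumes \<gamma>: "\<bar>Re \<gamma>\<bar> < 1" and L: "0 < Im L" "Im L < 2 * pi" and M: "0 < Im M" "Im M < 2 * pi"
    and ne: "exp L \<noteq> exp M"
begin

text \<open>The additional 1 in the exponent is the Jacobian of s = exp u.\<close>

definition G :: "complex \<Rightarrow> complex" where
  "G u = exp ((\<gamma> + 1) * u) / ((exp u - exp L) * (exp u - exp M))"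

text \<open>Half the smallest distance of L and M from the edges of the strip. The closed strip can
  be enlarged by this margin to an open set without admitting a translate of L or M by a multiple of
  2 \<pi> i.\<close>

definition \<eta> :: real where "\<eta> = min (min (Im L) (2 * pi - Im L)) (min (Im M) (2 * pi - Im M)) / 2"

definition S :: "complex set" where "S = {u. - \<eta> < Im u \<and> Im u < 2 * pi + \<eta>}"

lemma \<eta>: "0 < \<eta>" "\<eta> < Im L" "\<eta> < 2 * pi - Im L" "\<eta> < Im M" "\<eta> < 2 * pi - Im M"
  using L M by (auto simp: \<eta>_def min_def)

lemma open_S: "open S" and convex_S: "convex S"
proof -
  have "S = {u. - \<eta> < Im u} \<inter> {u. Im u < 2 * pi + \<eta>}" by (auto simp: S_def)
  then show "open S" "convex S"
    by (auto intro!: open_Int open_halfspace_Im_gt open_halfspace_Im_lt convex_Int convex_halfspace_Im_gt convex_halfspace_Im_lt)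
qed

lemma exp_eq_in_S:
  assumes "u \<in> S" "exp u = exp P" "\<eta> < Im P" "\<eta> < 2 * pi - Im P"
  shows "u = P"
proof -
  obtain n :: int where n: "u = P + (of_int (2 * n) * pi) * \<i>" using assms(2) by (auto simp: exp_eq)
  then have "Im u = Im P + 2 * real_of_int n * pi" by simp
  then have "2 * real_of_int n * pi < 2 * pi" "- (2 * pi) < 2 * real_of_int n * pi"
    using assms unfolding S_def mem_Collect_eq by linarith+
  then have "real_of_int n * pi < 1 * pi" "(-1) * pi < real_of_int n * pi" by linarith+
  then have "real_of_int n < 1" "-1 < real_of_int n"
    by (simp_all only: mult_less_cancel_right_pos[OF pi_gt_zero])
  then have "n = 0" by linarith
  then show ?thesis using n by simp
qed

lemma LM_in_S: "L \<in> S" "M \<in> S" "L \<noteq> M"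
  using L M \<eta> ne by (auto simp: S_def)

lemma denominator_nonzero: "u \<in> S - {L, M} \<Longrightarrow> (exp u - exp L) * (exp u - exp M) \<noteq> 0"
  using exp_eq_in_S[of u L] exp_eq_in_S[of u M] \<eta> by auto

lemma G_holomorphic: "G holomorphic_on S - {L, M}"
  unfolding G_def using denominator_nonzero by (intro holomorphic_intros) blast

lemma residue_G: "residue G L = exp (\<gamma> * L) / (exp L - exp M)" "residue G M = exp (\<gamma> * M) / (exp M - exp L)"
proof -
  have d: "((\<lambda>u. (exp u - exp L) * (exp u - exp M)) has_field_derivative exp L * (exp L - exp M)) (at L)"
    "((\<lambda>u. (exp u - exp L) * (exp u - exp M)) has_field_derivative exp M * (exp M - exp L)) (at M)"
    by (auto intro!: derivative_eq_intros)
  have "residue G L = exp ((\<gamma> + 1) * L) / (exp L * (exp L - exp M))"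
    unfolding G_def
    by (rule residue_simple_pole_deriv[OF _ _ open_S convex_connected[OF convex_S] LM_in_S(1) d(1)])
       (use ne in \<open>auto intro!: holomorphic_intros\<close>)
  then show "residue G L = exp (\<gamma> * L) / (exp L - exp M)" by (simp add: distrib_right exp_add)
  have "residue G M = exp ((\<gamma> + 1) * M) / (exp M * (exp M - exp L))"
    unfolding G_def
    by (rule residue_simple_pole_deriv[OF _ _ open_S convex_connected[OF convex_S] LM_in_S(2) d(2)])
       (use ne in \<open>auto intro!: holomorphic_intros\<close>)
  then show "residue G M = exp (\<gamma> * M) / (exp M - exp L)" by (simp add: distrib_right exp_add)
qed

text \<open>Quasi-periodicity: the upper edge of the rectangle contributes a multiple of the lower
  edge, which is the source of the factor 1 - exp(2 \<pi> i \<gamma>).\<close>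

lemma G_shift: "G (u + 2 * of_real pi * \<i>) = exp (2 * of_real pi * \<i> * \<gamma>) * G u"
proof -
  have "exp (u + 2 * of_real pi * \<i>) = exp u" by (simp add: exp_add)
  moreover have "exp ((\<gamma> + 1) * (u + 2 * of_real pi * \<i>)) = exp ((\<gamma> + 1) * u) * exp (2 * of_real pi * \<i> * \<gamma>) * exp (2 * of_real pi * \<i>)"
  proof -
    have "(\<gamma> + 1) * (u + 2 * of_real pi * \<i>) = (\<gamma> + 1) * u + 2 * of_real pi * \<i> * \<gamma> + 2 * of_real pi * \<i>"
      by (simp add: algebra_simps)
    then show ?thesis by (simp only: exp_add)
  qed
  ultimately show ?thesis by (simp add: G_def)
qed

lemma rectangle:
  assumes R: "\<bar>Re L\<bar> < R" "\<bar>Re M\<bar> < R"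
  shows "(1 - exp (2 * of_real pi * \<i> * \<gamma>)) * integral {-R..R} (\<lambda>u. G (of_real u))
    + contour_integral (linepath (Complex R 0) (Complex R (2 * pi))) G
    - contour_integral (linepath (Complex (-R) 0) (Complex (-R) (2 * pi))) G
    = 2 * of_real pi * \<i> * ((exp (\<gamma> * L) - exp (\<gamma> * M)) / (exp L - exp M))"
proof -
  define q where "q = exp (2 * of_real pi * \<i> * \<gamma>)"
  define a1 a2 a3 a4 where "a1 = Complex (-R) 0" and "a2 = Complex R 0" and "a3 = Complex R (2 * pi)" and "a4 = Complex (-R) (2 * pi)"
  have R0: "R > 0" using R by linarith
  have rect: "rectpath a1 a3 = linepath a1 a2 +++ linepath a2 a3 +++ linepath a3 a4 +++ linepath a4 a1"
    by (simp add: rectpath_def a1_def a2_def a3_def a4_def Let_def)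
  have cb: "cbox a1 a3 \<subseteq> S" using \<eta>(1) by (auto simp: in_cbox_complex_iff a1_def a3_def S_def)
  have pim: "path_image (rectpath a1 a3) \<subseteq> S - {L, M}"
  proof -
    have "path_image (rectpath a1 a3) \<subseteq> cbox a1 a3"
      using R0 by (intro path_image_rectpath_subset_cbox) (auto simp: a1_def a3_def)
    moreover have "L \<notin> path_image (rectpath a1 a3)" "M \<notin> path_image (rectpath a1 a3)"
      using R0 R L M by (subst path_image_rectpath; auto simp: a1_def a3_def)+
    ultimately show ?thesis using cb by blast
  qed
  have w: "winding_number (rectpath a1 a3) L = 1" "winding_number (rectpath a1 a3) M = 1"
    using R L M by (intro winding_number_rectpath; auto simp: in_box_complex_iff a1_def a3_def)+
  have "contour_integral (rectpath a1 a3) G = 2 * pi * \<i> * (\<Sum>p\<in>{L, M}. winding_number (rectpath a1 a3) p * residue G p)"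
  proof (rule Residue_theorem[OF open_S convex_connected[OF convex_S] _ G_holomorphic])
    show "\<forall>z. z \<notin> S \<longrightarrow> winding_number (rectpath a1 a3) z = 0"
      using cb R0 by (intro allI impI winding_number_rectpath_outside) (auto simp: a1_def a3_def)
  qed (use pim in auto)
  also have "\<dots> = 2 * of_real pi * \<i> * (exp (\<gamma> * L) / (exp L - exp M) + exp (\<gamma> * M) / (exp M - exp L))"
    using LM_in_S(3) by (simp add: w residue_G)
  also have "exp (\<gamma> * L) / (exp L - exp M) + exp (\<gamma> * M) / (exp M - exp L) = (exp (\<gamma> * L) - exp (\<gamma> * M)) / (exp L - exp M)"
    using minus_divide_right[of "exp (\<gamma> * M)" "exp L - exp M"] by (simp add: diff_divide_distrib)
  finally have res: "contour_integral (rectpath a1 a3) G = 2 * of_real pi * \<i> * ((exp (\<gamma> * L) - exp (\<gamma> * M)) / (exp L - exp M))" .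
  have seg: "closed_segment a1 a2 \<subseteq> S - {L, M}" "closed_segment a2 a3 \<subseteq> S - {L, M}" "closed_segment a3 a4 \<subseteq> S - {L, M}" "closed_segment a4 a1 \<subseteq> S - {L, M}"
    using pim unfolding rect by (auto simp: path_image_join)
  have ci: "G contour_integrable_on linepath a1 a2" "G contour_integrable_on linepath a2 a3"
    "G contour_integrable_on linepath a3 a4" "G contour_integrable_on linepath a4 a1"
    using seg by (auto intro!: contour_integrable_continuous_linepath holomorphic_on_imp_continuous_on
        intro: holomorphic_on_subset[OF G_holomorphic])
  have bottom: "contour_integral (linepath a1 a2) G = integral {-R..R} (\<lambda>u. G (of_real u))"
    using R0 by (subst contour_integral_linepath_Reals_eq) (auto simp: a1_def a2_def complex_is_Real_iff)
  have "(G has_contour_integral q * contour_integral (linepath a1 a2) G) (linepath a4 a3)"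
  proof -
    have "((\<lambda>x. q * (G (linepath a1 a2 x) * (a2 - a1))) has_integral q * contour_integral (linepath a1 a2) G) {0..1}"
      using has_contour_integral_integral[OF ci(1)] unfolding has_contour_integral_linepath by (rule has_integral_mult_right)
    moreover have "q * (G (linepath a1 a2 x) * (a2 - a1)) = G (linepath a4 a3 x) * (a3 - a4)" for x
    proof -
      have "linepath a4 a3 x = linepath a1 a2 x + 2 * of_real pi * \<i>" "a3 - a4 = a2 - a1"
        by (auto simp: linepath_def a1_def a2_def a3_def a4_def complex_eq_iff algebra_simps)
      then show ?thesis by (simp add: G_shift q_def)
    qed
    ultimately show ?thesis by (simp add: has_contour_integral_linepath)
  qed
  then have top: "contour_integral (linepath a4 a3) G = q * contour_integral (linepath a1 a2) G"
    by (rule contour_integral_unique)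
  have "contour_integral (rectpath a1 a3) G = contour_integral (linepath a1 a2) G + contour_integral (linepath a2 a3) G
      + contour_integral (linepath a3 a4) G + contour_integral (linepath a4 a1) G"
    unfolding rect using ci by (simp add: contour_integrable_joinI)
  also have "\<dots> = contour_integral (linepath a1 a2) G + contour_integral (linepath a2 a3) G
      - contour_integral (linepath a4 a3) G - contour_integral (linepath a1 a4) G"
    using contour_integral_reverse_linepath[of a3 a4 G] contour_integral_reverse_linepath[of a4 a1 G] seg
    by (simp add: closed_segment_commute holomorphic_on_imp_continuous_on[OF holomorphic_on_subset[OF G_holomorphic]])
  finally show ?thesis
    unfolding res[symmetric] top bottom q_def[symmetric] by (simp add: a1_def a2_def a3_def a4_def algebra_simps)
qed

lemma vertical_bound:
  assumes R: "\<bar>Re L\<bar> < \<bar>x\<bar>" "\<bar>Re M\<bar> < \<bar>x\<bar>"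
    and B: "\<And>u. Re u = x \<Longrightarrow> 0 \<le> Im u \<Longrightarrow> Im u \<le> 2 * pi \<Longrightarrow> cmod (G u) \<le> B"
  shows "cmod (contour_integral (linepath (Complex x 0) (Complex x (2 * pi))) G) \<le> B * (2 * pi)"
proof -
  have seg: "u \<in> S - {L, M} \<and> Re u = x \<and> 0 \<le> Im u \<and> Im u \<le> 2 * pi" if "u \<in> closed_segment (Complex x 0) (Complex x (2 * pi))" for u
    using that R \<eta>(1) by (subst (asm) closed_segment_same_Re) (auto simp: closed_segment_eq_real_ivl S_def)
  have "cmod (contour_integral (linepath (Complex x 0) (Complex x (2 * pi))) G) \<le> B * cmod (Complex x (2 * pi) - Complex x 0)"
  proof (rule contour_integral_bound_linepath)
    show "G contour_integrable_on linepath (Complex x 0) (Complex x (2 * pi))"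
      using seg by (intro contour_integrable_continuous_linepath holomorphic_on_imp_continuous_on holomorphic_on_subset[OF G_holomorphic]) blast
    show "0 \<le> B" using order_trans[OF norm_ge_zero B[of "Complex x 0"]] by simp
    show "cmod (G u) \<le> B" if "u \<in> closed_segment (Complex x 0) (Complex x (2 * pi))" for u
      using seg[OF that] by (intro B) auto
  qed
  also have "cmod (Complex x (2 * pi) - Complex x 0) = 2 * pi" by (simp add: cmod_def real_sqrt_mult)
  finally show ?thesis .
qed

lemma G_numerator:
  assumes "0 \<le> Im u" "Im u \<le> 2 * pi"
  shows "cmod (exp ((\<gamma> + 1) * u)) \<le> exp ((Re \<gamma> + 1) * Re u) * exp (\<bar>Im \<gamma>\<bar> * (2 * pi))"
proof -
  have "- (Im \<gamma> * Im u) \<le> \<bar>Im \<gamma>\<bar> * (2 * pi)"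
    using abs_ge_minus_self[of "Im \<gamma> * Im u"] mult_left_mono[of "Im u" "2 * pi" "\<bar>Im \<gamma>\<bar>"] assms by (simp add: abs_mult)
  then show ?thesis by (simp add: exp_add[symmetric])
qed

text \<open>The numerator has size exp((Re \<gamma> + 1) R) and the denominator exp(2R), so the edge
  vanishes because Re \<gamma> < 1.\<close>

lemma vertical_right:
  "(\<lambda>n. contour_integral (linepath (Complex (real n) 0) (Complex (real n) (2 * pi))) G) \<longlonglongrightarrow> 0"
proof (rule Lim_null_comparison)
  define K where "K = exp (\<bar>Im \<gamma>\<bar> * (2 * pi))"
  let ?B = "\<lambda>x. 4 * K * exp ((Re \<gamma> - 1) * x)"
  \<comment> \<open>One unit beyond Re P suffices: as exp 1 is at least 2, exp P is then at most
    half of exp u in modulus. The absolute values keep both poles off the edge.\<close>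
  have ev: "\<forall>\<^sub>F n in sequentially. real n > max (max \<bar>Re L\<bar> \<bar>Re M\<bar>) (max (Re L + 1) (Re M + 1))"
    by (rule eventually_compose_filterlim[OF eventually_gt_at_top filterlim_real_sequentially])
  show "\<forall>\<^sub>F n in sequentially. cmod (contour_integral (linepath (Complex (real n) 0) (Complex (real n) (2 * pi))) G) \<le> ?B (real n) * (2 * pi)"
    using ev
  proof eventually_elim
    case (elim n)
    show ?case
    proof (rule vertical_bound)
      fix u assume u: "Re u = real n" "0 \<le> Im u" "Im u \<le> 2 * pi"
      have half: "exp (real n) / 2 \<le> cmod (exp u - exp P)" if "Re P + 1 < real n" for P
      proof -
        have "2 * exp (Re P) \<le> exp 1 * exp (Re P)" using exp_ge_add_one_self[of 1] by (intro mult_right_mono) auto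
        also have "\<dots> \<le> exp (real n)" using that by (simp add: exp_add[symmetric])
        finally have "exp (Re P) \<le> exp (real n) / 2" by simp
        then show ?thesis using norm_triangle_ineq2[of "exp u" "exp P"] u by simp
      qed
      have "cmod (G u) \<le> (exp ((Re \<gamma> + 1) * real n) * K) / ((exp (real n) / 2) * (exp (real n) / 2))"
        unfolding G_def norm_divide norm_mult K_def
        using G_numerator[OF u(2,3)] u(1) half[of L] half[of M] elim by (intro frac_le mult_mono) auto
      also have "\<dots> = 4 * K * (exp ((Re \<gamma> + 1) * real n) / (exp (real n) * exp (real n)))" by simp
      also have "exp ((Re \<gamma> + 1) * real n) / (exp (real n) * exp (real n)) = exp ((Re \<gamma> - 1) * real n)"
        by (simp add: exp_add[symmetric] exp_diff[symmetric] algebra_simps)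
      finally show "cmod (G u) \<le> ?B (real n)" .
    qed (use elim in auto)
  qed
  have "((\<lambda>x. ?B x * (2 * pi)) \<longlongrightarrow> 0) at_top" using \<gamma> by real_asymp
  then show "(\<lambda>n. ?B (real n) * (2 * pi)) \<longlonglongrightarrow> 0"
    by (rule filterlim_compose[OF _ filterlim_real_sequentially])
qed

text \<open>On this side exp u tends to 0, so the denominator stays away from 0 and the numerator
  decays because Re \<gamma> > -1.\<close>

lemma vertical_left:
  "(\<lambda>n. contour_integral (linepath (Complex (- real n) 0) (Complex (- real n) (2 * pi))) G) \<longlonglongrightarrow> 0"
proof (rule Lim_null_comparison)
  define K where "K = exp (\<bar>Im \<gamma>\<bar> * (2 * pi))"
  define E where "E = (exp (Re L) / 2) * (exp (Re M) / 2)"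
  let ?B = "\<lambda>x. K / E * exp (- ((Re \<gamma> + 1) * x))"
  have ev: "\<forall>\<^sub>F n in sequentially. real n > max (max \<bar>Re L\<bar> \<bar>Re M\<bar>) (max (1 - Re L) (1 - Re M))"
    by (rule eventually_compose_filterlim[OF eventually_gt_at_top filterlim_real_sequentially])
  show "\<forall>\<^sub>F n in sequentially. cmod (contour_integral (linepath (Complex (- real n) 0) (Complex (- real n) (2 * pi))) G) \<le> ?B (real n) * (2 * pi)"
    using ev
  proof eventually_elim
    case (elim n)
    show ?case
    proof (rule vertical_bound)
      fix u assume u: "Re u = - real n" "0 \<le> Im u" "Im u \<le> 2 * pi"
      have half: "exp (Re P) / 2 \<le> cmod (exp u - exp P)" if "1 - Re P < real n" for P
      proof -
        have "2 * exp (- real n) \<le> exp 1 * exp (- real n)" using exp_ge_add_one_self[of 1] by (intro mult_right_mono) auto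
        also have "\<dots> \<le> exp (Re P)" using that by (simp add: exp_add[symmetric])
        finally have "exp (- real n) \<le> exp (Re P) / 2" by simp
        then show ?thesis using norm_triangle_ineq2[of "exp P" "exp u"] u by (simp add: norm_minus_commute)
      qed
      have "cmod (G u) \<le> (exp ((Re \<gamma> + 1) * - real n) * K) / E"
        unfolding G_def norm_divide norm_mult K_def E_def
        using G_numerator[OF u(2,3)] u(1) half[of L] half[of M] elim by (intro frac_le mult_mono) auto
      then show "cmod (G u) \<le> ?B (real n)" by (simp add: mult.commute)
    qed (use elim in auto)
  qed
  have "((\<lambda>x. ?B x * (2 * pi)) \<longlongrightarrow> 0) at_top" using \<gamma> by real_asymp
  then show "(\<lambda>n. ?B (real n) * (2 * pi)) \<longlonglongrightarrow> 0"
    by (rule filterlim_compose[OF _ filterlim_real_sequentially])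
qed

lemma integral_power_two_poles:
  assumes Im: "Im (exp L) \<noteq> 0" "Im (exp M) \<noteq> 0"
  shows "(1 - exp (2 * of_real pi * \<i> * \<gamma>)) *
      (LBINT s. if 0 < s then cpow \<gamma> s / ((of_real s - exp L) * (of_real s - exp M)) else 0)
    = 2 * of_real pi * \<i> * ((exp (\<gamma> * L) - exp (\<gamma> * M)) / (exp L - exp M))"
proof -
  define F where "F s = (if 0 < s then cpow \<gamma> s / ((of_real s - exp L) * (of_real s - exp M)) else 0)" for s :: real
  have i: "integrable lborel F" unfolding F_def by (rule integrable_power_two_poles[OF \<gamma> Im])
  have nz: "of_real s - exp L \<noteq> 0" "of_real s - exp M \<noteq> 0" for s :: real using Im by (metis Im_complex_of_real eq_iff_diff_eq_0)+
  have A: "integral {-real n..real n} (\<lambda>u. G (of_real u)) = (LBINT s. indicator {exp (- real n)..exp (real n)} s *\<^sub>R F s)" for n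
  proof -
    have c: "continuous_on {exp (- real n)..exp (real n)} F"
    proof -
      have pos: "s > 0" if "s \<in> {exp (- real n)..exp (real n)}" for s using that exp_gt_zero[of "- real n"] by (metis atLeastAtMost_iff less_le_trans)
      have "continuous_on {exp (- real n)..exp (real n)} (\<lambda>s. cpow \<gamma> s / ((of_real s - exp L) * (of_real s - exp M)))"
        unfolding cpow_def using nz pos by (intro continuous_intros) (auto simp: less_imp_neq[OF pos, symmetric])
      then show ?thesis by (rule continuous_on_eq) (simp add: F_def pos)
    qed
    have "((\<lambda>u. exp u *\<^sub>R F (exp u)) has_integral (integral {exp (- real n)..exp (real n)} F)) {-real n..real n}"
      by (rule has_integral_substitution[OF _ _ _ c]) (auto intro!: derivative_eq_intros)
    moreover have "exp u *\<^sub>R F (exp u) = G (of_real u)" for u :: real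
    proof -
      have "exp ((\<gamma> + 1) * of_real u) = exp (of_real u) * exp (\<gamma> * of_real u)" by (simp add: distrib_right exp_add)
      then show ?thesis by (simp add: F_def G_def cpow_def scaleR_conv_of_real exp_of_real)
    qed
    ultimately have "integral {-real n..real n} (\<lambda>u. G (of_real u)) = integral {exp (- real n)..exp (real n)} F"
      by (simp add: integral_unique)
    also have "\<dots> = (LBINT s:{exp (- real n)..exp (real n)}. F s)"
      using borel_integrable_atLeastAtMost'[OF c] by (simp add: set_borel_integral_eq_integral)
    finally show ?thesis by (simp add: set_lebesgue_integral_def)
  qed
  \<comment> \<open>The edges at -n and n correspond to the limits exp(-n) and exp n in s; absolute
    integrability on the half-line lets these windows exhaust it.\<close>
  have "(\<lambda>n. LBINT s. indicator {exp (- real n)..exp (real n)} s *\<^sub>R F s) \<longlonglongrightarrow> (LBINT s. F s)"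
  proof (rule integral_dominated_convergence[OF _ _ integrable_norm[OF i]])
    show "AE s in lborel. (\<lambda>n. indicator {exp (- real n)..exp (real n)} s *\<^sub>R F s) \<longlonglongrightarrow> F s"
    proof (rule AE_I2)
      fix s :: real
      show "(\<lambda>n. indicator {exp (- real n)..exp (real n)} s *\<^sub>R F s) \<longlonglongrightarrow> F s"
      proof (cases "s > 0")
        case True
        have "\<forall>\<^sub>F n in sequentially. real n > \<bar>ln s\<bar>"
          by (rule eventually_compose_filterlim[OF eventually_gt_at_top filterlim_real_sequentially])
        then have "\<forall>\<^sub>F n in sequentially. indicator {exp (- real n)..exp (real n)} s *\<^sub>R F s = F s"
        proof eventually_elim
          case (elim n)
          then have "exp (- real n) \<le> exp (ln s)" "exp (ln s) \<le> exp (real n)" by auto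
          then show ?case using True by simp
        qed
        then show ?thesis by (rule tendsto_eventually)
      qed (simp add: F_def)
    qed
    show "AE s in lborel. cmod (indicator {exp (- real n)..exp (real n)} s *\<^sub>R F s) \<le> cmod (F s)" for n
      by (intro AE_I2) (auto simp: indicator_def)
  qed (use borel_measurable_integrable[OF i] in auto)
  then have "(\<lambda>n. (1 - exp (2 * of_real pi * \<i> * \<gamma>)) * integral {-real n..real n} (\<lambda>u. G (of_real u))
    + contour_integral (linepath (Complex (real n) 0) (Complex (real n) (2 * pi))) G
    - contour_integral (linepath (Complex (- real n) 0) (Complex (- real n) (2 * pi))) G) \<longlonglongrightarrow> (1 - exp (2 * of_real pi * \<i> * \<gamma>)) * (LBINT s. F s) + 0 - 0"
    unfolding A by (intro tendsto_diff tendsto_add tendsto_mult tendsto_const vertical_left vertical_right)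
  moreover have "\<forall>\<^sub>F n in sequentially. real n > max \<bar>Re L\<bar> \<bar>Re M\<bar>"
    by (rule eventually_compose_filterlim[OF eventually_gt_at_top filterlim_real_sequentially])
  then have "\<forall>\<^sub>F n in sequentially. (1 - exp (2 * of_real pi * \<i> * \<gamma>)) * integral {-real n..real n} (\<lambda>u. G (of_real u))
    + contour_integral (linepath (Complex (real n) 0) (Complex (real n) (2 * pi))) G
    - contour_integral (linepath (Complex (- real n) 0) (Complex (- real n) (2 * pi))) G = 2 * of_real pi * \<i> * ((exp (\<gamma> * L) - exp (\<gamma> * M)) / (exp L - exp M))"
    by eventually_elim (rule rectangle; simp)
  ultimately have "(\<lambda>n::nat. 2 * of_real pi * \<i> * ((exp (\<gamma> * L) - exp (\<gamma> * M)) / (exp L - exp M))) \<longlonglongrightarrow> (1 - exp (2 * of_real pi * \<i> * \<gamma>)) * (LBINT s. F s) + 0 - 0"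
    by (rule Lim_transform_eventually)
  then have "2 * of_real pi * \<i> * ((exp (\<gamma> * L) - exp (\<gamma> * M)) / (exp L - exp M)) = (1 - exp (2 * of_real pi * \<i> * \<gamma>)) * (LBINT s. F s) + 0 - 0"
    by (rule LIMSEQ_unique[OF tendsto_const])
  then show ?thesis by (simp add: F_def)
qed

end

subsection \<open>Composition of weighted boundary operators\<close>

lemma half_line_lin:
  assumes "half_line f" "half_line g"
  shows "half_line (\<lambda>t. a * f t + b * g t)"
  using assms by (auto simp: half_line_def intro!: sq_integrable_add sq_integrable_cmult)

lemma half_line_weight_integrable:
  assumes \<alpha>: "\<bar>Re \<alpha>\<bar> < 1/2" and f: "half_line f" and e: "\<epsilon> > 0"
  shows "integrable lborel (\<lambda>s. cauchy_kernel \<epsilon> x s * (cpow (- \<alpha>) s * f s))"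
    and "cauchy_int \<epsilon> (\<lambda>s. cpow (- \<alpha>) s * f s) x = 1 / (2 * of_real pi * \<i>) * (LBINT s. pole_kernel (- \<alpha>) (Complex x \<epsilon>) s * f s)"
proof -
  have eq: "cauchy_kernel \<epsilon> x s * (cpow (- \<alpha>) s * f s) = 1 / (2 * of_real pi * \<i>) * (pole_kernel (- \<alpha>) (Complex x \<epsilon>) s * f s)" for s
  proof (cases "s > 0")
    case True
    have "of_real (s - x) - \<i> * of_real \<epsilon> = of_real s - Complex x \<epsilon>" by (simp add: complex_eq_iff)
    then show ?thesis using True by (simp add: cauchy_kernel_def pole_kernel_def del: of_real_diff)
  qed (use half_lineD(2)[OF f] in auto)
  show "integrable lborel (\<lambda>s. cauchy_kernel \<epsilon> x s * (cpow (- \<alpha>) s * f s))"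
    unfolding eq using \<alpha> e by (intro integrable_mult_right L2_Cauchy_Schwarz half_lineD(1)[OF f] half_lineD(1)[OF pole_kernel_half_line]) auto
  show "cauchy_int \<epsilon> (\<lambda>s. cpow (- \<alpha>) s * f s) x = 1 / (2 * of_real pi * \<i>) * (LBINT s. pole_kernel (- \<alpha>) (Complex x \<epsilon>) s * f s)"
    unfolding cauchy_int_def eq by (rule integral_mult_right_zero)
qed

lemma wcauchy_pole_kernel:
  assumes \<alpha>: "\<bar>Re \<alpha>\<bar> < 1/2" and f: "half_line f" and e: "\<epsilon> > 0"
  shows "wcauchy \<alpha> \<epsilon> f x = 1 / (of_real pi * \<i>) * cpow \<alpha> x * (LBINT s. pole_kernel (- \<alpha>) (Complex x \<epsilon>) s * f s)"
  unfolding wcauchy_def half_line_weight_integrable(2)[OF assms] by simp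

text \<open>\<open>boundary\<close> is chosen for each function separately, so linearity is read off
  from \<open>wcauchy\<close>, which is linear exactly, by uniqueness of limits.\<close>

lemma wboundary_lin:
  assumes \<alpha>: "\<bar>Re \<alpha>\<bar> < 1/2" and f: "half_line f" and g: "half_line g"
  shows "AE x in lborel. wboundary \<alpha> (\<lambda>t. a * f t + b * g t) x = a * wboundary \<alpha> f x + b * wboundary \<alpha> g x"
  using wcauchy_tendsto[OF \<alpha> f] wcauchy_tendsto[OF \<alpha> g] wcauchy_tendsto[OF \<alpha> half_line_lin[OF f g, of a b]]
proof eventually_elim
  case (elim x)
  show ?case
  proof (cases "x > 0")
    case True
    have eq: "wcauchy \<alpha> \<epsilon> (\<lambda>t. a * f t + b * g t) x = a * wcauchy \<alpha> \<epsilon> f x + b * wcauchy \<alpha> \<epsilon> g x" if "\<epsilon> > 0" for \<epsilon>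
    proof -
      have "cauchy_int \<epsilon> (\<lambda>t. cpow (- \<alpha>) t * (a * f t + b * g t)) x
          = (LBINT t. a * (cauchy_kernel \<epsilon> x t * (cpow (- \<alpha>) t * f t)) + b * (cauchy_kernel \<epsilon> x t * (cpow (- \<alpha>) t * g t)))"
        unfolding cauchy_int_def by (intro Bochner_Integration.integral_cong refl) (simp add: algebra_simps)
      also have "\<dots> = a * cauchy_int \<epsilon> (\<lambda>t. cpow (- \<alpha>) t * f t) x + b * cauchy_int \<epsilon> (\<lambda>t. cpow (- \<alpha>) t * g t) x"
        using half_line_weight_integrable(1)[OF \<alpha> f that, of x] half_line_weight_integrable(1)[OF \<alpha> g that, of x]
        unfolding cauchy_int_def integral_mult_right_zero[symmetric]
        by (intro Bochner_Integration.integral_add integrable_mult_right)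
      finally show ?thesis by (simp add: wcauchy_def algebra_simps)
    qed
    have "((\<lambda>\<epsilon>. a * wcauchy \<alpha> \<epsilon> f x + b * wcauchy \<alpha> \<epsilon> g x) \<longlongrightarrow> a * wboundary \<alpha> f x + b * wboundary \<alpha> g x) (at_right 0)"
      using elim True by (intro tendsto_intros) auto
    moreover have "\<forall>\<^sub>F \<epsilon> in at_right 0. a * wcauchy \<alpha> \<epsilon> f x + b * wcauchy \<alpha> \<epsilon> g x = wcauchy \<alpha> \<epsilon> (\<lambda>t. a * f t + b * g t) x"
      using eventually_at_right_less[of "0::real"] by eventually_elim (rule eq[symmetric])
    ultimately have "((\<lambda>\<epsilon>. wcauchy \<alpha> \<epsilon> (\<lambda>t. a * f t + b * g t) x) \<longlongrightarrow> a * wboundary \<alpha> f x + b * wboundary \<alpha> g x) (at_right 0)"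
      by (rule Lim_transform_eventually)
    then show ?thesis using elim(3) True tendsto_unique[OF trivial_limit_at_right_real] by blast
  qed (simp add: wboundary_def)
qed

lemma wboundary_continuous:
  assumes \<alpha>: "\<bar>Re \<alpha>\<bar> < 1/2" and f: "half_line f" and fn: "\<And>n. half_line (fn n)"
    and lim: "((\<lambda>n. L2nrm (\<lambda>t. f t - fn n t)) \<longlongrightarrow> 0) F"
  shows "((\<lambda>n. L2nrm (\<lambda>t. wboundary \<alpha> f t - wboundary \<alpha> (fn n) t)) \<longlongrightarrow> 0) F"
proof (rule Lim_null_comparison[OF always_eventually[OF allI]])
  define C where "C = 2 + weight_const \<alpha> * (2 / (1/2 - mid_exponent \<alpha>)) / pi"
  show "norm (L2nrm (\<lambda>t. wboundary \<alpha> f t - wboundary \<alpha> (fn n) t)) \<le> C * L2nrm (\<lambda>t. f t - fn n t)" for n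
  proof -
    have h: "half_line (\<lambda>t. 1 * f t + (-1) * fn n t)" by (intro half_line_lin f fn)
    note m = sq_integrable_measurable[OF half_lineD(1)]
    have [measurable]: "wboundary \<alpha> f \<in> borel_measurable borel" "wboundary \<alpha> (fn n) \<in> borel_measurable borel"
      by (intro m wboundary_half_line[OF \<alpha>] f fn)+
    have "AE x in lborel. wboundary \<alpha> f x - wboundary \<alpha> (fn n) x = wboundary \<alpha> (\<lambda>t. 1 * f t + (-1) * fn n t) x"
      using wboundary_lin[OF \<alpha> f fn[of n], of 1 "-1"] by eventually_elim simp
    then have "L2nrm (\<lambda>t. wboundary \<alpha> f t - wboundary \<alpha> (fn n) t) = L2nrm (wboundary \<alpha> (\<lambda>t. 1 * f t + (-1) * fn n t))"
      using m[OF wboundary_half_line(1)[OF \<alpha> h]] by (intro L2nrm_cong_AE) measurable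
    also have "\<dots> \<le> C * L2nrm (\<lambda>t. 1 * f t + (-1) * fn n t)"
      unfolding C_def by (rule wboundary_half_line(2)[OF \<alpha> h])
    finally show ?thesis by simp
  qed
  show "((\<lambda>n. C * L2nrm (\<lambda>t. f t - fn n t)) \<longlongrightarrow> 0) F"
    using tendsto_mult_left[OF lim, of C] by simp
qed

lemma bounded_support_integrable:
  assumes f: "half_line f" and supp: "\<And>t. f t \<noteq> 0 \<Longrightarrow> a \<le> t \<and> t \<le> b"
    and m: "m \<in> borel_measurable borel" and B: "\<And>t. a \<le> t \<Longrightarrow> t \<le> b \<Longrightarrow> cmod (m t) \<le> B"
  shows "integrable lborel (\<lambda>t. m t * f t)"
proof -
  have "integrable lborel (\<lambda>t. (m t * indicator {a..b} t) * f t)"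
  proof (intro L2_Cauchy_Schwarz half_lineD(1)[OF f])
    have [measurable]: "m \<in> borel_measurable borel" by fact
    have "sq_integrable (\<lambda>t. indicator {a..b} t)"
    proof -
      have "(\<lambda>t. (cmod (indicator {a..b} t))\<^sup>2) = indicat_real {a..b}" by (auto simp: indicator_def fun_eq_iff)
      moreover have "integrable lborel (indicat_real {a..b})"
        by (rule integrable_real_indicator) (auto simp: emeasure_lborel_Icc_eq)
      ultimately show ?thesis by (simp add: sq_integrable_def)
    qed
    then show "sq_integrable (\<lambda>t. m t * indicator {a..b} t)"
      by (rule sq_integrable_mono(1)[OF sq_integrable_cmult[of _ "of_real B"]])
         (use B in \<open>auto simp: indicator_def norm_mult intro!: AE_I2 intro: order_trans[OF _ abs_ge_self]\<close>)
  qed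
  moreover have "(m t * indicator {a..b} t) * f t = m t * f t" for t
    using supp[of t] by (cases "f t = 0") (auto simp: indicator_def)
  ultimately show ?thesis by simp
qed

lemma mellin_two_poles:
  assumes \<gamma>: "\<bar>Re \<gamma>\<bar> < 1" and q: "exp (2 * of_real pi * \<i> * \<gamma>) \<noteq> 1" and z: "Im z > 0" and w: "Im w < 0"
  shows "(LBINT s. if 0 < s then cpow \<gamma> s / ((of_real s - z) * (of_real s - w)) else 0)
    = 2 * of_real pi * \<i> / (1 - exp (2 * of_real pi * \<i> * \<gamma>)) *
      ((exp (\<gamma> * Ln z) - exp (2 * of_real pi * \<i> * \<gamma>) * exp (\<gamma> * Ln w)) / (z - w))"
proof -
  have nz: "z \<noteq> 0" "w \<noteq> 0" using z w by auto
  define L where "L = Ln z"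
  \<comment> \<open>In the strip arguments run from 0 to 2 \<pi>, as for a cut along the positive
    axis. The principal logarithm of w has negative imaginary part and must be raised by 2 \<pi> i;
    this produces the factor exp(2 \<pi> i \<gamma>) in front of the w-term only.\<close>
  define M where "M = Ln w + 2 * of_real pi * \<i>"
  have ex: "exp L = z" "exp M = w" using nz by (simp_all add: L_def M_def exp_add)
  have "0 < Im L" "Im L < pi" using z Im_Ln_pos_lt_imp[of z] Im_Ln_pos_lt[OF nz(1)] by (auto simp: L_def)
  moreover have "- pi < Im (Ln w)" "Im (Ln w) < 0"
    using w mpi_less_Im_Ln[OF nz(2)] Im_Ln_pos_le[OF nz(2)] Im_Ln_le_pi[OF nz(2)] by auto
  ultimately interpret strip_poles \<gamma> L M
    using \<gamma> ex z w by unfold_locales (auto simp: M_def)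
  have "exp (\<gamma> * M) = exp (2 * of_real pi * \<i> * \<gamma>) * exp (\<gamma> * Ln w)"
    by (simp add: M_def exp_add[symmetric] algebra_simps)
  then have "(1 - exp (2 * of_real pi * \<i> * \<gamma>)) *
      (LBINT s. if 0 < s then cpow \<gamma> s / ((of_real s - z) * (of_real s - w)) else 0)
    = 2 * of_real pi * \<i> * ((exp (\<gamma> * Ln z) - exp (2 * of_real pi * \<i> * \<gamma>) * exp (\<gamma> * Ln w)) / (z - w))"
    using integral_power_two_poles z w unfolding ex L_def[symmetric] by simp
  moreover have "1 - exp (2 * of_real pi * \<i> * \<gamma>) \<noteq> 0" using q by simp
  ultimately show ?thesis
    by (metis (no_types, lifting) nonzero_mult_div_cancel_left times_divide_eq_left)
qed

text \<open>q is the monodromy of s^(\<alpha>-\<beta>) around the origin; since |Re (\<alpha> -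
  \<beta>)| < 1, excluding q = 1 amounts to \<alpha> \<noteq> \<beta>. \<kappa> is the product of 2
  \<pi> i/(1 - q) from the contour integral and 1/(\<pi> i) from the normalisation.\<close>

locale weight_pair =
  fixes \<alpha> \<beta> :: complex and q \<kappa> :: complex
  assumes \<alpha>: "\<bar>Re \<alpha>\<bar> < 1/2" and \<beta>: "\<bar>Re \<beta>\<bar> < 1/2"
    and q_def: "q = exp (2 * of_real pi * \<i> * (\<alpha> - \<beta>))" and q: "q \<noteq> 1" and \<kappa>_def: "\<kappa> = 2 / (1 - q)"
begin

lemma abs_Re_diff: "\<bar>Re (\<alpha> - \<beta>)\<bar> < 1"
  using \<alpha> \<beta> by simp

lemma pole_cauchy_integral:
  assumes e: "\<epsilon> > 0" "\<delta> > 0"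
  shows "(LBINT s. pole_kernel (- \<beta>) (Complex x \<epsilon>) s * (2 * cpow \<alpha> s * cauchy_kernel \<delta> s r))
    = \<kappa> * ((exp ((\<alpha> - \<beta>) * Ln (Complex x \<epsilon>)) - q * exp ((\<alpha> - \<beta>) * Ln (Complex r (- \<delta>)))) / (Complex r (- \<delta>) - Complex x \<epsilon>))"
proof -
  define z w where "z = Complex x \<epsilon>" and "w = Complex r (- \<delta>)"
  have zw: "Im z > 0" "Im w < 0" using e by (auto simp: z_def w_def)
  have "pole_kernel (- \<beta>) z s * (2 * cpow \<alpha> s * cauchy_kernel \<delta> s r)
      = - 1 / (of_real pi * \<i>) * (if 0 < s then cpow (\<alpha> - \<beta>) s / ((of_real s - z) * (of_real s - w)) else 0)" for s
  proof (cases "0 < s")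
    case True
    have c: "cauchy_kernel \<delta> s r = 1 / (2 * of_real pi * \<i>) / (- (of_real s - w))"
    proof -
      have "of_real (r - s) - \<i> * of_real \<delta> = - (of_real s - w)" by (simp add: w_def complex_eq_iff)
      then show ?thesis by (simp add: cauchy_kernel_def del: of_real_diff)
    qed
    have "cpow (\<alpha> - \<beta>) s = cpow (- \<beta>) s * cpow \<alpha> s" using cpow_add[of "-\<beta>" \<alpha> s] by simp
    moreover have "b / Z * (2 * a * (1 / (2 * p) / (- W))) = - 1 / p * ((b * a) / (Z * W))" for a b p Z W :: complex
      by simp
    ultimately show ?thesis using True unfolding c pole_kernel_def by (simp only: if_True mult.assoc)
  qed (simp add: pole_kernel_def)
  then have "(LBINT s. pole_kernel (- \<beta>) z s * (2 * cpow \<alpha> s * cauchy_kernel \<delta> s r))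
      = - 1 / (of_real pi * \<i>) * (LBINT s. if 0 < s then cpow (\<alpha> - \<beta>) s / ((of_real s - z) * (of_real s - w)) else 0)"
    by (simp only: integral_mult_right_zero)
  also have "\<dots> = - 1 / (of_real pi * \<i>) * (2 * of_real pi * \<i> / (1 - q) *
      ((exp ((\<alpha> - \<beta>) * Ln z) - q * exp ((\<alpha> - \<beta>) * Ln w)) / (z - w)))"
    using mellin_two_poles[OF abs_Re_diff _ zw] q unfolding q_def by simp
  also have "\<dots> = \<kappa> * ((exp ((\<alpha> - \<beta>) * Ln z) - q * exp ((\<alpha> - \<beta>) * Ln w)) / (- (z - w)))"
  proof -
    have *: "- 1 / (p * j) * (2 * p * j / u * (A / B)) = 2 / u * (A / (- B))" if "p \<noteq> 0" "j \<noteq> 0" for p j u A B :: complex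
      using that by simp
    show ?thesis unfolding \<kappa>_def by (rule *) auto
  qed
  finally show ?thesis unfolding z_def w_def by simp
qed

text \<open>The weighted kernel is split to get absolute convergence: for the Cauchy kernel
  Cauchy-Schwarz in s and integrability of f in r suffice, and the homogeneous majorant of the
  correction is handled by Schur's test.\<close>

lemma pole_cauchy_swap:
  assumes e: "\<epsilon> > 0" "\<delta> > 0" and f: "half_line f" "integrable lborel f"
  shows "(LBINT s. pole_kernel (- \<beta>) (Complex x \<epsilon>) s * wcauchy \<alpha> \<delta> f s)
    = (LBINT r. \<kappa> * ((exp ((\<alpha> - \<beta>) * Ln (Complex x \<epsilon>)) - q * exp ((\<alpha> - \<beta>) * Ln (Complex r (- \<delta>)))) / (Complex r (- \<delta>) - Complex x \<epsilon>))
        * (cpow (- \<alpha>) r * f r))"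
proof -
  note f' = half_lineD(1)[OF f(1)]
  define p where "p = pole_kernel (- \<beta>) (Complex x \<epsilon>)"
  have p: "half_line p" unfolding p_def using \<beta> e by (intro pole_kernel_half_line) auto
  note p' = half_lineD(1)[OF p]
  have [measurable]: "f \<in> borel_measurable borel" "p \<in> borel_measurable borel"
    using f' p' by (simp_all add: sq_integrable_def)
  let ?b = "mid_exponent \<alpha>"
  define W where "W = weight_const \<alpha> / pi"
  have [measurable]: "case_prod (hom_kernel ?b) \<in> borel_measurable (borel \<Otimes>\<^sub>M lborel)"
    "case_prod (hom_kernel ?b) \<in> borel_measurable (lborel \<Otimes>\<^sub>M lborel)"
    by (simp_all cong: measurable_cong_sets)
  have W: "W \<ge> 0" using mid_exponent(4)[OF \<alpha>] by (simp add: W_def)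
  let ?F = "\<lambda>s r. p s * (2 * cpow \<alpha> s * cauchy_kernel \<delta> s r) * (cpow (- \<alpha>) r * f r)"
  have F_le: "ennreal (cmod (?F s r)) \<le> 2 * (ennreal (cmod (p s * cauchy_kernel \<delta> s r)) * ennreal (cmod (f r)))
      + ennreal W * (ennreal (cmod (p s)) * ennreal (hom_kernel ?b s r * cmod (f r)))" for s r
  proof (cases "s > 0 \<and> r > 0")
    case True
    have "?F s r = p s * (2 * cpow \<alpha> s * (cauchy_kernel \<delta> s r * cpow (- \<alpha>) r)) * f r" by (simp add: mult_ac)
    also have "\<dots> = p s * (2 * cauchy_kernel \<delta> s r + 1 / (of_real pi * \<i>) * (weight_kernel \<alpha> s r * damping \<delta> (r - s))) * f r"
      using True e by (simp only: wcauchy_kernel_split)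
    finally have "cmod (?F s r) = cmod (p s) * cmod (2 * cauchy_kernel \<delta> s r + 1 / (of_real pi * \<i>) * (weight_kernel \<alpha> s r * damping \<delta> (r - s))) * cmod (f r)"
      by (simp only: norm_mult)
    also have "\<dots> \<le> cmod (p s) * (2 * cmod (cauchy_kernel \<delta> s r) + W * hom_kernel ?b s r) * cmod (f r)"
    proof (intro mult_right_mono mult_left_mono)
      have "cmod (weight_kernel \<alpha> s r * damping \<delta> (r - s)) \<le> (weight_const \<alpha> * hom_kernel ?b s r) * 1"
        unfolding norm_mult by (intro mult_mono mid_exponent \<alpha> damping_le) (auto simp: mid_exponent[OF \<alpha>] hom_kernel_nonneg)
      then have "cmod (1 / (of_real pi * \<i>) * (weight_kernel \<alpha> s r * damping \<delta> (r - s))) \<le> W * hom_kernel ?b s r"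
        by (simp add: norm_mult norm_divide divide_right_mono W_def)
      then show "cmod (2 * cauchy_kernel \<delta> s r + 1 / (of_real pi * \<i>) * (weight_kernel \<alpha> s r * damping \<delta> (r - s)))
          \<le> 2 * cmod (cauchy_kernel \<delta> s r) + W * hom_kernel ?b s r"
        using norm_triangle_ineq[of "2 * cauchy_kernel \<delta> s r" "1 / (of_real pi * \<i>) * (weight_kernel \<alpha> s r * damping \<delta> (r - s))"]
        by (simp add: norm_mult)
    qed auto
    also have "\<dots> = 2 * (cmod (p s * cauchy_kernel \<delta> s r) * cmod (f r)) + W * (cmod (p s) * (hom_kernel ?b s r * cmod (f r)))"
      by (simp add: norm_mult algebra_simps)
    finally have "ennreal (cmod (?F s r)) \<le> ennreal (2 * (cmod (p s * cauchy_kernel \<delta> s r) * cmod (f r)) + W * (cmod (p s) * (hom_kernel ?b s r * cmod (f r))))"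
      by (rule ennreal_leI)
    also have "\<dots> = 2 * (ennreal (cmod (p s * cauchy_kernel \<delta> s r)) * ennreal (cmod (f r)))
      + ennreal W * (ennreal (cmod (p s)) * ennreal (hom_kernel ?b s r * cmod (f r)))"
      using W by (subst ennreal_plus) (auto simp: ennreal_mult hom_kernel_nonneg intro!: mult_nonneg_nonneg)
    finally show ?thesis .
  next
    case False
    then have "?F s r = 0" using half_lineD(2)[OF p, of s] half_lineD(2)[OF f(1), of r] by auto
    then show ?thesis by (simp only: norm_zero ennreal_0 zero_le)
  qed
  have I1: "(\<integral>\<^sup>+s. (\<integral>\<^sup>+r. ennreal (cmod (p s * cauchy_kernel \<delta> s r)) * ennreal (cmod (f r)) \<partial>lborel) \<partial>lborel) < \<infinity>"
  proof -
    have "(\<integral>\<^sup>+s. (\<integral>\<^sup>+r. ennreal (cmod (p s * cauchy_kernel \<delta> s r)) * ennreal (cmod (f r)) \<partial>lborel) \<partial>lborel)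
        = (\<integral>\<^sup>+r. (\<integral>\<^sup>+s. ennreal (cmod (p s * cauchy_kernel \<delta> s r)) * ennreal (cmod (f r)) \<partial>lborel) \<partial>lborel)"
      by (intro lborel_pair.Fubini'[symmetric]) measurable
    also have "\<dots> \<le> (\<integral>\<^sup>+r. ennreal (L2nrm p * (1 / sqrt (4 * pi * \<delta>))) * ennreal (cmod (f r)) \<partial>lborel)"
    proof (intro nn_integral_mono)
      fix r
      have i: "integrable lborel (\<lambda>s. p s * cauchy_kernel \<delta> s r)"
        by (intro L2_Cauchy_Schwarz p' cauchy_kernel_sq_integrable e)
      have "(\<integral>\<^sup>+s. ennreal (cmod (p s * cauchy_kernel \<delta> s r)) \<partial>lborel) = ennreal (LBINT s. cmod (p s * cauchy_kernel \<delta> s r))"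
        by (intro nn_integral_eq_integral integrable_norm i) auto
      also have "\<dots> \<le> ennreal (L2nrm p * (1 / sqrt (4 * pi * \<delta>)))"
        using L2_Cauchy_Schwarz(2)[OF p' cauchy_kernel_sq_integrable(2)[OF e(2), of r]]
        by (intro ennreal_leI) (simp add: cauchy_kernel_sq_integrable e)
      finally show "(\<integral>\<^sup>+s. ennreal (cmod (p s * cauchy_kernel \<delta> s r)) * ennreal (cmod (f r)) \<partial>lborel)
          \<le> ennreal (L2nrm p * (1 / sqrt (4 * pi * \<delta>))) * ennreal (cmod (f r))"
        by (simp add: nn_integral_multc mult_right_mono)
    qed
    also have "\<dots> = ennreal (L2nrm p * (1 / sqrt (4 * pi * \<delta>))) * ennreal (LBINT r. cmod (f r))"
      using f(2) by (simp add: nn_integral_cmult nn_integral_eq_integral)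
    also have "\<dots> < \<infinity>" by (simp add: ennreal_mult_less_top)
    finally show ?thesis .
  qed
  have I2: "(\<integral>\<^sup>+s. (\<integral>\<^sup>+r. ennreal (cmod (p s)) * ennreal (hom_kernel ?b s r * cmod (f r)) \<partial>lborel) \<partial>lborel) < \<infinity>"
  proof -
    let ?N = "\<lambda>s. complex_of_real (LBINT r. hom_kernel ?b s r * cmod (f r))"
    have N: "sq_integrable ?N" by (rule hom_kernel_integrable(2)[OF mid_exponent(1,2)[OF \<alpha>] f'])
    have "(\<integral>\<^sup>+s. (\<integral>\<^sup>+r. ennreal (cmod (p s)) * ennreal (hom_kernel ?b s r * cmod (f r)) \<partial>lborel) \<partial>lborel)
        = (\<integral>\<^sup>+s. ennreal (cmod (p s * ?N s)) \<partial>lborel)"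
    proof (rule nn_integral_cong_AE)
      show "AE s in lborel. (\<integral>\<^sup>+r. ennreal (cmod (p s)) * ennreal (hom_kernel ?b s r * cmod (f r)) \<partial>lborel) = ennreal (cmod (p s * ?N s))"
        using hom_kernel_integrable(1)[OF mid_exponent(1,2)[OF \<alpha>] f']
      proof eventually_elim
        case (elim s)
        have nn: "0 \<le> (LBINT r. hom_kernel ?b s r * cmod (f r))"
          by (intro Bochner_Integration.integral_nonneg mult_nonneg_nonneg hom_kernel_nonneg norm_ge_zero)
        have "(\<integral>\<^sup>+r. ennreal (cmod (p s)) * ennreal (hom_kernel ?b s r * cmod (f r)) \<partial>lborel)
            = ennreal (cmod (p s)) * (\<integral>\<^sup>+r. ennreal (hom_kernel ?b s r * cmod (f r)) \<partial>lborel)"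
          using borel_measurable_integrable[OF elim] by (intro nn_integral_cmult) simp
        also have "(\<integral>\<^sup>+r. ennreal (hom_kernel ?b s r * cmod (f r)) \<partial>lborel) = ennreal (LBINT r. hom_kernel ?b s r * cmod (f r))"
          by (intro nn_integral_eq_integral elim) (auto simp: hom_kernel_nonneg)
        finally show ?case using nn by (simp add: norm_mult ennreal_mult)
      qed
    qed
    also have "\<dots> < \<infinity>"
      using L2_Cauchy_Schwarz(1)[OF p' N] by (simp add: integrable_iff_bounded)
    finally show ?thesis .
  qed
  have fin: "(\<integral>\<^sup>+s. (\<integral>\<^sup>+r. ennreal (cmod (?F s r)) \<partial>lborel) \<partial>lborel) < \<infinity>"
  proof -
    have "(\<integral>\<^sup>+s. (\<integral>\<^sup>+r. ennreal (cmod (?F s r)) \<partial>lborel) \<partial>lborel)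
      \<le> (\<integral>\<^sup>+s. (\<integral>\<^sup>+r. 2 * (ennreal (cmod (p s * cauchy_kernel \<delta> s r)) * ennreal (cmod (f r)))
      + ennreal W * (ennreal (cmod (p s)) * ennreal (hom_kernel ?b s r * cmod (f r))) \<partial>lborel) \<partial>lborel)"
      by (intro nn_integral_mono F_le)
    also have "\<dots> = 2 * (\<integral>\<^sup>+s. (\<integral>\<^sup>+r. ennreal (cmod (p s * cauchy_kernel \<delta> s r)) * ennreal (cmod (f r)) \<partial>lborel) \<partial>lborel)
      + ennreal W * (\<integral>\<^sup>+s. (\<integral>\<^sup>+r. ennreal (cmod (p s)) * ennreal (hom_kernel ?b s r * cmod (f r)) \<partial>lborel) \<partial>lborel)"
      by (subst nn_integral_add nn_integral_cmult, measurable)+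
    also have "\<dots> < \<infinity>"
      using I1 I2 by (simp add: ennreal_mult_less_top)
    finally show ?thesis .
  qed
  have "(LBINT s. p s * wcauchy \<alpha> \<delta> f s) = (LBINT s. LBINT r. ?F s r)"
  proof (rule Bochner_Integration.integral_cong[OF refl])
    fix s
    have "p s * wcauchy \<alpha> \<delta> f s = (LBINT r. p s * (2 * cpow \<alpha> s) * (cauchy_kernel \<delta> s r * (cpow (- \<alpha>) r * f r)))"
      unfolding wcauchy_def cauchy_int_def integral_mult_right_zero by (simp add: mult.assoc)
    then show "p s * wcauchy \<alpha> \<delta> f s = (LBINT r. ?F s r)" by (simp add: mult.assoc)
  qed
  also have "\<dots> = (LBINT r. LBINT s. ?F s r)"
    by (rule integral_swap(1)[symmetric, OF _ fin]) measurable
  also have "\<dots> = (LBINT r. (LBINT s. p s * (2 * cpow \<alpha> s * cauchy_kernel \<delta> s r)) * (cpow (- \<alpha>) r * f r))"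
    by (simp only: integral_mult_left_zero)
  finally show ?thesis unfolding p_def pole_cauchy_integral[OF e] .
qed

end

lemma cmod_cpow_le:
  assumes "0 < a" "a \<le> t" "t \<le> b"
  shows "cmod (cpow \<gamma> t) \<le> exp (cmod \<gamma> * (\<bar>ln a\<bar> + \<bar>ln b\<bar>))"
proof -
  have "ln a \<le> ln t" "ln t \<le> ln b" using assms by auto
  then have "\<bar>ln t\<bar> \<le> \<bar>ln a\<bar> + \<bar>ln b\<bar>" by linarith
  moreover have "Re (\<gamma> * of_real (ln t)) \<le> cmod \<gamma> * \<bar>ln t\<bar>"
    using complex_Re_le_cmod[of "\<gamma> * of_real (ln t)"] by (simp add: norm_mult)
  ultimately have "Re (\<gamma> * of_real (ln t)) \<le> cmod \<gamma> * (\<bar>ln a\<bar> + \<bar>ln b\<bar>)"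
    by (meson mult_left_mono norm_ge_zero order_trans)
  then show ?thesis unfolding cpow_def norm_exp_eq_Re by simp
qed

lemma cmod_exp_Ln_le:
  assumes "0 < a" "a \<le> t" "t \<le> b" "0 < \<delta>" "\<delta> \<le> 1"
  shows "cmod (exp (\<gamma> * Ln (Complex t (- \<delta>)))) \<le> exp (cmod \<gamma> * (\<bar>ln a\<bar> + \<bar>ln (b + 1)\<bar> + pi))"
proof -
  define w where "w = Complex t (- \<delta>)"
  have w: "w \<noteq> 0" "a \<le> cmod w" "cmod w \<le> b + 1"
    using assms abs_Re_le_cmod[of w] cmod_le[of w] by (auto simp: w_def complex_eq_iff)
  then have "ln a \<le> ln (cmod w)" "ln (cmod w) \<le> ln (b + 1)" using assms by auto
  then have "\<bar>Re (Ln w)\<bar> \<le> \<bar>ln a\<bar> + \<bar>ln (b + 1)\<bar>" using w(1) by (simp add: Re_Ln)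
  moreover have "\<bar>Im (Ln w)\<bar> \<le> pi" using Im_Ln_le_pi[OF w(1)] mpi_less_Im_Ln[OF w(1)] by simp
  ultimately have "cmod (Ln w) \<le> \<bar>ln a\<bar> + \<bar>ln (b + 1)\<bar> + pi"
    using cmod_le[of "Ln w"] by linarith
  then have "cmod \<gamma> * cmod (Ln w) \<le> cmod \<gamma> * (\<bar>ln a\<bar> + \<bar>ln (b + 1)\<bar> + pi)" by (rule mult_left_mono) simp
  moreover have "Re (\<gamma> * Ln w) \<le> cmod \<gamma> * cmod (Ln w)"
    using complex_Re_le_cmod[of "\<gamma> * Ln w"] by (simp only: norm_mult)
  ultimately show ?thesis unfolding norm_exp_eq_Re w_def[symmetric] by simp
qed

lemma Ln_Complex_tendsto:
  assumes "t > 0" and "((\<lambda>n. d n) \<longlongrightarrow> (0::real)) F"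
  shows "((\<lambda>n. exp (\<gamma> * Ln (Complex t (d n)))) \<longlongrightarrow> cpow \<gamma> t) F"
proof -
  have "((\<lambda>n. Complex t (d n)) \<longlongrightarrow> Complex t 0) F" by (intro tendsto_Complex tendsto_const assms)
  then have "((\<lambda>n. Complex t (d n)) \<longlongrightarrow> of_real t) F" by (simp add: complex_of_real_def)
  then have "((\<lambda>n. exp (\<gamma> * Ln (Complex t (d n)))) \<longlongrightarrow> exp (\<gamma> * Ln (of_real t))) F"
    using assms(1) by (intro tendsto_exp tendsto_mult tendsto_const tendsto_Ln) auto
  then show ?thesis using assms(1) by (simp add: cpow_def Ln_of_real)
qed

context weight_pair
begin

text \<open>Only the inner regularisation is removed here, the outer \<epsilon> stays fixed. A
  support away from 0 and infinity makes r^(-\<alpha>) f integrable and bounds w^(\<alpha>-\<beta>)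
  uniformly. In the limit r^(\<alpha>-\<beta>) r^(-\<alpha>) = r^(-\<beta>), which is how the second
  pole kernel acquires the weight \<beta>.\<close>

lemma pole_wboundary_compact:
  assumes e: "\<epsilon> > 0" and f: "half_line f" and ab: "0 < a" and supp: "\<And>t. f t \<noteq> 0 \<Longrightarrow> a \<le> t \<and> t \<le> b"
  shows "(LBINT s. pole_kernel (- \<beta>) (Complex x \<epsilon>) s * wboundary \<alpha> f s)
    = \<kappa> * exp ((\<alpha> - \<beta>) * Ln (Complex x \<epsilon>)) * (LBINT r. pole_kernel (- \<alpha>) (Complex x \<epsilon>) r * f r)
      - \<kappa> * q * (LBINT r. pole_kernel (- \<beta>) (Complex x \<epsilon>) r * f r)"
proof -
  define z where "z = Complex x \<epsilon>"
  define E where "E = exp ((\<alpha> - \<beta>) * Ln z)"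
  have z: "Im z > 0" "Im z \<noteq> 0" using e by (auto simp: z_def)
  have [measurable]: "f \<in> borel_measurable borel" using half_lineD(1)[OF f] by (simp add: sq_integrable_def)
  have fi: "integrable lborel f"
    using bounded_support_integrable[OF f supp, of "\<lambda>_. 1" 1] by simp
  have wi: "integrable lborel (\<lambda>r. cpow (- \<alpha>) r * f r)"
    by (rule bounded_support_integrable[OF f supp, of _ "exp (cmod (- \<alpha>) * (\<bar>ln a\<bar> + \<bar>ln b\<bar>))"]) (use cmod_cpow_le[OF ab, of _ b "- \<alpha>"] in auto)
  have p\<beta>: "half_line (pole_kernel (- \<beta>) z)" and p\<alpha>: "half_line (pole_kernel (- \<alpha>) z)"
    using \<alpha> \<beta> z by (auto intro: pole_kernel_half_line)
  let ?h = "\<lambda>n r. \<kappa> * ((E - q * exp ((\<alpha> - \<beta>) * Ln (Complex r (- null_seq n)))) / (Complex r (- null_seq n) - z)) * (cpow (- \<alpha>) r * f r)"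
  let ?g = "\<lambda>r. \<kappa> * ((E - q * cpow (\<alpha> - \<beta>) r) / (of_real r - z)) * (cpow (- \<alpha>) r * f r)"
  have nz: "of_real r - z \<noteq> 0" for r :: real using z by (auto simp: complex_eq_iff)
  have LHS: "(\<lambda>n. LBINT s. pole_kernel (- \<beta>) z s * wcauchy \<alpha> (null_seq n) f s) \<longlonglongrightarrow> (LBINT s. pole_kernel (- \<beta>) z s * wboundary \<alpha> f s)"
    by (rule wcauchy_weak_limit[OF \<alpha> f p\<beta>])
  have swap: "(LBINT s. pole_kernel (- \<beta>) z s * wcauchy \<alpha> (null_seq n) f s) = (LBINT r. ?h n r)" for n
    unfolding z_def E_def by (rule pole_cauchy_swap[OF e null_seq(1) f fi])
  define B where "B = exp (cmod (\<alpha> - \<beta>) * (\<bar>ln a\<bar> + \<bar>ln (b + 1)\<bar> + pi))"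
  \<comment> \<open>The denominator w - z has imaginary part -(\<epsilon> +
    \<open>null_seq n\<close>), so its modulus is at least \<epsilon> whatever n is.\<close>
  define C where "C = cmod \<kappa> * ((cmod E + cmod q * B) / \<epsilon>)"
  have RHS: "(\<lambda>n. LBINT r. ?h n r) \<longlonglongrightarrow> (LBINT r. ?g r)"
  proof (rule integral_dominated_convergence[where w="\<lambda>r. C * cmod (cpow (- \<alpha>) r * f r)"])
    show "integrable lborel (\<lambda>r. C * cmod (cpow (- \<alpha>) r * f r))"
      by (intro integrable_mult_right integrable_norm wi)
    show "AE r in lborel. (\<lambda>n. ?h n r) \<longlonglongrightarrow> ?g r"
    proof (rule AE_I2)
      fix r :: real
      show "(\<lambda>n. ?h n r) \<longlonglongrightarrow> ?g r"
      proof (cases "r > 0")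
        case True
        have d: "(\<lambda>n. - null_seq n) \<longlonglongrightarrow> 0" using tendsto_minus[OF null_seq(2)] by simp
        have "(\<lambda>n. Complex r (- null_seq n)) \<longlonglongrightarrow> Complex r 0" by (intro tendsto_Complex tendsto_const d)
        then have "(\<lambda>n. Complex r (- null_seq n)) \<longlonglongrightarrow> of_real r" by (simp add: complex_of_real_def)
        then show ?thesis
          using nz by (intro tendsto_mult tendsto_divide tendsto_diff tendsto_const Ln_Complex_tendsto[OF True d]) auto
      qed (use half_lineD(2)[OF f] in simp)
    qed
    show "AE r in lborel. cmod (?h n r) \<le> C * cmod (cpow (- \<alpha>) r * f r)" for n
    proof (rule AE_I2)
      fix r :: real
      show "cmod (?h n r) \<le> C * cmod (cpow (- \<alpha>) r * f r)"
      proof (cases "f r = 0")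
        case False
        have n1: "null_seq n \<le> 1" by (simp add: null_seq_def)
        have "\<epsilon> \<le> cmod (Complex r (- null_seq n) - z)"
          using abs_Im_le_cmod[of "Complex r (- null_seq n) - z"] null_seq(1)[of n] e by (simp add: z_def)
        moreover have "cmod (E - q * exp ((\<alpha> - \<beta>) * Ln (Complex r (- null_seq n)))) \<le> cmod E + cmod q * B"
        proof -
          have "cmod (q * exp ((\<alpha> - \<beta>) * Ln (Complex r (- null_seq n)))) \<le> cmod q * B"
            unfolding norm_mult[of q] B_def using supp[OF False] ab n1 null_seq(1)[of n]
            by (intro mult_left_mono cmod_exp_Ln_le) auto
          then show ?thesis using norm_triangle_ineq4[of E "q * exp ((\<alpha> - \<beta>) * Ln (Complex r (- null_seq n)))"] by linarith
        qed
        ultimately have "cmod ((E - q * exp ((\<alpha> - \<beta>) * Ln (Complex r (- null_seq n)))) / (Complex r (- null_seq n) - z)) \<le> (cmod E + cmod q * B) / \<epsilon>"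
          unfolding norm_divide using e by (intro frac_le) (auto simp: B_def)
        then show ?thesis
          unfolding norm_mult[of "_ * _" "cpow (- \<alpha>) r * f r"] norm_mult[of \<kappa>] C_def by (intro mult_right_mono mult_left_mono) auto
      qed simp
    qed
    show "?h n \<in> borel_measurable lborel" for n
    proof -
      have "(\<lambda>r. Complex r (- null_seq n)) = (\<lambda>r. of_real r - \<i> * of_real (null_seq n))" by (auto simp: complex_eq_iff)
      then have [measurable]: "(\<lambda>r. Complex r (- null_seq n)) \<in> borel_measurable borel" by simp
      show ?thesis by measurable
    qed
    show "?g \<in> borel_measurable lborel" by measurable
  qed
  have "(LBINT s. pole_kernel (- \<beta>) z s * wboundary \<alpha> f s) = (LBINT r. ?g r)"
    using LIMSEQ_unique[OF LHS[unfolded swap] RHS] .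
  also have "\<dots> = (LBINT r. (\<kappa> * E) * (pole_kernel (- \<alpha>) z r * f r) - (\<kappa> * q) * (pole_kernel (- \<beta>) z r * f r))"
  proof (rule Bochner_Integration.integral_cong[OF refl])
    fix r :: real
    show "?g r = (\<kappa> * E) * (pole_kernel (- \<alpha>) z r * f r) - (\<kappa> * q) * (pole_kernel (- \<beta>) z r * f r)"
    proof (cases "r > 0")
      case True
      have "cpow (- \<beta>) r = cpow (\<alpha> - \<beta>) r * cpow (- \<alpha>) r" using cpow_add[of "\<alpha> - \<beta>" "- \<alpha>" r] by simp
      moreover have "\<kappa> * ((E - q * G) / Z) * (A * y) = (\<kappa> * E) * (A / Z * y) - (\<kappa> * q) * (G * A / Z * y)" for G Z A y :: complex
        by (simp add: diff_divide_distrib algebra_simps)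
      ultimately show ?thesis using True unfolding pole_kernel_def by (simp only: if_True)
    qed (use half_lineD(2)[OF f] in simp)
  qed
  also have "\<dots> = \<kappa> * E * (LBINT r. pole_kernel (- \<alpha>) z r * f r) - \<kappa> * q * (LBINT r. pole_kernel (- \<beta>) z r * f r)"
    unfolding integral_mult_right_zero[symmetric]
    by (intro Bochner_Integration.integral_diff integrable_mult_right L2_Cauchy_Schwarz half_lineD(1) p\<alpha> p\<beta> f)
  finally show ?thesis unfolding z_def E_def .
qed

text \<open>Both sides are continuous in f for the L2 norm, and restrictions to
  \<open>[null_seq n, n]\<close> approximate f.\<close>

lemma pole_wboundary:
  assumes e: "\<epsilon> > 0" and f: "half_line f"
  shows "(LBINT s. pole_kernel (- \<beta>) (Complex x \<epsilon>) s * wboundary \<alpha> f s)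
    = \<kappa> * exp ((\<alpha> - \<beta>) * Ln (Complex x \<epsilon>)) * (LBINT r. pole_kernel (- \<alpha>) (Complex x \<epsilon>) r * f r)
      - \<kappa> * q * (LBINT r. pole_kernel (- \<beta>) (Complex x \<epsilon>) r * f r)"
proof -
  define z where "z = Complex x \<epsilon>"
  have z: "Im z > 0" "Im z \<noteq> 0" using e by (auto simp: z_def)
  note f' = half_lineD(1)[OF f]
  have [measurable]: "f \<in> borel_measurable borel" using f' by (simp add: sq_integrable_def)
  have p\<beta>: "sq_integrable (pole_kernel (- \<beta>) z)" and p\<alpha>: "sq_integrable (pole_kernel (- \<alpha>) z)"
    using \<alpha> \<beta> z by (auto intro!: half_lineD(1)[OF pole_kernel_half_line])
  define A where "A n = {null_seq n..real n}" for n
  define fn where "fn n t = indicator (A n) t * f t" for n t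
  have fn: "half_line (fn n)" for n
    unfolding half_line_def
  proof
    show "sq_integrable (fn n)"
      unfolding fn_def A_def by (intro sq_integrable_mono[OF f']) (auto simp: indicator_def)
  qed (use half_lineD(2)[OF f] in \<open>auto simp: fn_def\<close>)
  have lim: "(\<lambda>n. L2nrm (\<lambda>t. f t - fn n t)) \<longlonglongrightarrow> 0"
    unfolding fn_def
  proof (rule L2_cutoff_tendsto[OF f'])
    show "A n \<in> sets borel" for n by (simp add: A_def)
    show "AE t in lborel. f t \<noteq> 0 \<longrightarrow> (\<forall>\<^sub>F n in sequentially. t \<in> A n)"
    proof (intro AE_I2 impI)
      fix t assume "f t \<noteq> 0"
      then have t: "t > 0" using half_lineD(2)[OF f, of t] by force
      have "\<forall>\<^sub>F n in sequentially. null_seq n < t" using null_seq(2) t by (rule order_tendstoD)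
      moreover have "\<forall>\<^sub>F n in sequentially. t < real n"
        by (rule eventually_compose_filterlim[OF eventually_gt_at_top filterlim_real_sequentially])
      ultimately show "\<forall>\<^sub>F n in sequentially. t \<in> A n" by eventually_elim (simp add: A_def)
    qed
  qed
  have sw: "sq_integrable (wboundary \<alpha> f)" "sq_integrable (wboundary \<alpha> (fn n))" for n
    by (intro half_lineD(1) wboundary_half_line[OF \<alpha>] f fn)+
  have 1: "(\<lambda>n. LBINT s. pole_kernel (- \<beta>) z s * wboundary \<alpha> (fn n) s) \<longlonglongrightarrow> (LBINT s. pole_kernel (- \<beta>) z s * wboundary \<alpha> f s)"
    using wboundary_continuous[OF \<alpha> f fn lim] by (intro L2_continuous_functional p\<beta> sw) (simp add: L2nrm_minus_commute)
  have lim': "(\<lambda>n. L2nrm (\<lambda>t. fn n t - f t)) \<longlonglongrightarrow> 0" using lim by (simp add: L2nrm_minus_commute)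
  have 2: "(\<lambda>n. LBINT r. pole_kernel (- \<alpha>) z r * fn n r) \<longlonglongrightarrow> (LBINT r. pole_kernel (- \<alpha>) z r * f r)"
    "(\<lambda>n. LBINT r. pole_kernel (- \<beta>) z r * fn n r) \<longlonglongrightarrow> (LBINT r. pole_kernel (- \<beta>) z r * f r)"
    by (intro L2_continuous_functional p\<alpha> p\<beta> half_lineD(1)[OF fn] f' lim')+
  have eq: "(LBINT s. pole_kernel (- \<beta>) z s * wboundary \<alpha> (fn n) s)
    = \<kappa> * exp ((\<alpha> - \<beta>) * Ln z) * (LBINT r. pole_kernel (- \<alpha>) z r * fn n r) - \<kappa> * q * (LBINT r. pole_kernel (- \<beta>) z r * fn n r)" for n
    unfolding z_def by (rule pole_wboundary_compact[OF e fn null_seq(1)[of n], of n "real n"]) (auto simp: fn_def A_def indicator_def split: if_splits)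
  have "(\<lambda>n. LBINT s. pole_kernel (- \<beta>) z s * wboundary \<alpha> (fn n) s) \<longlonglongrightarrow>
      \<kappa> * exp ((\<alpha> - \<beta>) * Ln z) * (LBINT r. pole_kernel (- \<alpha>) z r * f r) - \<kappa> * q * (LBINT r. pole_kernel (- \<beta>) z r * f r)"
    unfolding eq by (intro tendsto_diff tendsto_mult tendsto_const 2)
  from LIMSEQ_unique[OF 1 this] show ?thesis unfolding z_def .
qed

text \<open>Multiplying the preceding identity by x^\<beta> gives weighted Cauchy integrals at x + i
  \<epsilon>. The stray factor z^(\<alpha>-\<beta>) x^(\<beta>-\<alpha>) tends to 1 as \<epsilon>
  tends to 0.\<close>

lemma wboundary_wboundary:
  assumes f: "half_line f"
  shows "AE x in lborel. wboundary \<beta> (wboundary \<alpha> f) x = \<kappa> * wboundary \<alpha> f x + (2 - \<kappa>) * wboundary \<beta> f x"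
proof -
  note g = wboundary_half_line(1)[OF \<alpha> f]
  show ?thesis
    using wcauchy_tendsto[OF \<alpha> f] wcauchy_tendsto[OF \<beta> f] wcauchy_tendsto[OF \<beta> g]
  proof eventually_elim
    case (elim x)
    show ?case
    proof (cases "x > 0")
      case True
      let ?E = "\<lambda>\<epsilon>. exp ((\<alpha> - \<beta>) * Ln (Complex x \<epsilon>))"
      \<comment> \<open>This restates \<kappa> (1 - q) = 2.\<close>
      have \<kappa>q: "- (\<kappa> * q) = 2 - \<kappa>" using q by (simp add: \<kappa>_def field_simps)
      have eq: "wcauchy \<beta> \<epsilon> (wboundary \<alpha> f) x = \<kappa> * (?E \<epsilon> * (cpow \<beta> x * cpow (- \<alpha>) x)) * wcauchy \<alpha> \<epsilon> f x + (2 - \<kappa>) * wcauchy \<beta> \<epsilon> f x"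
        if e: "\<epsilon> > 0" for \<epsilon>
      proof -
        have "K * B * (\<kappa> * E * I - \<kappa> * q * J) = \<kappa> * (E * (B * A')) * (K * A * I) + (2 - \<kappa>) * (K * B * J)"
          if "A * A' = 1" for K B E I J A A' :: complex
        proof -
          have "\<kappa> * (E * (B * A')) * (K * A * I) = (A * A') * (K * B * (\<kappa> * E * I))" by (simp add: mult_ac)
          then show ?thesis unfolding \<kappa>q[symmetric] that by (simp add: algebra_simps)
        qed
        from this[OF cpow_minus[of \<alpha> x]] show ?thesis
          unfolding wcauchy_pole_kernel[OF \<beta> g e] wcauchy_pole_kernel[OF \<beta> f e] wcauchy_pole_kernel[OF \<alpha> f e] pole_wboundary[OF e f] .
      qed
      have one: "cpow (\<alpha> - \<beta>) x * (cpow \<beta> x * cpow (- \<alpha>) x) = 1"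
        by (simp add: cpow_add[symmetric])
      have "((\<lambda>\<epsilon>. \<kappa> * (?E \<epsilon> * (cpow \<beta> x * cpow (- \<alpha>) x)) * wcauchy \<alpha> \<epsilon> f x + (2 - \<kappa>) * wcauchy \<beta> \<epsilon> f x) \<longlongrightarrow>
         \<kappa> * (cpow (\<alpha> - \<beta>) x * (cpow \<beta> x * cpow (- \<alpha>) x)) * wboundary \<alpha> f x + (2 - \<kappa>) * wboundary \<beta> f x) (at_right 0)"
        using elim(1,2) True by (intro tendsto_add tendsto_mult tendsto_const Ln_Complex_tendsto[OF True] tendsto_ident_at) auto
      moreover have "\<forall>\<^sub>F \<epsilon> in at_right 0. \<kappa> * (?E \<epsilon> * (cpow \<beta> x * cpow (- \<alpha>) x)) * wcauchy \<alpha> \<epsilon> f x + (2 - \<kappa>) * wcauchy \<beta> \<epsilon> f x = wcauchy \<beta> \<epsilon> (wboundary \<alpha> f) x"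
        using eventually_at_right_less[of "0::real"] by eventually_elim (rule eq[symmetric])
      ultimately have "((\<lambda>\<epsilon>. wcauchy \<beta> \<epsilon> (wboundary \<alpha> f) x) \<longlongrightarrow> \<kappa> * (cpow (\<alpha> - \<beta>) x * (cpow \<beta> x * cpow (- \<alpha>) x)) * wboundary \<alpha> f x + (2 - \<kappa>) * wboundary \<beta> f x) (at_right 0)"
        by (rule Lim_transform_eventually)
      then show ?thesis
        using elim(3) True one tendsto_unique[OF trivial_limit_at_right_real] by auto
    qed (simp add: wboundary_def)
  qed
qed

end

text \<open>\<open>W\<^sub>0 - 1\<close> is the singular integral operator, so \<open>A\<close> is \<open>S - \<lambda>\<close>. The choice of \<open>\<alpha>\<close> makes
  \<open>\<kappa> = \<lambda> + 1\<close> for the pair \<open>(\<alpha>, 0)\<close> and \<open>\<kappa> = 1 - \<lambda>\<close> for the pair \<open>(0, \<alpha>)\<close>.\<close>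

lemma resolvent:
  fixes lam \<alpha> :: complex
  assumes \<alpha>: "\<bar>Re \<alpha>\<bar> < 1/2" and q: "exp (2 * of_real pi * \<i> * \<alpha>) = (lam - 1) / (lam + 1)"
    and lam: "lam \<noteq> 1" "lam \<noteq> -1"
    and c: "c = 1 / (1 - lam\<^sup>2)" and f: "half_line f"
  defines "R \<equiv> \<lambda>f t. (c * (lam - 1)) * f t + c * wboundary \<alpha> f t"
    and "A \<equiv> \<lambda>f t. 1 * wboundary 0 f t + (- (1 + lam)) * f t"
  shows "AE x in lborel. A (R f) x = f x" "AE x in lborel. R (A f) x = f x"
proof -
  have nz: "lam + 1 \<noteq> 0" "lam - 1 \<noteq> 0" "1 - lam \<noteq> 0" using lam by (auto simp: add_eq_0_iff2 add_eq_0_iff)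
  have "(1 - lam) * (1 + lam) = 1 - lam\<^sup>2" by (simp add: algebra_simps power2_eq_square)
  then have nz2: "1 - lam\<^sup>2 \<noteq> 0" using nz by (metis add.commute mult_eq_0_iff)
  have c1: "c * ((1 - lam) * (1 + lam)) = 1" using \<open>(1 - lam) * (1 + lam) = 1 - lam\<^sup>2\<close> nz2 by (simp add: c)
  have z: "\<bar>Re 0\<bar> < 1/2" by simp
  note W = wboundary_half_line(1)[OF \<alpha> f] wboundary_half_line(1)[OF z f]
  interpret P: weight_pair \<alpha> 0 "(lam - 1) / (lam + 1)" "lam + 1"
  proof
    show "(lam - 1) / (lam + 1) = exp (2 * of_real pi * \<i> * (\<alpha> - 0))" using q by simp
    show "(lam - 1) / (lam + 1) \<noteq> 1" using nz by (simp add: field_simps)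
    show "lam + 1 = 2 / (1 - (lam - 1) / (lam + 1))" using nz by (simp add: field_simps)
  qed (use \<alpha> in auto)
  interpret Q: weight_pair 0 \<alpha> "(lam + 1) / (lam - 1)" "1 - lam"
  proof
    have "exp (2 * of_real pi * \<i> * (0 - \<alpha>)) = inverse (exp (2 * of_real pi * \<i> * \<alpha>))" by (simp add: exp_minus)
    then show "(lam + 1) / (lam - 1) = exp (2 * of_real pi * \<i> * (0 - \<alpha>))" using q by simp
    show "(lam + 1) / (lam - 1) \<noteq> 1" using nz by (simp add: field_simps)
    show "1 - lam = 2 / (1 - (lam + 1) / (lam - 1))" using nz by (simp add: field_simps)
  qed (use \<alpha> in auto)
  show "AE x in lborel. A (R f) x = f x"
    using wboundary_lin[OF z f W(1), of "c * (lam - 1)" c] P.wboundary_wboundary[OF f]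
  proof eventually_elim
    case (elim x)
    \<comment> \<open>The terms with \<open>wboundary \<alpha>\<close> cancel because \<kappa> = lam
      + 1, those with \<open>wboundary 0\<close> because 2 - \<kappa> = 1 - lam; a multiple of f
      remains, and c normalises it to f.\<close>
    have "A (R f) x = c * (lam - 1) * wboundary 0 f x + c * ((lam + 1) * wboundary \<alpha> f x + (2 - (lam + 1)) * wboundary 0 f x)
       - (1 + lam) * (c * (lam - 1) * f x + c * wboundary \<alpha> f x)"
      unfolding A_def R_def elim by (simp add: algebra_simps)
    also have "\<dots> = c * ((1 - lam) * (1 + lam)) * f x" by (simp add: algebra_simps)
    finally show ?case by (simp add: c1)
  qed
  show "AE x in lborel. R (A f) x = f x"
    using wboundary_lin[OF \<alpha> W(2) f, of 1 "- (1 + lam)"] Q.wboundary_wboundary[OF f]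
  proof eventually_elim
    case (elim x)
    \<comment> \<open>The same cancellation with \<kappa> = 1 - lam and 2 - \<kappa> = 1 +
      lam.\<close>
    have "R (A f) x = c * (lam - 1) * (wboundary 0 f x - (1 + lam) * f x) + c * (((1 - lam) * wboundary 0 f x + (2 - (1 - lam)) * wboundary \<alpha> f x)
       - (1 + lam) * wboundary \<alpha> f x)"
      unfolding A_def R_def elim by (simp add: algebra_simps)
    also have "\<dots> = c * ((1 - lam) * (1 + lam)) * f x" by (simp add: algebra_simps)
    finally show ?case by (simp add: c1)
  qed
qed

section \<open>Transfer to the quotient space\<close>

lemma AE_Rplus: "(AE t in Rplus. P t) \<longleftrightarrow> (AE t in lborel. 0 < t \<longrightarrow> P t)"
  by (simp add: AE_restrict_space_iff AE_completion_iff)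

lemma half_line_L2_fun:
  assumes "half_line f"
  shows "f \<in> L2_fun" "L2_norm_fun f = L2nrm f"
proof -
  have m: "f \<in> borel_measurable borel" and i: "integrable lborel (\<lambda>t. (cmod (f t))\<^sup>2)"
    using half_lineD(1)[OF assms] by (auto simp: sq_integrable_def)
  have eq: "(\<lambda>t. indicator {0<..} t * (cmod (f t))\<^sup>2) = (\<lambda>t. (cmod (f t))\<^sup>2)"
    using half_lineD(2)[OF assms] by (force simp: indicator_def fun_eq_iff)
  have m': "f \<in> borel_measurable Rplus"
    using m by (intro measurable_restrict_space1 measurable_completion) simp
  have "integrable lebesgue (\<lambda>t. (cmod (f t))\<^sup>2)" using i m by (simp add: integrable_completion)
  then have "integrable Rplus (\<lambda>t. (cmod (f t))\<^sup>2)" by (simp add: integrable_restrict_space eq)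
  then show "f \<in> L2_fun" using m' by (simp add: L2_fun_def)
  have "(LINT t|Rplus. (cmod (f t))\<^sup>2) = (LINT t|lebesgue. (cmod (f t))\<^sup>2)"
    by (simp add: integral_restrict_space eq)
  also have "\<dots> = (LBINT t. (cmod (f t))\<^sup>2)" using m by (simp add: integral_completion)
  finally show "L2_norm_fun f = L2nrm f" by (simp add: L2_norm_fun_def L2nrm_def)
qed

text \<open>Elements of \<open>L2_fun\<close> are Lebesgue measurable, whereas the estimates on the
  line concern Borel functions. A measurable function for the completed measure agrees almost
  everywhere with a Borel one; real and imaginary parts are treated separately.\<close>

lemma half_line_representative:
  assumes "h \<in> L2_fun"
  obtains f where "half_line f" "AE t in lborel. 0 < t \<longrightarrow> f t = h t"
proof -
  have hm: "h \<in> borel_measurable Rplus" and hi: "integrable Rplus (\<lambda>t. (cmod (h t))\<^sup>2)"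
    using assms by (auto simp: L2_fun_def)
  define k where "k t = (if t \<in> {0<..} then h t else 0)" for t :: real
  have k: "k \<in> borel_measurable lebesgue"
    unfolding k_def using hm by (subst borel_measurable_if) auto
  obtain g1 where g1: "g1 \<in> borel_measurable lborel" "AE t in lborel. Re (k t) = g1 t"
    using completion_ex_borel_measurable_real[of "\<lambda>t. Re (k t)" lborel] k by auto
  obtain g2 where g2: "g2 \<in> borel_measurable lborel" "AE t in lborel. Im (k t) = g2 t"
    using completion_ex_borel_measurable_real[of "\<lambda>t. Im (k t)" lborel] k by auto
  define f where "f t = (if 0 < t then of_real (g1 t) + \<i> * of_real (g2 t) else 0)" for t
  have [measurable]: "g1 \<in> borel_measurable borel" "g2 \<in> borel_measurable borel" using g1 g2 by auto
  have fm[measurable]: "f \<in> borel_measurable borel" unfolding f_def by measurable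
  have ae: "AE t in lborel. f t = k t"
    using g1(2) g2(2) by eventually_elim (auto simp: f_def k_def complex_eq_iff)
  have "integrable lebesgue (\<lambda>t. indicator {0<..} t *\<^sub>R (cmod (h t))\<^sup>2)"
    using hi by (simp add: integrable_restrict_space)
  moreover have "indicator {0<..} t *\<^sub>R (cmod (h t))\<^sup>2 = (cmod (k t))\<^sup>2" for t by (simp add: k_def)
  ultimately have ik: "integrable lebesgue (\<lambda>t. (cmod (k t))\<^sup>2)" by simp
  have "integrable lebesgue (\<lambda>t. (cmod (f t))\<^sup>2)"
  proof (rule integrable_cong_AE_imp[OF ik])
    show "(\<lambda>t. (cmod (f t))\<^sup>2) \<in> borel_measurable lebesgue" by (intro measurable_completion) simp
    show "AE t in lebesgue. (cmod (k t))\<^sup>2 = (cmod (f t))\<^sup>2"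
      using AE_completion[OF ae] by eventually_elim simp
  qed
  then have "integrable lborel (\<lambda>t. (cmod (f t))\<^sup>2)" by (subst (asm) integrable_completion) auto
  then have "half_line f" by (simp add: half_line_def sq_integrable_def f_def)
  moreover have "AE t in lborel. 0 < t \<longrightarrow> f t = h t" using ae by eventually_elim (simp add: k_def)
  ultimately show thesis by (rule that)
qed

text \<open>Measurability of g is a conclusion here: Lebesgue measure is complete, so changes on
  null sets preserve it. This lets almost-everywhere defined expressions such as principal values
  represent a class.\<close>

lemma L2_fun_AE:
  assumes f: "f \<in> L2_fun" and ae: "AE t in lborel. 0 < t \<longrightarrow> f t = g t"
  shows "g \<in> L2_fun"
proof -
  have fm: "f \<in> borel_measurable Rplus" and fi: "integrable Rplus (\<lambda>t. (cmod (f t))\<^sup>2)"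
    using f by (auto simp: L2_fun_def)
  have "(\<lambda>t. if t \<in> {0<..} then f t else 0) \<in> borel_measurable lebesgue"
    using fm by (subst borel_measurable_if) auto
  moreover have "AE t in lebesgue. (if t \<in> {0<..} then f t else 0) = (if t \<in> {0<..} then g t else 0)"
    using AE_completion[OF ae] by eventually_elim simp
  ultimately have "(\<lambda>t. if t \<in> {0<..} then g t else 0) \<in> borel_measurable lebesgue"
    by (rule borel_measurable_AE)
  then have gm: "g \<in> borel_measurable Rplus" by (rule borel_measurable_if_D)
  have "integrable Rplus (\<lambda>t. (cmod (g t))\<^sup>2)"
  proof (rule integrable_cong_AE_imp[OF fi])
    show "(\<lambda>t. (cmod (g t))\<^sup>2) \<in> borel_measurable Rplus" using gm by measurable
    have "AE t in Rplus. f t = g t" using ae by (simp add: AE_Rplus)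
    then show "AE t in Rplus. (cmod (f t))\<^sup>2 = (cmod (g t))\<^sup>2" by eventually_elim simp
  qed
  then show ?thesis using gm by (simp add: L2_fun_def)
qed

lemma abs_L2_eq:
  assumes "f \<in> L2_fun" "AE t in lborel. 0 < t \<longrightarrow> f t = g t"
  shows "abs_L2 f = abs_L2 g"
  using assms L2_fun_AE[OF assms] by (intro Quotient_rel_abs[OF Quotient_L2]) (simp add: AE_Rplus)

lemma rep_L2_fun: "rep_L2 \<phi> \<in> L2_fun"
  using Quotient_rep_reflp[OF Quotient_L2, of \<phi>] by simp

lemma abs_rep_L2: "abs_L2 (rep_L2 \<phi>) = \<phi>"
  by (rule Quotient_abs_rep[OF Quotient_L2])

lemma rep_abs_L2:
  assumes "f \<in> L2_fun"
  shows "AE t in lborel. 0 < t \<longrightarrow> rep_L2 (abs_L2 f) t = f t"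
  using Quotient_rep_abs[OF Quotient_L2, of f] assms by (simp add: AE_Rplus)

lemma half_line_rep_L2:
  obtains f where "half_line f" "abs_L2 f = \<phi>" "AE t in lborel. 0 < t \<longrightarrow> f t = rep_L2 \<phi> t"
proof -
  obtain f where f: "half_line f" "AE t in lborel. 0 < t \<longrightarrow> f t = rep_L2 \<phi> t"
    using half_line_representative[OF rep_L2_fun] .
  moreover have "abs_L2 f = \<phi>" using abs_L2_eq[OF half_line_L2_fun(1)[OF f(1)] f(2)] by (simp add: abs_rep_L2)
  ultimately show thesis using that by blast
qed

lemma abs_L2_arith:
  assumes "f \<in> L2_fun" "g \<in> L2_fun"
  shows "abs_L2 f + abs_L2 g = abs_L2 (\<lambda>t. f t + g t)" "scaleC_L2 c (abs_L2 f) = abs_L2 (\<lambda>t. c * f t)"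
    "norm (abs_L2 f) = L2_norm_fun f"
  using assms by (simp_all add: plus_L2.abs_eq scaleC_L2.abs_eq norm_L2.abs_eq)

lemma abs_L2_diff:
  assumes "f \<in> L2_fun" "g \<in> L2_fun"
  shows "abs_L2 f - abs_L2 g = abs_L2 (\<lambda>t. f t - g t)"
  unfolding minus_L2_def uminus_L2_def
  using assms by (simp add: abs_L2_arith L2_fun_cmult[of g "-1", simplified])

section \<open>Operators on classes\<close>

definition lift_op :: "((real \<Rightarrow> complex) \<Rightarrow> real \<Rightarrow> complex) \<Rightarrow> L2 \<Rightarrow> L2" where
  "lift_op W \<phi> = abs_L2 (W (SOME f. half_line f \<and> abs_L2 f = \<phi>))"

locale half_line_operator =
  fixes W :: "(real \<Rightarrow> complex) \<Rightarrow> real \<Rightarrow> complex" and C :: real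
  assumes hl: "half_line f \<Longrightarrow> half_line (W f)"
    and lin: "half_line f \<Longrightarrow> half_line g \<Longrightarrow> AE x in lborel. W (\<lambda>t. a * f t + b * g t) x = a * W f x + b * W g x"
    and bd: "half_line f \<Longrightarrow> L2nrm (W f) \<le> C * L2nrm f"
begin

text \<open>Linearity and the norm bound, applied to f - g, force the images to agree almost
  everywhere; hence the representative chosen in \<open>lift_op\<close> is immaterial.\<close>

lemma W_cong:
  assumes f: "half_line f" and g: "half_line g" and eq: "abs_L2 f = abs_L2 g"
  shows "AE x in lborel. W f x = W g x"
proof -
  let ?d = "\<lambda>t. 1 * f t + (-1) * g t"
  have d: "half_line ?d" by (rule half_line_lin[OF f g])
  have "AE t in lborel. 0 < t \<longrightarrow> f t = g t"
    using rep_abs_L2[OF half_line_L2_fun(1)[OF f]] rep_abs_L2[OF half_line_L2_fun(1)[OF g]]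
    by eventually_elim (simp add: eq)
  then have "AE t in lborel. ?d t = 0"
    by eventually_elim (metis (no_types, lifting) add.right_inverse f g half_lineD(2) mult_1 mult_minus1 not_le)
  then have "L2nrm ?d = L2nrm (\<lambda>t. 0)"
    using sq_integrable_measurable[OF half_lineD(1)[OF d]] by (intro L2nrm_cong_AE) auto
  then have "L2nrm (W ?d) \<le> 0" using bd[OF d] by (simp add: L2nrm_def)
  then have "L2nrm (W ?d) = 0" using L2nrm_nonneg[of "W ?d"] by linarith
  then have "(LBINT t. (cmod (W ?d t))\<^sup>2) = 0" by (metis L2nrm_sq power_zero_numeral)
  then have "AE t in lborel. (cmod (W ?d t))\<^sup>2 = 0"
    using half_lineD(1)[OF hl[OF d]] by (subst (asm) integral_nonneg_eq_0_iff_AE) (auto simp: sq_integrable_def)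
  then show ?thesis using lin[OF f g, of 1 "-1"] by eventually_elim simp
qed

lemma lift_op_abs:
  assumes f: "half_line f"
  shows "lift_op W (abs_L2 f) = abs_L2 (W f)"
proof -
  define g where "g = (SOME g. half_line g \<and> abs_L2 g = abs_L2 f)"
  have g: "half_line g" "abs_L2 g = abs_L2 f"
    using someI[of "\<lambda>g. half_line g \<and> abs_L2 g = abs_L2 f" f] f unfolding g_def by auto
  have "abs_L2 (W g) = abs_L2 (W f)"
  proof (rule abs_L2_eq[OF half_line_L2_fun(1)[OF hl[OF g(1)]]])
    show "AE t in lborel. 0 < t \<longrightarrow> W g t = W f t"
      using W_cong[OF g(1) f g(2)] by eventually_elim simp
  qed
  then show ?thesis by (simp add: lift_op_def g_def)
qed

lemma lift_op_bounded: "bounded_operator (lift_op W)"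
  unfolding bounded_operator_def
proof (intro conjI allI)
  have add: "lift_op W (\<phi> + \<psi>) = lift_op W \<phi> + lift_op W \<psi>" for \<phi> \<psi>
  proof -
    obtain f where f: "half_line f" "abs_L2 f = \<phi>" by (rule half_line_rep_L2)
    obtain g where g: "half_line g" "abs_L2 g = \<psi>" by (rule half_line_rep_L2)
    have s: "half_line (\<lambda>t. f t + g t)" using half_line_lin[OF f(1) g(1), of 1 1] by simp
    note l = half_line_L2_fun(1)
    have "\<phi> + \<psi> = abs_L2 (\<lambda>t. f t + g t)" using abs_L2_arith(1)[OF l[OF f(1)] l[OF g(1)]] f g by simp
    then have "lift_op W (\<phi> + \<psi>) = abs_L2 (W (\<lambda>t. f t + g t))" using lift_op_abs[OF s] by simp
    also have "\<dots> = abs_L2 (\<lambda>t. W f t + W g t)"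
    proof (rule abs_L2_eq[OF l[OF hl[OF s]]])
      show "AE t in lborel. 0 < t \<longrightarrow> W (\<lambda>t. f t + g t) t = W f t + W g t"
        using lin[OF f(1) g(1), of 1 1] by eventually_elim simp
    qed
    also have "\<dots> = lift_op W \<phi> + lift_op W \<psi>"
      using abs_L2_arith(1)[OF l[OF hl[OF f(1)]] l[OF hl[OF g(1)]]] lift_op_abs[OF f(1)] lift_op_abs[OF g(1)] f g by simp
    finally show ?thesis .
  qed
  have scale: "lift_op W (scaleC_L2 c \<phi>) = scaleC_L2 c (lift_op W \<phi>)" for c \<phi>
  proof -
    obtain f where f: "half_line f" "abs_L2 f = \<phi>" by (rule half_line_rep_L2)
    have s: "half_line (\<lambda>t. c * f t)" using half_line_lin[OF f(1) f(1), of c 0] by simp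
    note l = half_line_L2_fun(1)
    have "scaleC_L2 c \<phi> = abs_L2 (\<lambda>t. c * f t)" using abs_L2_arith(2)[OF l[OF f(1)] l[OF f(1)]] f by simp
    then have "lift_op W (scaleC_L2 c \<phi>) = abs_L2 (W (\<lambda>t. c * f t))" using lift_op_abs[OF s] by simp
    also have "\<dots> = abs_L2 (\<lambda>t. c * W f t)"
    proof (rule abs_L2_eq[OF l[OF hl[OF s]]])
      show "AE t in lborel. 0 < t \<longrightarrow> W (\<lambda>t. c * f t) t = c * W f t"
        using lin[OF f(1) f(1), of c 0] by eventually_elim simp
    qed
    also have "\<dots> = scaleC_L2 c (lift_op W \<phi>)"
      using abs_L2_arith(2)[OF l[OF hl[OF f(1)]] l[OF hl[OF f(1)]]] lift_op_abs[OF f(1)] f by simp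
    finally show ?thesis .
  qed
  then show "lift_op W (scaleC_L2 c \<phi>) = scaleC_L2 c (lift_op W \<phi>)" for c \<phi> .
  show "bounded_linear (lift_op W)"
  proof (rule bounded_linear_intro[where K=C])
    show "lift_op W (\<phi> + \<psi>) = lift_op W \<phi> + lift_op W \<psi>" for \<phi> \<psi> by (rule add)
    show "lift_op W (r *\<^sub>R \<phi>) = r *\<^sub>R lift_op W \<phi>" for r \<phi> unfolding scaleR_L2_def by (rule scale)
    show "norm (lift_op W \<phi>) \<le> norm \<phi> * C" for \<phi>
    proof -
      obtain f where f: "half_line f" "abs_L2 f = \<phi>" by (rule half_line_rep_L2)
      have "norm (lift_op W \<phi>) = L2nrm (W f)" "norm \<phi> = L2nrm f"
        using f lift_op_abs[OF f(1)] abs_L2_arith(3) half_line_L2_fun hl[OF f(1)] by metis+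
      then show ?thesis using bd[OF f(1)] by (simp add: mult.commute)
    qed
  qed
qed

end

lemma half_line_operator_affine:
  assumes \<alpha>: "\<bar>Re \<alpha>\<bar> < 1/2"
  shows "half_line_operator (\<lambda>f t. a * f t + b * wboundary \<alpha> f t)
    (cmod a + cmod b * (2 + weight_const \<alpha> * (2 / (1/2 - mid_exponent \<alpha>)) / pi))"
proof
  fix f assume f: "half_line f"
  note W = wboundary_half_line[OF \<alpha> f]
  show "half_line (\<lambda>t. a * f t + b * wboundary \<alpha> f t)" by (rule half_line_lin[OF f W(1)])
  have "L2nrm (\<lambda>t. a * f t + b * wboundary \<alpha> f t) \<le> L2nrm (\<lambda>t. a * f t) + L2nrm (\<lambda>t. b * wboundary \<alpha> f t)"
    by (intro L2nrm_triangle sq_integrable_cmult half_lineD(1) f W)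
  also have "\<dots> = cmod a * L2nrm f + cmod b * L2nrm (wboundary \<alpha> f)" by (simp only: L2nrm_cmult)
  also have "\<dots> \<le> cmod a * L2nrm f + cmod b * ((2 + weight_const \<alpha> * (2 / (1/2 - mid_exponent \<alpha>)) / pi) * L2nrm f)"
    by (intro add_left_mono mult_left_mono W) auto
  finally show "L2nrm (\<lambda>t. a * f t + b * wboundary \<alpha> f t) \<le> (cmod a + cmod b * (2 + weight_const \<alpha> * (2 / (1/2 - mid_exponent \<alpha>)) / pi)) * L2nrm f"
    by (simp only: distrib_right mult.assoc)
  fix g :: "real \<Rightarrow> complex" and c d :: complex assume g: "half_line g"
  show "AE x in lborel. a * (c * f x + d * g x) + b * wboundary \<alpha> (\<lambda>t. c * f t + d * g t) x
     = c * (a * f x + b * wboundary \<alpha> f x) + d * (a * g x + b * wboundary \<alpha> g x)"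
    using wboundary_lin[OF \<alpha> f g, of c d] by eventually_elim (simp add: algebra_simps)
qed

text \<open>The integrand g is prescribed only at points s > 0 other than x, since any symmetric
  truncation removes x; this permits a representative r that agrees with f only almost everywhere.
  The constant c serves to reverse the sign of the denominator.\<close>

lemma principal_value_transfer:
  assumes f: "half_line f" and rf: "AE t in lborel. 0 < t \<longrightarrow> f t = r t"
    and x: "0 < x" and g: "\<And>s. 0 < s \<Longrightarrow> s \<noteq> x \<Longrightarrow> g s = c * (cpow (- \<alpha>) s * r s / of_real (s - x))"
    and int: "\<And>\<epsilon>. \<epsilon> > 0 \<Longrightarrow> integrable lborel (\<lambda>t. truncated_kernel \<epsilon> x t * (cpow (- \<alpha>) t * f t))"
    and lim: "((\<lambda>\<epsilon>. LBINT t. truncated_kernel \<epsilon> x t * (cpow (- \<alpha>) t * f t)) \<longlongrightarrow> l) (at_right 0)"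
  shows "has_principal_value g x (c * l)"
proof -
  let ?A = "\<lambda>\<epsilon>. {t. 0 < t \<and> \<epsilon> < \<bar>t - x\<bar>}"
  let ?k = "\<lambda>\<epsilon> t. c * (truncated_kernel \<epsilon> x t * (cpow (- \<alpha>) t * f t))"
  have [measurable]: "f \<in> borel_measurable borel" using half_lineD(1)[OF f] by (simp add: sq_integrable_def)
  have ae: "AE t in lebesgue. ?k \<epsilon> t = indicator (?A \<epsilon>) t *\<^sub>R g t" if "\<epsilon> > 0" for \<epsilon>
    using AE_completion[OF rf]
  proof eventually_elim
    case (elim t)
    show ?case
    proof (cases "t \<in> ?A \<epsilon>")
      case True
      then have "t \<noteq> x" using that by auto
      then show ?thesis using True elim g[of t] by (simp add: truncated_kernel_def mult_ac)
    next
      case False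
      then show ?thesis using half_lineD(2)[OF f, of t] by (auto simp: truncated_kernel_def)
    qed
  qed
  have km: "?k \<epsilon> \<in> borel_measurable borel" for \<epsilon> by measurable
  have km': "?k \<epsilon> \<in> borel_measurable lebesgue" for \<epsilon> using km by (intro measurable_completion) simp
  have gm: "(\<lambda>t. indicator (?A \<epsilon>) t *\<^sub>R g t) \<in> borel_measurable lebesgue" if "\<epsilon> > 0" for \<epsilon>
    by (rule borel_measurable_AE[OF km' ae[OF that]])
  have ki: "integrable lebesgue (?k \<epsilon>)" if "\<epsilon> > 0" for \<epsilon>
    using int[OF that] km[of \<epsilon>] by (subst integrable_completion) auto
  have "set_integrable lebesgue (?A \<epsilon>) g" if "\<epsilon> > 0" for \<epsilon>
    unfolding set_integrable_def by (rule integrable_cong_AE_imp[OF ki[OF that] gm[OF that] ae[OF that]])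
  moreover have "((\<lambda>\<epsilon>. LINT t:?A \<epsilon>|lebesgue. g t) \<longlongrightarrow> c * l) (at_right 0)"
  proof (rule Lim_transform_eventually)
    show "((\<lambda>\<epsilon>. c * (LBINT t. truncated_kernel \<epsilon> x t * (cpow (- \<alpha>) t * f t))) \<longlongrightarrow> c * l) (at_right 0)"
      by (intro tendsto_mult tendsto_const lim)
    show "\<forall>\<^sub>F \<epsilon> in at_right 0. c * (LBINT t. truncated_kernel \<epsilon> x t * (cpow (- \<alpha>) t * f t)) = (LINT t:?A \<epsilon>|lebesgue. g t)"
      using eventually_at_right_less[of "0::real"]
    proof eventually_elim
      case (elim \<epsilon>)
      have "(LINT t:?A \<epsilon>|lebesgue. g t) = (LINT t|lebesgue. ?k \<epsilon> t)"
        unfolding set_lebesgue_integral_def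
      proof (rule integral_cong_AE[OF gm[OF elim] km'])
        show "AE t in lebesgue. indicator (?A \<epsilon>) t *\<^sub>R g t = ?k \<epsilon> t" using ae[OF elim] by eventually_elim simp
      qed
      also have "\<dots> = (LBINT t. ?k \<epsilon> t)" using km[of \<epsilon>] by (intro integral_completion) simp
      finally show ?case by (simp only: integral_mult_right_zero)
    qed
  qed
  ultimately show ?thesis unfolding has_principal_value_def by blast
qed

lemma principal_value_eqI:
  assumes "has_principal_value g x l" shows "principal_value g x = l"
  unfolding principal_value_def
proof (rule the_equality)
  show "has_principal_value g x l" by (rule assms)
  fix l' assume "has_principal_value g x l'"
  then have "((\<lambda>\<epsilon>. LINT t:{t. 0 < t \<and> \<epsilon> < \<bar>t - x\<bar>}|lebesgue. g t) \<longlongrightarrow> l') (at_right 0)"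
    by (simp only: has_principal_value_def)
  moreover have "((\<lambda>\<epsilon>. LINT t:{t. 0 < t \<and> \<epsilon> < \<bar>t - x\<bar>}|lebesgue. g t) \<longlongrightarrow> l) (at_right 0)"
    using assms by (simp only: has_principal_value_def)
  ultimately show "l' = l" by (rule tendsto_unique[OF trivial_limit_at_right_real])
qed

lemma weighted_principal_value_exists:
  assumes \<alpha>: "\<bar>Re \<alpha>\<bar> < 1/2" and f: "half_line f" and rf: "AE t in lborel. 0 < t \<longrightarrow> f t = r t"
    and g: "\<And>x s. 0 < x \<Longrightarrow> 0 < s \<Longrightarrow> s \<noteq> x \<Longrightarrow> g x s = c * (cpow (- \<alpha>) s * r s / of_real (s - x))"
  shows "AE x in lborel. 0 < x \<longrightarrow>
    has_principal_value (g x) x (c * (cpow (- \<alpha>) x * (of_real pi * \<i> * (wboundary \<alpha> f x - f x))))"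
  using weighted_principal_value[OF \<alpha> f]
proof eventually_elim
  case (elim x)
  show ?case
  proof
    assume x: "0 < x"
    let ?I = "\<lambda>\<epsilon>. LBINT t. truncated_kernel \<epsilon> x t * (cpow (- \<alpha>) t * f t)"
    have "((\<lambda>\<epsilon>. cpow (- \<alpha>) x * (cpow \<alpha> x * ?I \<epsilon>)) \<longlongrightarrow> cpow (- \<alpha>) x * (of_real pi * \<i> * (wboundary \<alpha> f x - f x))) (at_right 0)"
      using elim x by (intro tendsto_mult_left) auto
    moreover have "cpow (- \<alpha>) x * (cpow \<alpha> x * y) = y" for y
      using cpow_minus[of \<alpha> x] by (metis mult.assoc mult.commute mult_1)
    ultimately have lim: "(?I \<longlongrightarrow> cpow (- \<alpha>) x * (of_real pi * \<i> * (wboundary \<alpha> f x - f x))) (at_right 0)" by simp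
    show "has_principal_value (g x) x (c * (cpow (- \<alpha>) x * (of_real pi * \<i> * (wboundary \<alpha> f x - f x))))"
      by (rule principal_value_transfer[OF f rf x g[OF x] _ lim]) (use elim x in auto)
  qed
qed

lemma S_Rplus_eq:
  assumes f: "half_line f"
  shows "S_Rplus (abs_L2 f) = abs_L2 (\<lambda>t. wboundary 0 f t - f t)"
proof -
  let ?r = "rep_L2 (abs_L2 f)"
  have z: "\<bar>Re 0\<bar> < 1/2" by simp
  have rf: "AE t in lborel. 0 < t \<longrightarrow> f t = ?r t"
    using rep_abs_L2[OF half_line_L2_fun(1)[OF f]] by eventually_elim simp
  have W: "half_line (\<lambda>t. wboundary 0 f t - f t)"
    using half_line_lin[OF wboundary_half_line(1)[OF z f] f, of 1 "-1"] by simp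
  have "abs_L2 (\<lambda>t. wboundary 0 f t - f t) = S_Rplus (abs_L2 f)"
    unfolding S_Rplus_def
  proof (rule abs_L2_eq[OF half_line_L2_fun(1)[OF W]])
    have "AE x in lborel. 0 < x \<longrightarrow> has_principal_value (\<lambda>t. ?r t / of_real (t - x)) x (1 * (cpow (- 0) x * (of_real pi * \<i> * (wboundary 0 f x - f x))))"
      by (rule weighted_principal_value_exists[OF z f rf]) simp
    then show "AE x in lborel. 0 < x \<longrightarrow> wboundary 0 f x - f x = 1 / (of_real pi * \<i>) * principal_value (\<lambda>t. ?r t / of_real (t - x)) x"
      by eventually_elim (auto dest!: principal_value_eqI)
  qed
  then show ?thesis by simp
qed

section \<open>Invertibility and the inversion formula\<close>

theorem mainTheorem4:
  fixes lam \<alpha> :: complex and T :: "L2 \<Rightarrow> L2"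
  assumes "lam \<notin> complex_of_real ` {-1..1}"
    and "\<alpha> = 1 / (2 * of_real pi * \<i>) * Ln ((lam - 1) / (lam + 1))"
    and "T = (\<lambda>\<phi>. S_Rplus \<phi> - scaleC_L2 lam \<phi>)"
  shows "\<bar>Re \<alpha>\<bar> < 1 / 2 \<and>
    invertible_operator T \<and>
    (- 1 / 2 < Re \<alpha> \<and> Re \<alpha> < 0 \<longrightarrow>
      (\<forall>f :: L2. AE t in Rplus. \<exists>l.
        has_principal_value (\<lambda>s. rep_L2 f s / (of_real (t - s) * of_real s powr \<alpha>)) t l \<and>
        rep_L2 (inv T f) t =
          1 / (1 - lam\<^sup>2) * (lam * rep_L2 f t - of_real t powr \<alpha> / (\<i> * of_real pi) * l)))"
proof -
  define w where "w = (lam - 1) / (lam + 1)"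
  have lam: "lam \<noteq> 1" "lam \<noteq> -1"
    using assms(1) by (auto simp: image_iff dest: bspec[of _ _ 1] bspec[of _ _ "-1"])
  have nz: "lam + 1 \<noteq> 0" "lam - 1 \<noteq> 0" using lam by (auto simp: add_eq_0_iff2)
  have w0: "w \<noteq> 0" using nz by (simp add: w_def)
  \<comment> \<open>The Moebius map lam -> (lam - 1)/(lam + 1) has inverse w -> (1 + w)/(1 - w),
    which sends nonpositive reals into [-1, 1]. Off this segment w therefore avoids the cut, so |Im
    (Ln w)| is strictly below \<pi> and |Re \<alpha>| strictly below 1/2.\<close>
  have wn: "w \<notin> \<real>\<^sub>\<le>\<^sub>0"
  proof
    assume "w \<in> \<real>\<^sub>\<le>\<^sub>0"
    then obtain y :: real where y: "w = of_real y" "y \<le> 0" by (auto elim: nonpos_Reals_cases)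
    have "w * (lam + 1) = lam - 1" using nz by (simp add: w_def)
    then have "lam * (1 - w) = 1 + w" by (simp add: algebra_simps)
    then have "lam = (1 + w) / (1 - w)" using y by (simp add: field_simps)
    then have "lam = of_real ((1 + y) / (1 - y))" by (simp add: y(1))
    moreover have "(1 + y) / (1 - y) \<in> {-1..1}" using y(2) by (auto simp: field_simps)
    ultimately have "lam \<in> complex_of_real ` {-1..1}" by (rule image_eqI)
    then show False using assms(1) by contradiction
  qed
  have \<alpha>w: "2 * of_real pi * \<i> * \<alpha> = Ln w"
    unfolding assms(2) w_def[symmetric] by simp
  have "Im (Ln w) = 2 * pi * Re \<alpha>" unfolding \<alpha>w[symmetric] by simp
  then have Re\<alpha>: "Re \<alpha> = Im (Ln w) / (2 * pi)" by simp
  have "\<bar>Im (Ln w)\<bar> < pi"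
    using wn w0 Im_Ln_le_pi[OF w0] mpi_less_Im_Ln[OF w0] Im_Ln_eq_pi[OF w0] by (auto simp: complex_nonpos_Reals_iff)
  then have \<alpha>: "\<bar>Re \<alpha>\<bar> < 1/2" unfolding Re\<alpha> using pi_gt_zero by (simp add: abs_divide field_simps)
  have q: "exp (2 * of_real pi * \<i> * \<alpha>) = (lam - 1) / (lam + 1)"
    unfolding \<alpha>w using w0 by (simp add: w_def)
  \<comment> \<open>Sign check: for large lam the leading term c lam is asymptotic to -1/lam, as it
    must be for the inverse of S - lam.\<close>
  define c where "c = 1 / (1 - lam\<^sup>2)"
  define A where "A = (\<lambda>f t. (- (1 + lam)) * f t + 1 * wboundary 0 f t)"
  define R where "R = (\<lambda>f t. (c * (lam - 1)) * f t + c * wboundary \<alpha> f t)"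
  have z: "\<bar>Re 0\<bar> < 1/2" by simp
  interpret PA: half_line_operator A "cmod (- (1 + lam)) + cmod 1 * (2 + weight_const 0 * (2 / (1/2 - mid_exponent 0)) / pi)"
    unfolding A_def by (rule half_line_operator_affine[OF z])
  interpret PR: half_line_operator R "cmod (c * (lam - 1)) + cmod c * (2 + weight_const \<alpha> * (2 / (1/2 - mid_exponent \<alpha>)) / pi)"
    unfolding R_def by (rule half_line_operator_affine[OF \<alpha>])
  have T_abs: "T (abs_L2 f) = abs_L2 (A f)" if f: "half_line f" for f
  proof -
    note l = half_line_L2_fun(1)
    have W: "half_line (\<lambda>t. wboundary 0 f t - f t)"
      using half_line_lin[OF wboundary_half_line(1)[OF z f] f, of 1 "-1"] by simp
    have "T (abs_L2 f) = abs_L2 (\<lambda>t. (wboundary 0 f t - f t) - lam * f t)"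
      unfolding assms(3) S_Rplus_eq[OF f] abs_L2_arith(2)[OF l[OF f] l[OF f]]
      by (rule abs_L2_diff[OF l[OF W] L2_fun_cmult[OF l[OF f]]])
    also have "(\<lambda>t. (wboundary 0 f t - f t) - lam * f t) = A f" by (auto simp: A_def algebra_simps)
    finally show ?thesis .
  qed
  have T: "T = lift_op A"
  proof
    fix \<phi>
    obtain f where f: "half_line f" "abs_L2 f = \<phi>" by (rule half_line_rep_L2)
    show "T \<phi> = lift_op A \<phi>" using T_abs[OF f(1)] PA.lift_op_abs[OF f(1)] f(2) by simp
  qed
  have res: "AE x in lborel. A (R f) x = f x" "AE x in lborel. R (A f) x = f x" if "half_line f" for f
    using resolvent[OF \<alpha> q lam c_def that] unfolding A_def R_def by (simp_all add: add.commute)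
  have RT: "lift_op R (T \<phi>) = \<phi>" and TR: "T (lift_op R \<phi>) = \<phi>" for \<phi>
  proof -
    obtain f where f: "half_line f" "abs_L2 f = \<phi>" by (rule half_line_rep_L2)
    have "lift_op R (T \<phi>) = abs_L2 (R (A f))"
      using T_abs[OF f(1)] PR.lift_op_abs[OF PA.hl[OF f(1)]] f(2) by simp
    also have "\<dots> = abs_L2 f"
      using res(2)[OF f(1)] by (intro abs_L2_eq half_line_L2_fun PR.hl PA.hl f) auto
    finally show "lift_op R (T \<phi>) = \<phi>" by (simp add: f)
    have "T (lift_op R \<phi>) = abs_L2 (A (R f))"
      using T_abs[OF PR.hl[OF f(1)]] PR.lift_op_abs[OF f(1)] f(2) by simp
    also have "\<dots> = abs_L2 f"
      using res(1)[OF f(1)] by (intro abs_L2_eq half_line_L2_fun PR.hl PA.hl f) auto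
    finally show "T (lift_op R \<phi>) = \<phi>" by (simp add: f)
  qed
  have inv: "invertible_operator T"
    unfolding invertible_operator_def
  proof (intro conjI exI[of _ "lift_op R"])
    show "bounded_operator T" unfolding T by (rule PA.lift_op_bounded)
    show "bounded_operator (lift_op R)" by (rule PR.lift_op_bounded)
  qed (auto simp: RT TR)
  have invT: "inv T = lift_op R"
    by (rule inv_unique_comp) (auto simp: RT TR)
  have formula: "AE t in Rplus. \<exists>l.
        has_principal_value (\<lambda>s. rep_L2 \<phi> s / (of_real (t - s) * of_real s powr \<alpha>)) t l \<and>
        rep_L2 (inv T \<phi>) t =
          1 / (1 - lam\<^sup>2) * (lam * rep_L2 \<phi> t - of_real t powr \<alpha> / (\<i> * of_real pi) * l)" for \<phi>
  proof -
    obtain f where f: "half_line f" "abs_L2 f = \<phi>" "AE t in lborel. 0 < t \<longrightarrow> f t = rep_L2 \<phi> t" by (rule half_line_rep_L2)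
    have "AE t in lborel. 0 < t \<longrightarrow> has_principal_value (\<lambda>s. rep_L2 \<phi> s / (of_real (t - s) * of_real s powr \<alpha>)) t
        ((-1) * (cpow (- \<alpha>) t * (of_real pi * \<i> * (wboundary \<alpha> f t - f t))))"
    proof (rule weighted_principal_value_exists[OF \<alpha> f(1,3)])
      fix t s :: real assume ts: "0 < t" "0 < s" "s \<noteq> t"
      have e1: "cpow (- \<alpha>) s = 1 / cpow \<alpha> s" using cpow_minus[of \<alpha> s] by (simp add: field_simps)
      have e2: "complex_of_real (t - s) = - of_real (s - t)" by simp
      have "y / (- D * P) = (-1) * (1 / P * y / D)" for y D P :: complex by simp
      then show "rep_L2 \<phi> s / (of_real (t - s) * of_real s powr \<alpha>) = (-1) * (cpow (- \<alpha>) s * rep_L2 \<phi> s / of_real (s - t))"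
        unfolding cpow_powr[OF ts(2)] e1 e2 .
    qed
    moreover have "AE t in lborel. 0 < t \<longrightarrow> rep_L2 (inv T \<phi>) t = R f t"
      using rep_abs_L2[OF half_line_L2_fun(1)[OF PR.hl[OF f(1)]]] PR.lift_op_abs[OF f(1)] by (simp add: invT f(2))
    ultimately have "AE t in lborel. 0 < t \<longrightarrow> (\<exists>l.
        has_principal_value (\<lambda>s. rep_L2 \<phi> s / (of_real (t - s) * of_real s powr \<alpha>)) t l \<and>
        rep_L2 (inv T \<phi>) t = 1 / (1 - lam\<^sup>2) * (lam * rep_L2 \<phi> t - of_real t powr \<alpha> / (\<i> * of_real pi) * l))"
      using f(3)
    proof eventually_elim
      case (elim t)
      show ?case
      proof
        assume t: "0 < t"
        \<comment> \<open>The factor -1 comes from the denominator t - s in place of s - t.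
          Multiplication by t^\<alpha> cancels t^(-\<alpha>), so subtracting the integral term adds
          \<open>wboundary \<alpha> f t - f t\<close> to lam f(t), which gives
          \<open>R f t\<close>.\<close>
        define l where "l = (-1) * (cpow (- \<alpha>) t * (of_real pi * \<i> * (wboundary \<alpha> f t - f t)))"
        have "of_real t powr \<alpha> / (\<i> * of_real pi) * l = - (cpow \<alpha> t * cpow (- \<alpha>) t) * (wboundary \<alpha> f t - f t)"
          unfolding cpow_powr[OF t] l_def by (simp add: field_simps)
        then have l: "of_real t powr \<alpha> / (\<i> * of_real pi) * l = - (wboundary \<alpha> f t - f t)" by (simp only: cpow_minus) simp
        have "f t = rep_L2 \<phi> t" using elim(3) t by simp
        then have "1 / (1 - lam\<^sup>2) * (lam * rep_L2 \<phi> t - of_real t powr \<alpha> / (\<i> * of_real pi) * l) = R f t"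
          unfolding l R_def c_def[symmetric] by (simp add: algebra_simps)
        then show "\<exists>l. has_principal_value (\<lambda>s. rep_L2 \<phi> s / (of_real (t - s) * of_real s powr \<alpha>)) t l \<and>
          rep_L2 (inv T \<phi>) t = 1 / (1 - lam\<^sup>2) * (lam * rep_L2 \<phi> t - of_real t powr \<alpha> / (\<i> * of_real pi) * l)"
          using elim(1,2) t unfolding l_def[symmetric] by (intro exI[of _ l]) simp
      qed
    qed
    then show ?thesis unfolding AE_Rplus .
  qed
  show ?thesis using \<alpha> inv formula by blast
qed

end
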